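(* For $\mu_d$-almost every $\Lambda\in X_d$, $$\limsup_{\|T\|_\infty\to\infty}\; -\frac{\log c_{B_T}(\Lambda)}{\log\log\|T\|_\infty}\;\ge\;\frac{d-1}{d},$$ where the limsup is taken over $T\in\mathscr{T}_d$.
   Context: $X_d$ is the space of lattices in $\mathbb{R}^d$ of covolume one, and $\mu_d$ is the unique $\mathrm{SL}_d(\mathbb{R})$-invariant Borel probability measure on $X_d$. Set $\mathscr{T}_d=\{T=(T_1,\ldots,T_d): T_p>0,\ T_1\cdots T_d=1\}$, $\|T\|_\infty=\max_p T_p$, and for $T\in\mathscr{T}_d$ let $B_T=\prod_{p=1}^d[-T_p,T_p]\subset\mathbb{R}^d$. For a compact convex symmetric set $B\subset\mathbb{R}^d$ with non-empty interior and $\Lambda\in X_d$, $c_B(\Lambda)=\inf\{c>0:\ \Lambda\cap cB\ne\{0\}\}$, i.e. the infimum of those $c>0$ for which $cB$ contains a nonzero vector of $\Lambda$. *)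

theory Defs
  imports "HOL-Analysis.Analysis" "HOL-Probability.Probability"
begin

text \<open>Throughout, the dimension \<open>d\<close> is \<open>CARD('n)\<close>.\<close>

definition integer_vectors :: "(real^'n) set" where
  "integer_vectors = {z. \<forall>i. z $ i \<in> \<int>}"

text \<open>The integer span of the columns of \<open>A\<close>; a lattice when \<open>A\<close> is invertible.\<close>

definition lattice_of :: "real^'n^'n \<Rightarrow> (real^'n) set" where
  "lattice_of A = (*v) A ` integer_vectors"

text \<open>The space \<open>X\<^sub>d\<close>: the covolume of \<open>lattice_of A\<close> is \<open>\<bar>det A\<bar>\<close>.\<close>

definition unimodular_lattices :: "(real^'n) set set" where
  "unimodular_lattices = {\<Lambda>. \<exists>A. \<bar>det A\<bar> = 1 \<and> \<Lambda> = lattice_of A}"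

definition special_linear :: "(real^'n^'n) set" where
  "special_linear = {A. det A = 1}"

text \<open>The topology of \<open>X\<^sub>d = SL\<^sub>d(\<real>) / SL\<^sub>d(\<int>)\<close>: the quotient topology under the map
  sending \<open>g\<close> to \<open>g \<int>\<^sup>d\<close>; see \<open>quotient_map_lattice_of\<close> below.\<close>

definition lattice_topology :: "(real^'n) set topology" where
  "lattice_topology = topology (\<lambda>U. U \<subseteq> unimodular_lattices \<and>
     openin (top_of_set special_linear) {g \<in> special_linear. lattice_of g \<in> U})"

lemma openin_lattice_topology:
  fixes U :: "(real^'n) set set"
  shows "openin lattice_topology U \<longleftrightarrow> U \<subseteq> unimodular_lattices \<and>
     openin (top_of_set special_linear) {g \<in> special_linear. lattice_of g \<in> U}"
proof -
  let ?L = "\<lambda>U::(real^'n) set set. U \<subseteq> unimodular_lattices \<and>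
     openin (top_of_set special_linear) {g \<in> special_linear. lattice_of g \<in> U}"
  have "?L (S \<inter> T)" if "?L S" "?L T" for S T
  proof -
    have "{g \<in> special_linear. lattice_of g \<in> S \<inter> T} =
        {g \<in> special_linear. lattice_of g \<in> S} \<inter> {g \<in> special_linear. lattice_of g \<in> T}"
      by auto
    then show ?thesis using that by auto
  qed
  moreover have "?L (\<Union>K)" if "\<forall>S\<in>K. ?L S" for K
  proof -
    have "{g \<in> special_linear. lattice_of g \<in> \<Union>K} =
        (\<Union>S\<in>K. {g \<in> special_linear. lattice_of g \<in> S})"
      by auto
    then show ?thesis using that by auto
  qed
  ultimately have "istopology ?L"
    unfolding istopology_def by blast
  then show ?thesis
    unfolding lattice_topology_def by (subst topology_inverse') auto
qed

lemma unimodular_lattices_eq_image: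
  "unimodular_lattices = lattice_of ` (special_linear :: (real^'n^'n) set)"
proof -
  have "\<exists>B. det B = 1 \<and> lattice_of A = lattice_of B" if "det A = -1" for A :: "real^'n^'n"
  proof -
    fix k :: 'n
    define D :: "real^'n^'n" where
      "D = (\<chi> i j. if i = j then (if i = k then -1 else 1) else 0)"
    have D: "D *v x = (\<chi> i. if i = k then - x $ i else x $ i)" for x
      by (simp add: D_def vec_eq_iff matrix_vector_mult_def if_distrib [of "\<lambda>a. a * _"] cong: if_cong)
    have "det D = (\<Prod>i\<in>UNIV. D $ i $ i)"
      by (rule det_diagonal) (simp add: D_def)
    then have "det D = -1"
      by (simp add: D_def)
    then have "det (A ** D) = 1"
      using that by (simp add: det_mul)
    moreover have "(*v) D ` integer_vectors = integer_vectors"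
    proof (intro equalityI subsetI)
      fix x :: "real^'n" assume x: "x \<in> integer_vectors"
      have "x = D *v (D *v x)" by (simp add: D vec_eq_iff)
      moreover have "D *v x \<in> integer_vectors"
        using x by (auto simp: D integer_vectors_def)
      ultimately show "x \<in> (*v) D ` integer_vectors" by blast
    qed (auto simp: D integer_vectors_def)
    then have "lattice_of (A ** D) = lattice_of A"
      by (metis (no_types, lifting) lattice_of_def image_image image_cong matrix_vector_mul_assoc)
    ultimately show ?thesis by metis
  qed
  note flip = this
  show ?thesis
  proof (intro equalityI subsetI)
    fix \<Lambda> :: "(real^'n) set" assume "\<Lambda> \<in> unimodular_lattices"
    then obtain A where A: "\<bar>det A\<bar> = 1" "\<Lambda> = lattice_of A"
      by (auto simp: unimodular_lattices_def)
    then have "det A = 1 \<or> det A = -1" by arith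
    then show "\<Lambda> \<in> lattice_of ` special_linear"
      using flip [of A] A(2) by (auto simp: special_linear_def)
  qed (force simp: unimodular_lattices_def special_linear_def)
qed

lemma topspace_lattice_topology:
  "topspace lattice_topology = (unimodular_lattices :: (real^'n) set set)"
proof -
  have "{g \<in> special_linear. lattice_of g \<in> unimodular_lattices} = (special_linear :: (real^'n^'n) set)"
    by (auto simp: unimodular_lattices_eq_image)
  then have "openin lattice_topology (unimodular_lattices :: (real^'n) set set)"
    unfolding openin_lattice_topology by simp
  then show ?thesis
    by (meson openin_lattice_topology openin_subset openin_topspace subset_antisym)
qed

lemma quotient_map_lattice_of:
  "quotient_map (top_of_set special_linear) lattice_topology lattice_of"
  unfolding quotient_map_def
  by (simp add: topspace_lattice_topology unimodular_lattices_eq_image openin_lattice_topology)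

definition lattice_borel :: "(real^'n) set measure" where
  "lattice_borel = sigma unimodular_lattices {U. openin lattice_topology U}"

text \<open>The \<open>SL\<^sub>d(\<real>)\<close>-invariant Borel probability measures on \<open>X\<^sub>d\<close>; it is a classical fact
  that there is exactly one, denoted \<open>\<mu>\<^sub>d\<close>.\<close>

definition invariant_lattice_measure :: "(real^'n) set measure \<Rightarrow> bool" where
  "invariant_lattice_measure \<mu> \<longleftrightarrow> prob_space \<mu> \<and> sets \<mu> = sets lattice_borel \<and>
     (\<forall>g\<in>special_linear. distr \<mu> \<mu> (\<lambda>\<Lambda>. (*v) g ` \<Lambda>) = \<mu>)"

definition diag_params :: "(real^'n) set" where
  "diag_params = {T. (\<forall>p. T $ p > 0) \<and> (\<Prod>p\<in>UNIV. T $ p) = 1}"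

definition max_coord :: "real^'n \<Rightarrow> real" where
  "max_coord T = Max (range (\<lambda>p. T $ p))"

definition box_of :: "real^'n \<Rightarrow> (real^'n) set" where
  "box_of T = {x. \<forall>p. x $ p \<in> {- T $ p..T $ p}}"

definition lattice_min :: "(real^'n) set \<Rightarrow> (real^'n) set \<Rightarrow> real" where
  "lattice_min B \<Lambda> = Inf {c. c > 0 \<and> \<Lambda> \<inter> (*\<^sub>R) c ` B \<noteq> {0}}"

text \<open>The filter describing \<open>T \<in> \<T>\<^sub>d\<close> with \<open>\<parallel>T\<parallel>\<^sub>\<infinity> \<rightarrow> \<infinity>\<close>.\<close>

definition diag_at_infinity :: "(real^'n) filter" where
  "diag_at_infinity = inf (filtercomap max_coord at_top) (principal diag_params)"

end

theory Submission
  imports Defs "HOL-Real_Asymp.Real_Asymp"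
begin

text \<open>
  Write \<open>d = m + 1\<close>. A lattice vector \<open>v\<close> with \<open>\<bar>v\<^sub>k\<bar> \<Prod>\<^bsub>j \<noteq> k\<^esub> \<bar>v\<^sub>j\<bar> \<le> t\<^bsup>-\<kappa>\<^esup>\<close>, where \<open>\<kappa> < m\<close> and
  \<open>t\<close> bounds the logarithms of the \<open>\<bar>v\<^sub>j\<bar>\<close>, lies in \<open>c B\<^sub>T\<close> for a suitable \<open>T\<close> with \<open>c\<close> about \<open>t\<^bsup>-\<kappa>/d\<^esup>\<close>.
  So almost every lattice must be shown to have such vectors for arbitrarily large \<open>t\<close>.

  By invariance of \<open>\<mu>\<close> and Fubini it suffices to treat \<open>B \<int>\<^sup>d\<close> for Lebesgue almost every matrix \<open>B\<close>.
  Lebesgue null sets of matrices are preserved by right multiplication with shears, so it even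
  suffices to fix \<open>B\<close> and to randomise over the shear. The problem then concerns
  \<open>\<bar>p + \<gamma> \<cdot> q\<bar> \<Prod>\<^sub>j \<bar>L\<^sub>j(q)\<bar>\<close> with \<open>p\<close> and \<open>q \<in> \<int>\<^sup>m\<close> integral, the forms \<open>L\<^sub>j\<close> fixed and \<open>\<gamma>\<close> random
  on the torus. For \<open>m \<ge> 2\<close> the events for different primitive \<open>q\<close> are pairwise independent, and
  Chebyshev's inequality applies since \<open>\<Sum> 1 / \<Prod>\<^sub>j L\<^sub>j(q)\<close> over primitive \<open>q\<close> with \<open>1 \<le> L\<^sub>j(q) \<le> R\<close>
  is at least of order \<open>(ln R)\<^sup>m\<close>. For \<open>m = 1\<close> there is no such independence; this case follows
  from the distribution of continued fraction digits.
\<close>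

section \<open>Lattices meeting an open set\<close>

text \<open>The threshold \<open>\<kappa> < m\<close> is a matter of expectation. The event of
  \<open>q\<close> has probability of order \<open>t powr - \<kappa>\<close> divided by the product
  of the forms, so the expected number of hits is at least of order
  \<open>t powr (m - \<kappa>)\<close>, which diverges for \<open>\<kappa> < m\<close>; letting
  \<open>\<kappa>\<close> increase to \<open>m\<close>, the exponent \<open>\<kappa> / d\<close>
  approaches \<open>(d - 1) / d\<close>. The obstacle is that \<open>\<mu>\<close> enters only
  through its invariance. Lebesgue measure on matrices, rescaled to determinant one, replaces it:
  one matrix that moves almost every lattice into the good set is enough. A shear adds multiples of
  one basis vector to the others. Eliminating that vector from the coordinates other than
  \<open>k\<close> gives forms which do not feel the shear, while coordinate \<open>k\<close>
  becomes random modulo one; this is why the \<open>L\<close> are fixed and only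
  \<open>\<gamma>\<close> varies. For \<open>m = 1\<close> the scale is set by two facts on digits:
  infinitely often digit \<open>n\<close> exceeds \<open>n\<close>, which makes the product at most
  of order \<open>1 / n\<close>, while the logarithm of the denominator is only of order
  \<open>n * ln n\<close>.\<close>

definition approx_region :: "real \<Rightarrow> nat \<Rightarrow> (real^'n) set" where
  "approx_region \<alpha> N = (\<Union>T\<in>{T \<in> diag_params. real N \<le> max_coord T}.
     {v. v \<noteq> 0 \<and> (\<forall>p. \<bar>v $ p\<bar> < ln (max_coord T) powr (-\<alpha>) * T $ p)})"

text \<open>Openness is what the strict inequalities and the condition \<open>v \<noteq> 0\<close>
  are for: the lattices meeting an open set form an open, hence measurable, set, so measurability of
  the limsup never has to be discussed.\<close>

lemma open_approx_region: "open (approx_region \<alpha> N)"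
proof -
  have "open {v::real^'n. v \<noteq> 0 \<and> (\<forall>p. \<bar>v $ p\<bar> < c * T $ p)}" for c T
  proof -
    have "{v::real^'n. v \<noteq> 0 \<and> (\<forall>p. \<bar>v $ p\<bar> < c * T $ p)} = - {0} \<inter> (\<Inter>p. {v. \<bar>v $ p\<bar> < c * T $ p})"
      by auto
    also have "open \<dots>"
      by (intro open_Int open_INT ballI open_Collect_less continuous_intros open_Compl) auto
    finally show ?thesis .
  qed
  then show ?thesis
    unfolding approx_region_def by blast
qed

text \<open>The inverse matrix bounds the integer coordinates of \<open>v\<close> by a multiple of
  \<open>norm v\<close>, and a nonzero integer vector has a coordinate of absolute value at least
  one.\<close>

lemma lattice_of_discrete:
  fixes A :: "real^'n^'n"
  assumes "det A \<noteq> 0"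
  obtains \<delta> where "\<delta> > 0" "\<And>v. v \<in> lattice_of A \<Longrightarrow> v \<noteq> 0 \<Longrightarrow> \<delta> \<le> norm v"
proof -
  obtain B where B: "B ** A = mat 1"
    using assms invertible_det_nz invertible_left_inverse by blast
  have "bounded_linear ((*v) B)" by (rule matrix_vector_mul_bounded_linear)
  then obtain K where K: "K > 0" "\<And>x. norm (B *v x) \<le> norm x * K"
    using bounded_linear.pos_bounded by blast
  show ?thesis
  proof
    show "inverse K > 0" using K by simp
    fix v assume "v \<in> lattice_of A" "v \<noteq> 0"
    then obtain z where z: "z \<in> integer_vectors" "v = A *v z"
      by (auto simp: lattice_of_def)
    then obtain i where i: "z $ i \<noteq> 0"
      using \<open>v \<noteq> 0\<close> by (metis matrix_vector_mult_0_right vec_eq_iff zero_index)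
    have "1 \<le> \<bar>z $ i\<bar>"
      using z(1) i unfolding integer_vectors_def
      by (metis (mono_tags, lifting) Ints_nonzero_abs_ge1 mem_Collect_eq)
    also have "\<dots> \<le> norm z" by (rule component_le_norm_cart)
    also have "z = B *v v"
      using z B by (simp add: matrix_vector_mul_assoc)
    also have "norm (B *v v) \<le> norm v * K" by (rule K)
    finally show "inverse K \<le> norm v"
      using K(1) by (simp add: field_simps)
  qed
qed

lemma max_coord_ge: "T $ p \<le> max_coord T"
  unfolding max_coord_def by (rule Max_ge) auto

text \<open>Positivity has to be known before logarithms are taken: \<open>ln\<close> is total and
  monotone only on positive arguments. It comes from discreteness of the lattice; the upper bound is
  membership of \<open>c\<close> in the set whose infimum is taken.\<close>

lemma lattice_min_bounds:
  fixes T :: "real^'n"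
  assumes "\<Lambda> \<in> unimodular_lattices" "T \<in> diag_params" "c > 0"
    and v: "v \<in> \<Lambda>" "v \<noteq> 0" "\<And>p. \<bar>v $ p\<bar> \<le> c * T $ p"
  shows "0 < lattice_min (box_of T) \<Lambda>" "lattice_min (box_of T) \<Lambda> \<le> c"
proof -
  let ?S = "{c. c > 0 \<and> \<Lambda> \<inter> (*\<^sub>R) c ` box_of T \<noteq> {0}}"
  have box: "x \<in> (*\<^sub>R) c ` box_of T \<longleftrightarrow> (\<forall>p. \<bar>x $ p\<bar> \<le> c * T $ p)" if "c > 0" for x c
  proof -
    have "x \<in> (*\<^sub>R) c ` box_of T \<longleftrightarrow> inverse c *\<^sub>R x \<in> box_of T"
      using that by (force simp: image_iff intro!: bexI [where x = "inverse c *\<^sub>R x"])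
    also have "\<dots> \<longleftrightarrow> (\<forall>p. \<bar>inverse c * x $ p\<bar> \<le> T $ p)"
      by (simp add: box_of_def abs_le_iff minus_le_iff conj_commute)
    also have "\<dots> \<longleftrightarrow> (\<forall>p. \<bar>x $ p\<bar> \<le> c * T $ p)"
      using that by (simp add: abs_mult field_simps)
    finally show ?thesis .
  qed
  have Tpos: "T $ p > 0" for p using assms(2) by (simp add: diag_params_def)
  then have mpos: "max_coord T > 0" using max_coord_ge[of T] by (meson less_le_trans)
  have cS: "c \<in> ?S" using assms box[of c v] by auto
  show "lattice_min (box_of T) \<Lambda> \<le> c"
    unfolding lattice_min_def by (rule cInf_lower [OF cS]) (auto intro!: bdd_belowI [of _ 0])
  obtain A where A: "\<bar>det A\<bar> = 1" "\<Lambda> = lattice_of A"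
    using assms by (auto simp: unimodular_lattices_def)
  then obtain \<delta> where \<delta>: "\<delta> > 0" "\<And>v. v \<in> \<Lambda> \<Longrightarrow> v \<noteq> 0 \<Longrightarrow> \<delta> \<le> norm v"
    by (metis abs_zero lattice_of_discrete zero_neq_one)
  \<comment> \<open>A nonzero lattice vector in \<open>b\<close> times the box has norm at least
    \<open>\<delta>\<close> and at most \<open>d * b * max_coord T\<close>, so \<open>b\<close> is
    at least this quotient.\<close>
  let ?\<eta> = "\<delta> / (real CARD('n) * max_coord T)"
  have "?\<eta> \<le> lattice_min (box_of T) \<Lambda>"
    unfolding lattice_min_def
  proof (rule cInf_greatest)
    show "?S \<noteq> {}" using cS by blast
    fix b assume b: "b \<in> ?S"
    have "0 = A *v 0" by simp
    moreover have "(0::real^'n) \<in> integer_vectors" by (simp add: integer_vectors_def)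
    ultimately have "0 \<in> \<Lambda>" unfolding A lattice_of_def by blast
    then have "0 \<in> \<Lambda> \<inter> (*\<^sub>R) b ` box_of T"
      using b Tpos box[of b 0] by (auto simp: less_imp_le)
    then obtain w where w: "w \<in> \<Lambda>" "w \<noteq> 0" "w \<in> (*\<^sub>R) b ` box_of T"
      using b by blast
    have "\<delta> \<le> norm w" using \<delta> w by blast
    also have "\<dots> \<le> (\<Sum>p\<in>UNIV. \<bar>w $ p\<bar>)" by (rule norm_le_l1_cart)
    also have "\<dots> \<le> (\<Sum>p::'n\<in>UNIV. b * max_coord T)"
    proof (intro sum_mono)
      fix p
      have "b > 0" using b by simp
      then show "\<bar>w $ p\<bar> \<le> b * max_coord T"
        using box[of b w] w(3) max_coord_ge[of T p] mult_left_mono[of "T $ p" "max_coord T" b]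
        by (meson less_imp_le order_trans)
    qed
    finally show "?\<eta> \<le> b" using mpos by (simp add: field_simps)
  qed
  moreover have "?\<eta> > 0" using \<delta> mpos by simp
  ultimately show "0 < lattice_min (box_of T) \<Lambda>" by linarith
qed

lemma Limsup_ge_of_meets:
  fixes \<Lambda> :: "(real^'n) set"
  assumes \<Lambda>: "\<Lambda> \<in> unimodular_lattices" and meets: "\<And>N. \<Lambda> \<inter> approx_region \<alpha> N \<noteq> {}"
  shows "ereal \<alpha> \<le> Limsup diag_at_infinity
      (\<lambda>T. ereal (- (ln (lattice_min (box_of T) \<Lambda>) / ln (ln (max_coord T)))))"
  unfolding Limsup_def
proof (rule INF_greatest)
  fix P assume "P \<in> {P. eventually P (diag_at_infinity :: (real^'n) filter)}"
  then obtain M where M: "\<And>T::real^'n. M \<le> max_coord T \<Longrightarrow> T \<in> diag_params \<Longrightarrow> P T"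
    by (auto simp: diag_at_infinity_def eventually_inf_principal eventually_filtercomap_at_top_linorder)
  \<comment> \<open>The bound \<open>M\<close> places \<open>T\<close> in the eventual set; the
    bound 3 makes \<open>ln (ln (max_coord T))\<close> positive, so that dividing by it keeps the
    inequality.\<close>
  obtain N where N: "real N \<ge> max M 3" using real_arch_simple by blast
  obtain T v where T: "T \<in> diag_params" "real N \<le> max_coord T" and v: "v \<in> \<Lambda>" "v \<noteq> 0"
    "\<And>p. \<bar>v $ p\<bar> < ln (max_coord T) powr (-\<alpha>) * T $ p"
    using meets[of N] unfolding approx_region_def by blast
  have m3: "max_coord T \<ge> 3" using N T by linarith
  have "ln 3 \<le> ln (max_coord T)" using m3 by simp
  then have "ln (max_coord T) > 1" using ln3_gt_1 by linarith
  then have lnpos: "ln (max_coord T) > 1" "ln (ln (max_coord T)) > 0" by auto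
  have "ln (max_coord T) powr (-\<alpha>) > 0" using lnpos by simp
  note b = lattice_min_bounds[OF \<Lambda> T(1) this v(1,2) less_imp_le[OF v(3)]]
  have "ln (lattice_min (box_of T) \<Lambda>) \<le> ln (ln (max_coord T) powr (-\<alpha>))"
    using b by (intro ln_mono) auto
  also have "\<dots> = - \<alpha> * ln (ln (max_coord T))" using lnpos by (simp add: ln_powr)
  finally have "\<alpha> \<le> - (ln (lattice_min (box_of T) \<Lambda>) / ln (ln (max_coord T)))"
    using lnpos by (simp add: field_simps)
  then show "ereal \<alpha> \<le> (SUP T\<in>{T. P T}. ereal (- (ln (lattice_min (box_of T) \<Lambda>) / ln (ln (max_coord T)))))"
    using M[of T] T N by (intro SUP_upper2[of T]) auto
qed

text \<open>Pulled back to \<open>special_linear\<close>, the condition is a union over integer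
  vectors \<open>z\<close> of the open conditions \<open>g *v z \<in> U\<close>, so the set is open
  in the quotient topology.\<close>

lemma meets_open_measurable:
  assumes "open (U :: (real^'n) set)"
  shows "{\<Lambda> \<in> unimodular_lattices. \<Lambda> \<inter> U \<noteq> {}} \<in> sets lattice_borel"
proof -
  have eq: "{g \<in> special_linear. lattice_of g \<in> {\<Lambda> \<in> unimodular_lattices. \<Lambda> \<inter> U \<noteq> {}}} =
    special_linear \<inter> (\<Union>z\<in>integer_vectors. (\<lambda>g::real^'n^'n. g *v z) -` U)"
    using unimodular_lattices_eq_image by (auto simp: lattice_of_def)
  have "linear (\<lambda>g::real^'n^'n. g *v z)" for z
    by (rule linearI) (simp_all add: matrix_vector_mult_add_rdistrib scaleR_matrix_vector_assoc)
  then have "open ((\<lambda>g::real^'n^'n. g *v z) -` U)" for z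
    by (intro open_vimage assms linear_continuous_on linear_conv_bounded_linear[THEN iffD1])
  then have "openin lattice_topology {\<Lambda> \<in> unimodular_lattices. \<Lambda> \<inter> U \<noteq> {}}"
    unfolding openin_lattice_topology eq by (auto intro!: openin_open_Int)
  then show ?thesis
    unfolding lattice_borel_def
    using openin_lattice_topology by (subst sets_measure_of) auto
qed

section \<open>Reduction to shears\<close>

abbreviation unit_measure :: "real measure" where
  "unit_measure \<equiv> uniform_measure lborel {0..<1}"

definition torus_measure :: "('n::finite \<Rightarrow> real) measure" where
  "torus_measure = Pi\<^sub>M UNIV (\<lambda>_. unit_measure)"

lemma prob_space_unit: "prob_space unit_measure"
  by (rule prob_space_uniform_measure) auto

lemma prob_space_torus_measure: "prob_space torus_measure"
  unfolding torus_measure_def by (intro prob_space_PiM prob_space_unit)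

lemma measurable_torus_component: "(\<lambda>\<gamma>. \<gamma> l) \<in> borel_measurable torus_measure"
proof -
  have "(\<lambda>\<gamma>. \<gamma> l) \<in> torus_measure \<rightarrow>\<^sub>M unit_measure"
    unfolding torus_measure_def by (rule measurable_component_singleton) simp
  also have "torus_measure \<rightarrow>\<^sub>M unit_measure = borel_measurable torus_measure"
    by (rule measurable_cong_sets) simp_all
  finally show ?thesis .
qed

text \<open>Right multiplication by \<open>shear k \<gamma>\<close> adds \<open>\<gamma> j\<close>
  times column \<open>k\<close> to each column \<open>j \<noteq> k\<close>: one basis vector of the
  lattice is kept and the others are moved along it.\<close>

definition shear :: "'n \<Rightarrow> ('n \<Rightarrow> real) \<Rightarrow> real^'n^'n" where
  "shear k \<gamma> = (\<chi> i j. if i = k \<and> j \<noteq> k then \<gamma> j else if i = j then 1 else 0)"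

text \<open>Affine dependence on \<open>\<gamma>\<close> is what makes
  \<open>B ** shear k \<gamma>\<close> jointly measurable in \<open>B\<close> and
  \<open>\<gamma>\<close>.\<close>

lemma shear_eq_sum:
  "shear k \<gamma> = mat 1 + (\<Sum>l\<in>UNIV - {k}. \<gamma> l *\<^sub>R (\<chi> i j. if i = k \<and> j = l then 1 else 0))"
proof -
  have *: "(\<Sum>l\<in>UNIV - {k}. \<gamma> l * (if i = k \<and> j = l then 1 else 0)) = (if i = k \<and> j \<noteq> k then \<gamma> j else 0)" for i j
  proof -
    have "(\<Sum>l\<in>UNIV - {k}. \<gamma> l * (if i = k \<and> j = l then 1 else 0)) = (\<Sum>l\<in>UNIV - {k}. if j = l then (if i = k then \<gamma> l else 0) else 0)"
      by (intro sum.cong) auto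
    then show ?thesis by auto
  qed
  show ?thesis
    unfolding vec_eq_iff by (auto simp: shear_def mat_def * )
qed

lemma det_shear [simp]:
  fixes k :: "'n::finite"
  shows "det (shear k \<gamma>) = 1"
proof -
  let ?x = "\<Sum>l\<in>UNIV - {k}. \<gamma> l *s row l (mat 1 :: real^'n^'n)"
  have "?x \<in> vec.span {row j (mat 1 :: real^'n^'n) |j. j \<noteq> k}"
    by (intro vec.span_sum vec.span_scale vec.span_base) auto
  then have "det (\<chi> i. if i = k then row k (mat 1) + ?x else row i (mat 1)) = det (mat 1 :: real^'n^'n)"
    by (rule det_row_span)
  also have "(\<chi> i. if i = k then row k (mat 1) + ?x else row i (mat 1)) = shear k \<gamma>"
  proof -
    have "?x $ j = (if j = k then 0 else \<gamma> j)" for j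
    proof -
      have "?x $ j = (\<Sum>l\<in>UNIV - {k}. if l = j then \<gamma> l else 0)"
        unfolding sum_component by (intro sum.cong) (auto simp: row_def mat_def)
      then show ?thesis by auto
    qed
    then show ?thesis
      unfolding vec_eq_iff by (auto simp: shear_def row_def mat_def)
  qed
  finally show ?thesis by simp
qed

section \<open>Lebesgue null sets of matrices and normalisation of the determinant\<close>

lemma linear_matrix_mul_right: "linear (\<lambda>B. (B :: real^'n^'m) ** (C :: real^'p^'n))"
  by (rule linearI) (simp_all add: vec_eq_iff matrix_matrix_mult_def distrib_right sum.distrib sum_distrib_left mult.assoc)

lemma matrix_mul_sum_right: "(A :: real^'n^'m) ** sum f S = (\<Sum>i\<in>S. A ** (f i :: real^'p^'n))"
  by (induct S rule: infinite_finite_induct) (auto simp: matrix_add_ldistrib)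

text \<open>The preimage of \<open>N\<close> is the image of \<open>N\<close> under the inverse
  linear map, hence negligible. That is a statement about the completed measure; since the preimage
  is Borel, it descends to \<open>lborel\<close>.\<close>

lemma null_sets_matrix_mul_right:
  fixes h :: "real^'n^'n"
  assumes N: "N \<in> null_sets lborel" and h: "det h \<noteq> 0"
  shows "{B. B ** h \<in> N} \<in> null_sets lborel"
proof -
  obtain h' where h': "h ** h' = mat 1" "h' ** h = mat 1"
    using h invertible_det_nz unfolding invertible_def by blast
  have eq: "{B. B ** h \<in> N} = (\<lambda>B. B ** h') ` N"
  proof (intro equalityI subsetI)
    fix B assume "B \<in> {B. B ** h \<in> N}"
    moreover have "B = (B ** h) ** h'" using h' by (metis matrix_mul_assoc matrix_mul_rid)
    ultimately show "B \<in> (\<lambda>B. B ** h') ` N" by blast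
  next
    fix B assume "B \<in> (\<lambda>B. B ** h') ` N"
    then obtain C where "C \<in> N" "B = C ** h'" by blast
    moreover have "(C ** h') ** h = C" using h' by (metis matrix_mul_assoc matrix_mul_rid)
    ultimately show "B \<in> {B. B ** h \<in> N}" by simp
  qed
  have "negligible N" using N by (simp add: negligible_iff_null_sets null_sets_completionI)
  have "(\<lambda>B. B ** h') differentiable_on N"
    by (rule linear_imp_differentiable_on) (rule linear_matrix_mul_right)
  with \<open>negligible N\<close> have "negligible {B. B ** h \<in> N}"
    unfolding eq by (intro negligible_differentiable_image_negligible order_refl)
  moreover have "{B. B ** h \<in> N} \<in> sets lborel"
  proof -
    have "(\<lambda>B. B ** h) \<in> borel_measurable borel"
      by (intro borel_measurable_continuous_onI linear_continuous_on
          linear_conv_bounded_linear[THEN iffD1] linear_matrix_mul_right)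
    then have "(\<lambda>B. B ** h) -` N \<inter> space borel \<in> sets borel"
      using N by (intro measurable_sets) auto
    then show ?thesis by (simp add: vimage_def)
  qed
  ultimately show ?thesis
    by (simp add: negligible_iff_null_sets null_sets_completion_iff)
qed

text \<open>Rescaling lets Lebesgue measure on matrices of positive determinant stand in for Haar
  measure on \<open>special_linear\<close>. It commutes with right multiplication by matrices of
  determinant one, so shears and unimodular bases pass through it.\<close>

definition unimodular_part :: "real^'n^'n \<Rightarrow> real^'n^'n" where
  "unimodular_part B = det B powr (- 1 / real CARD('n)) *\<^sub>R B"

lemma det_scaleR: "det (c *\<^sub>R (B :: real^'n^'n)) = c ^ CARD('n) * det B"
proof -
  have "c *\<^sub>R B = matrix ((*\<^sub>R) c) ** B"
    by (simp add: matrix_scaleR vec_eq_iff matrix_matrix_mult_def mat_def if_distrib[of "\<lambda>a. a * _"] cong: if_cong)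
  then show ?thesis by (simp add: det_mul)
qed

lemma unimodular_part_special_linear:
  fixes B :: "real^'n^'n"
  assumes "det B > 0"
  shows "unimodular_part B \<in> special_linear"
proof -
  have "(det B powr (- 1 / real CARD('n))) ^ CARD('n) = det B powr (- 1)"
    using assms by (simp add: powr_realpow [symmetric] powr_powr)
  then show ?thesis
    using assms by (simp add: unimodular_part_def special_linear_def det_scaleR powr_minus)
qed

lemma unimodular_part_mult:
  "det C = 1 \<Longrightarrow> unimodular_part (B ** C) = unimodular_part B ** C"
  by (simp add: unimodular_part_def det_mul scalar_matrix_assoc)

lemma continuous_on_det: "continuous_on S (det :: real^'n^'n \<Rightarrow> real)"
  unfolding det_def by (intro continuous_intros)

lemma lattice_of_mult: "lattice_of (A ** B) = (*v) A ` lattice_of B"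
  by (simp add: lattice_of_def image_image matrix_vector_mul_assoc)

lemma countable_integer_vectors: "countable (integer_vectors :: (real^'n) set)"
proof -
  have "integer_vectors \<subseteq> range (\<lambda>f::'n\<Rightarrow>int. \<chi> i. real_of_int (f i))"
  proof
    fix z :: "real^'n" assume "z \<in> integer_vectors"
    then have "z = (\<chi> i. real_of_int \<lfloor>z $ i\<rfloor>)"
      by (simp add: integer_vectors_def vec_eq_iff)
    then show "z \<in> range (\<lambda>f::'n\<Rightarrow>int. \<chi> i. real_of_int (f i))"
      by (rule range_eqI[where x = "\<lambda>i. \<lfloor>z $ i\<rfloor>"])
  qed
  then show ?thesis by (rule countable_subset) auto
qed

text \<open>Joint openness serves twice: with the vector fixed it makes the exceptional set of
  matrices Borel, and in both variables it yields a decomposition into countably many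
  rectangles.\<close>

lemma open_unimodular_part:
  fixes U :: "(real^'n) set"
  assumes "open U"
  shows "open {p :: (real^'n^'n) \<times> (real^'n). det (fst p) > 0 \<and> unimodular_part (fst p) *v snd p \<in> U}"
proof -
  let ?D = "{p :: (real^'n^'n) \<times> (real^'n). det (fst p) > 0}"
  have c: "continuous_on T (\<lambda>p :: (real^'n^'n) \<times> (real^'n). det (fst p))" for T
    by (rule continuous_on_compose2[OF continuous_on_det[of UNIV]]) (auto intro: continuous_intros)
  have "open ?D"
    by (intro open_Collect_less c continuous_intros)
  moreover have "continuous_on ?D (\<lambda>p. unimodular_part (fst p) *v snd p)"
  proof -
    have "unimodular_part (fst p) *v snd p =
      (\<chi> i. \<Sum>j\<in>UNIV. det (fst p) powr (- 1 / real CARD('n)) * fst p $ i $ j * snd p $ j)" for p :: "(real^'n^'n) \<times> (real^'n)"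
      by (simp add: unimodular_part_def matrix_vector_mult_def)
    moreover have "continuous_on ?D \<dots>"
      by (intro continuous_intros c) auto
    ultimately show ?thesis by simp
  qed
  ultimately have "open (?D \<inter> (\<lambda>p. unimodular_part (fst p) *v snd p) -` U)"
    using assms by (intro continuous_open_preimage)
  then show ?thesis by (simp add: vimage_def Int_def)
qed

text \<open>Fubini in \<open>B\<close> and \<open>\<gamma>\<close>: for almost every
  \<open>B\<close>, almost every shear takes \<open>B\<close> out of the exceptional set, by the
  hypothesis on its unimodular part. Exchanging the order yields one fixed shear taking almost every
  \<open>B\<close> out of that set; undoing this shear shows that the set is null.\<close>

lemma AE_meets_matrix:
  fixes U :: "(real^'n) set"
  assumes U: "open U"
    and shear: "\<And>x. x \<in> special_linear \<Longrightarrow> x $ k $ k \<noteq> 0 \<Longrightarrow>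
       AE \<gamma> in torus_measure. lattice_of (x ** shear k \<gamma>) \<inter> U \<noteq> {}"
  shows "{B :: real^'n^'n. det B > 0 \<and> lattice_of (unimodular_part B) \<inter> U = {}} \<in> null_sets lborel"
    (is "?N \<in> _")
proof -
  interpret T: prob_space "torus_measure :: ('n \<Rightarrow> real) measure" by (rule prob_space_torus_measure)
  have opn: "open {B :: real^'n^'n. det B > 0 \<and> unimodular_part B *v z \<in> U}" for z
  proof -
    have "open ((\<lambda>B. (B, z)) -` {p :: (real^'n^'n) \<times> (real^'n). det (fst p) > 0 \<and> unimodular_part (fst p) *v snd p \<in> U})"
      by (intro open_vimage open_unimodular_part U continuous_intros)
    then show ?thesis by (simp add: vimage_def)
  qed
  have "?N = {B. det B > 0} - (\<Union>z\<in>integer_vectors. {B. det B > 0 \<and> unimodular_part B *v z \<in> U})"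
    by (auto simp: lattice_of_def)
  moreover have "open {B :: real^'n^'n. det B > 0}"
    by (intro open_Collect_less continuous_on_det continuous_intros)
  ultimately have N0: "?N \<in> sets borel"
    using opn by (auto intro!: sets.Diff sets.countable_UN' countable_integer_vectors)
  define N where "N = ?N"
  have N: "N \<in> sets borel" using N0 by (simp only: N_def)
  have "AE B in lborel. AE \<gamma> in torus_measure. B ** shear k \<gamma> \<notin> N"
  proof (rule AE_mp)
    \<comment> \<open>The hypothesis on shears asks for a nonzero diagonal entry at
      \<open>k\<close>; the matrices violating this form a coordinate hyperplane.\<close>
    have "negligible {B :: real^'n^'n. B \<bullet> axis k (axis k 1) = 0}"
      by (rule negligible_standard_hyperplane) (auto simp: Basis_vec_def)
    moreover have "B \<bullet> axis k (axis k 1) = B $ k $ k" for B :: "real^'n^'n"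
      by (simp add: inner_axis)
    ultimately have "{B :: real^'n^'n. B $ k $ k = 0} \<in> null_sets lebesgue"
      by (simp add: negligible_iff_null_sets)
    then have "AE B in lebesgue. B \<notin> {B :: real^'n^'n. B $ k $ k = 0}"
      by (rule AE_not_in)
    then have "AE B in lebesgue. (B :: real^'n^'n) $ k $ k \<noteq> 0" by simp
    then show "AE B in lborel. (B :: real^'n^'n) $ k $ k \<noteq> 0"
      by (simp add: AE_completion_iff)
    show "AE B in lborel. B $ k $ k \<noteq> 0 \<longrightarrow> (AE \<gamma> in torus_measure. B ** shear k \<gamma> \<notin> N)"
    proof (rule AE_I2, rule impI)
      fix B :: "real^'n^'n" assume B: "B $ k $ k \<noteq> 0"
      show "AE \<gamma> in torus_measure. B ** shear k \<gamma> \<notin> N"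
      proof (cases "det B > 0")
        case True
        have "unimodular_part B $ k $ k \<noteq> 0" using B True by (simp add: unimodular_part_def)
        from shear[OF unimodular_part_special_linear[OF True] this] show ?thesis
          by eventually_elim (simp add: N_def unimodular_part_mult)
      qed (simp add: N_def det_mul)
    qed
  qed
  also have "(AE B in lborel. AE \<gamma> in torus_measure. B ** shear k \<gamma> \<notin> N) \<longleftrightarrow>
    (AE \<gamma> in torus_measure. AE B in lborel. B ** shear k \<gamma> \<notin> N)"
  proof (rule pair_sigma_finite.AE_commute)
    show "pair_sigma_finite lborel (torus_measure :: ('n \<Rightarrow> real) measure)"
      unfolding pair_sigma_finite_def using T.sigma_finite_measure_axioms sigma_finite_lborel by blast
    let ?P = "(lborel :: (real^'n^'n) measure) \<Otimes>\<^sub>M (torus_measure :: ('n \<Rightarrow> real) measure)"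
    have "(\<lambda>p :: (real^'n^'n) \<times> ('n \<Rightarrow> real). fst p ** shear k (snd p)) = (\<lambda>p. fst p + (\<Sum>l\<in>UNIV - {k}. snd p l *\<^sub>R
        (fst p ** (\<chi> i j. if i = k \<and> j = l then 1 else 0))))"
      (is "_ = ?f")
    proof -
      show ?thesis
        by (simp add: fun_eq_iff shear_eq_sum matrix_add_ldistrib matrix_mul_sum_right
            matrix_scalar_ac scalar_matrix_assoc)
    qed
    moreover have "?f \<in> borel_measurable ?P"
    proof -
      have "(\<lambda>B. B ** C) \<in> borel_measurable borel" for C :: "real^'n^'n"
        by (intro borel_measurable_continuous_onI linear_continuous_on
          linear_conv_bounded_linear[THEN iffD1] linear_matrix_mul_right)
      then have "(\<lambda>p. fst p ** C) \<in> borel_measurable ?P" for C :: "real^'n^'n"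
        by (rule measurable_compose[rotated]) (simp add: measurable_fst )
      moreover have "(\<lambda>p. snd p l) \<in> borel_measurable ?P" for l
        by (rule measurable_compose[OF measurable_snd measurable_torus_component])
      ultimately show ?thesis
        by (intro borel_measurable_add borel_measurable_sum borel_measurable_scaleR measurable_fst) simp_all
    qed
    ultimately have "(\<lambda>p. fst p ** shear k (snd p)) \<in> borel_measurable ?P" by simp
    from measurable_sets[OF this, of "- N"] N
    show "{p \<in> space ?P. fst p ** shear k (snd p) \<notin> N} \<in> sets ?P"
      by (simp add: vimage_def Int_def conj_commute)
  qed
  finally have AE: "AE \<gamma> in torus_measure. AE B in lborel. B ** shear k \<gamma> \<notin> N" .
  obtain \<gamma> where "AE B in lborel. B ** shear k \<gamma> \<notin> N"
  proof (rule ccontr)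
    assume "\<not> thesis"
    with AE that have "AE \<gamma> in (torus_measure :: ('n \<Rightarrow> real) measure). False"
      by (elim eventually_mono) blast
    then show False by (simp add: T.AE_False)
  qed
  moreover have "{B. B ** shear k \<gamma> \<in> N} \<in> sets borel"
  proof -
    have "(\<lambda>B. B ** shear k \<gamma>) \<in> borel_measurable borel"
        by (intro borel_measurable_continuous_onI linear_continuous_on
          linear_conv_bounded_linear[THEN iffD1] linear_matrix_mul_right)
    from measurable_sets[OF this N] show ?thesis by (simp add: vimage_def)
  qed
  ultimately have *: "{B. B ** shear k \<gamma> \<in> N} \<in> null_sets lborel"
    by (subst (asm) AE_iff_null) auto
  obtain h' where h': "shear k \<gamma> ** h' = mat 1" "h' ** shear k \<gamma> = mat 1"
    using invertible_det_nz[of "shear k \<gamma>"] unfolding invertible_def by auto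
  then have "det h' \<noteq> 0" by (metis det_I det_mul mult_zero_right zero_neq_one)
  from null_sets_matrix_mul_right[OF * this]
  have "{B. B ** h' ** shear k \<gamma> \<in> N} \<in> null_sets lborel" by simp
  also have "{B. B ** h' ** shear k \<gamma> \<in> N} = N"
    using h' by (simp flip: matrix_mul_assoc)
  finally show ?thesis by (simp only: N_def)
qed

section \<open>From matrices to the invariant measure\<close>

lemma space_lattice_borel: "space lattice_borel = unimodular_lattices"
  unfolding lattice_borel_def by (rule space_measure_of) (auto simp: openin_lattice_topology)

lemma measurable_image_lattice:
  fixes g :: "real^'n^'n"
  assumes g: "g \<in> special_linear"
  shows "(\<lambda>\<Lambda>. (*v) g ` \<Lambda>) \<in> lattice_borel \<rightarrow>\<^sub>M lattice_borel"
proof -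
  have mem: "(*v) g ` \<Lambda> \<in> unimodular_lattices" if \<Lambda>: "\<Lambda> \<in> unimodular_lattices" for \<Lambda>
  proof -
    obtain h where "h \<in> special_linear" "\<Lambda> = lattice_of h"
      using \<Lambda> by (auto simp: unimodular_lattices_eq_image)
    then have "(*v) g ` \<Lambda> = lattice_of (g ** h)" "g ** h \<in> special_linear"
      using g by (simp_all add: lattice_of_mult special_linear_def det_mul)
    then show ?thesis by (simp add: unimodular_lattices_eq_image)
  qed
  have "(\<lambda>\<Lambda>. (*v) g ` \<Lambda>) -` U \<inter> unimodular_lattices \<in> sets lattice_borel"
    if "openin lattice_topology U" for U
  proof -
    let ?V = "(\<lambda>\<Lambda>. (*v) g ` \<Lambda>) -` U \<inter> unimodular_lattices"
    have "openin (top_of_set special_linear) {h \<in> special_linear. lattice_of h \<in> U}"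
      using that by (simp add: openin_lattice_topology)
    then obtain Q where Q: "open Q" "{h \<in> special_linear. lattice_of h \<in> U} = special_linear \<inter> Q"
      by (auto simp: openin_open)
    have "linear (\<lambda>h::real^'n^'n. g ** h)"
      by (rule linearI) (simp_all add: matrix_add_ldistrib matrix_scalar_ac scalar_matrix_assoc)
    then have "open ((\<lambda>h. g ** h) -` Q)"
      by (intro open_vimage Q linear_continuous_on linear_conv_bounded_linear[THEN iffD1])
    moreover have "{h \<in> special_linear. lattice_of h \<in> ?V} = special_linear \<inter> (\<lambda>h. g ** h) -` Q"
    proof -
      have "lattice_of h \<in> ?V \<longleftrightarrow> g ** h \<in> Q" if h: "h \<in> special_linear" for h
      proof -
        have "g ** h \<in> special_linear" using g h by (simp add: special_linear_def det_mul)
        then have "lattice_of (g ** h) \<in> U \<longleftrightarrow> g ** h \<in> Q" using Q(2) by blast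
        moreover have "lattice_of h \<in> unimodular_lattices" using h by (simp add: unimodular_lattices_eq_image)
        ultimately show ?thesis by (simp add: lattice_of_mult)
      qed
      then show ?thesis by blast
    qed
    ultimately have "openin lattice_topology ?V"
      by (auto simp: openin_lattice_topology intro!: openin_open_Int)
    then show ?thesis
      unfolding lattice_borel_def using openin_lattice_topology by (subst sets_measure_of) auto
  qed
  then have "(\<lambda>\<Lambda>. (*v) g ` \<Lambda>) \<in> lattice_borel \<rightarrow>\<^sub>M sigma unimodular_lattices {U. openin lattice_topology U}"
    using mem by (intro measurable_measure_of) (auto simp: openin_lattice_topology space_lattice_borel)
  then show ?thesis by (simp only: lattice_borel_def [symmetric])
qed

text \<open>For a fixed lattice \<open>lattice_of h\<close>, the product of \<open>B\<close> and
  \<open>h\<close> avoids the null set for almost every \<open>B\<close>. Exchanging the quantifiers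
  gives a single \<open>B\<close> whose unimodular part moves almost every lattice to one meeting
  \<open>U\<close>; as this matrix preserves \<open>\<mu>\<close>, almost every lattice meets
  \<open>U\<close> itself.\<close>

lemma AE_meets_lattice:
  fixes U :: "(real^'n) set"
  assumes \<mu>: "invariant_lattice_measure \<mu>" and U: "open U"
    and null: "{B :: real^'n^'n. det B > 0 \<and> lattice_of (unimodular_part B) \<inter> U = {}} \<in> null_sets lborel"
      (is "?N \<in> _")
  shows "AE \<Lambda> in \<mu>. \<Lambda> \<inter> U \<noteq> {}"
proof -
  interpret prob_space \<mu> using \<mu> by (simp add: invariant_lattice_measure_def)
  have sets: "sets \<mu> = sets lattice_borel" using \<mu> by (simp add: invariant_lattice_measure_def)
  have space: "space \<mu> = unimodular_lattices"
    using sets_eq_imp_space_eq[OF sets] by (simp add: space_lattice_borel)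
  let ?R = "\<lambda>\<Lambda> B. det B > 0 \<longrightarrow> (*v) (unimodular_part B) ` \<Lambda> \<inter> U \<noteq> {}"
  have "AE B in lborel. ?R \<Lambda> B" if \<Lambda>: "\<Lambda> \<in> space \<mu>" for \<Lambda>
  proof -
    obtain h where h: "h \<in> special_linear" "\<Lambda> = lattice_of h"
      using \<Lambda> unimodular_lattices_eq_image unfolding space by blast
    then have "det h = 1" by (simp add: special_linear_def)
    then have "{B. B ** h \<in> ?N} \<in> null_sets lborel"
      by (intro null_sets_matrix_mul_right null) auto
    then have "AE B in lborel. B \<notin> {B. B ** h \<in> ?N}" by (rule AE_not_in)
    then show ?thesis
      by eventually_elim
        (use \<open>det h = 1\<close> in \<open>simp add: h(2) det_mul unimodular_part_mult lattice_of_mult\<close>)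
  qed
  then have "AE \<Lambda> in \<mu>. AE B in lborel. ?R \<Lambda> B" by (rule AE_I2)
  also have "(AE \<Lambda> in \<mu>. AE B in lborel. ?R \<Lambda> B) \<longleftrightarrow> (AE B in lborel. AE \<Lambda> in \<mu>. ?R \<Lambda> B)"
  proof (rule pair_sigma_finite.AE_commute)
    show "pair_sigma_finite \<mu> (lborel :: (real^'n^'n) measure)"
      unfolding pair_sigma_finite_def using sigma_finite_measure_axioms sigma_finite_lborel by blast
    let ?P = "\<mu> \<Otimes>\<^sub>M (lborel :: (real^'n^'n) measure)"
    let ?\<Omega> = "{p :: (real^'n^'n) \<times> (real^'n). det (fst p) > 0 \<and> unimodular_part (fst p) *v snd p \<in> U}"
    obtain \<A> :: "(real^'n^'n) set set" where \<A>: "countable \<A>" "topological_basis \<A>"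
      using ex_countable_basis by blast
    obtain \<C> :: "(real^'n) set set" where \<C>: "countable \<C>" "topological_basis \<C>"
      using ex_countable_basis by blast
    let ?K = "{p \<in> \<A> \<times> \<C>. fst p \<times> snd p \<subseteq> ?\<Omega>}"
    \<comment> \<open>Joint measurability: that some \<open>v \<in> \<Lambda>\<close> is mapped into
      \<open>U\<close> is an open condition on \<open>(B, v)\<close>, so countably many basic
      rectangles exhaust it, and each contributes a measurable set of lattices times an open set of
      matrices.\<close>
    let ?W = "\<Union>p\<in>?K. {\<Lambda> \<in> unimodular_lattices. \<Lambda> \<inter> snd p \<noteq> {}} \<times> fst p"
    have "countable ?K" using \<A>(1) \<C>(1) by (intro countable_subset[of ?K "\<A> \<times> \<C>"]) auto
    moreover have "{\<Lambda> \<in> unimodular_lattices. \<Lambda> \<inter> snd p \<noteq> {}} \<times> fst p \<in> sets ?P" if "p \<in> ?K" for p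
    proof (rule pair_measureI)
      have "open (snd p)" "open (fst p)"
        using that \<A>(2) \<C>(2) topological_basis_open by auto
      then show "{\<Lambda> \<in> unimodular_lattices. \<Lambda> \<inter> snd p \<noteq> {}} \<in> sets \<mu>" "fst p \<in> sets lborel"
        unfolding sets by (auto intro: meets_open_measurable)
    qed
    ultimately have "?W \<in> sets ?P" by (intro sets.countable_UN') auto
    have W: "(\<Lambda>, B) \<in> ?W \<longleftrightarrow> \<Lambda> \<in> unimodular_lattices \<and> det B > 0 \<and> (*v) (unimodular_part B) ` \<Lambda> \<inter> U \<noteq> {}" for \<Lambda> B
    proof
      assume "(\<Lambda>, B) \<in> ?W"
      then obtain A C v where "(A, C) \<in> ?K" "\<Lambda> \<in> unimodular_lattices" "v \<in> \<Lambda>" "v \<in> C" "B \<in> A" by auto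
      moreover from this have "(B, v) \<in> ?\<Omega>" by auto
      ultimately show "\<Lambda> \<in> unimodular_lattices \<and> det B > 0 \<and> (*v) (unimodular_part B) ` \<Lambda> \<inter> U \<noteq> {}" by auto
    next
      assume "\<Lambda> \<in> unimodular_lattices \<and> det B > 0 \<and> (*v) (unimodular_part B) ` \<Lambda> \<inter> U \<noteq> {}"
      then obtain u where u: "\<Lambda> \<in> unimodular_lattices" "det B > 0" "u \<in> (*v) (unimodular_part B) ` \<Lambda>" "u \<in> U"
        by blast
      obtain v where v: "v \<in> \<Lambda>" "u = unimodular_part B *v v" using u(3) by (elim imageE)
      then have v3: "(B, v) \<in> ?\<Omega>" using u by simp
      obtain A C where "open A" "open C" "(B, v) \<in> A \<times> C" and AC: "A \<times> C \<subseteq> ?\<Omega>"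
        by (rule open_prod_elim[OF open_unimodular_part[OF U] v3])
      then have "open A" "B \<in> A" "open C" "v \<in> C" by simp_all
      obtain A' where A': "A' \<in> \<A>" "B \<in> A'" "A' \<subseteq> A"
        using topological_basisE[OF \<A>(2) \<open>open A\<close> \<open>B \<in> A\<close>] by blast
      obtain C' where C': "C' \<in> \<C>" "v \<in> C'" "C' \<subseteq> C"
        using topological_basisE[OF \<C>(2) \<open>open C\<close> \<open>v \<in> C\<close>] by blast
      have "(A', C') \<in> ?K" using A' C' order_trans[OF Sigma_mono[OF A'(3) C'(3)] AC] by simp
      then show "(\<Lambda>, B) \<in> ?W" using A' C' v u(1) by (intro UN_I[of "(A', C')"]) auto
    qed
    have "{B :: real^'n^'n. \<not> det B > 0} \<in> sets borel"
      by (intro borel_closed) (auto simp: not_less intro!: closed_Collect_le continuous_on_det)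
    then have "space \<mu> \<times> {B :: real^'n^'n. \<not> det B > 0} \<in> sets ?P"
      by (intro pair_measureI) auto
    with \<open>?W \<in> sets ?P\<close> have "?W \<union> space \<mu> \<times> {B :: real^'n^'n. \<not> det B > 0} \<in> sets ?P" by blast
    also have "?W \<union> space \<mu> \<times> {B :: real^'n^'n. \<not> det B > 0} = {p \<in> space ?P. ?R (fst p) (snd p)}"
    proof (rule set_eqI)
      fix p :: "(real^'n) set \<times> (real^'n^'n)"
      obtain \<Lambda> B where p: "p = (\<Lambda>, B)" by (cases p)
      show "p \<in> ?W \<union> space \<mu> \<times> {B :: real^'n^'n. \<not> det B > 0} \<longleftrightarrow> p \<in> {p \<in> space ?P. ?R (fst p) (snd p)}"
        unfolding p Un_iff W by (auto simp: space_pair_measure space)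
    qed
    finally show "{p \<in> space ?P. ?R (fst p) (snd p)} \<in> sets ?P" .
  qed
  finally have AE: "AE B in lborel. AE \<Lambda> in \<mu>. ?R \<Lambda> B" .
  \<comment> \<open>Matrices of positive determinant form a nonempty open set, so a property valid
    almost everywhere holds at one of them.\<close>
  obtain B :: "real^'n^'n" where B: "det B > 0" "AE \<Lambda> in \<mu>. ?R \<Lambda> B"
  proof (rule ccontr)
    assume "\<not> thesis"
    then have "AE B in lborel. (B :: real^'n^'n) \<notin> {B. det B > 0}"
      using AE that by (auto elim!: eventually_mono)
    moreover have opn: "open {B :: real^'n^'n. det B > 0}"
      by (intro open_Collect_less continuous_on_det continuous_intros)
    ultimately have "{B :: real^'n^'n. det B > 0} \<in> null_sets lborel"
      by (subst (asm) AE_iff_null) auto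
    then have "negligible {B :: real^'n^'n. det B > 0}"
      by (simp add: negligible_iff_null_sets null_sets_completionI)
    moreover have "mat 1 \<in> {B :: real^'n^'n. det B > 0}" by simp
    ultimately show False using open_not_negligible[OF opn] by blast
  qed
  have g: "unimodular_part B \<in> special_linear" by (rule unimodular_part_special_linear) (rule B)
  have meas: "(\<lambda>\<Lambda>. (*v) (unimodular_part B) ` \<Lambda>) \<in> \<mu> \<rightarrow>\<^sub>M \<mu>"
    using measurable_image_lattice[OF g] by (simp add: measurable_cong_sets[OF sets sets])
  have "distr \<mu> \<mu> (\<lambda>\<Lambda>. (*v) (unimodular_part B) ` \<Lambda>) = \<mu>"
    using \<mu> g by (simp add: invariant_lattice_measure_def)
  moreover have "AE \<Lambda> in distr \<mu> \<mu> (\<lambda>\<Lambda>. (*v) (unimodular_part B) ` \<Lambda>). \<Lambda> \<inter> U \<noteq> {}"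
    using B meets_open_measurable[OF U]
    by (subst AE_distr_iff[OF meas]) (auto simp: sets space)
  ultimately show ?thesis by metis
qed

section \<open>Independence on the torus\<close>

definition near_int :: "real \<Rightarrow> real set" where
  "near_int r = {x. \<exists>p::int. \<bar>of_int p + x\<bar> \<le> r}"

lemma near_int_measurable [measurable]: "near_int r \<in> sets borel"
proof -
  have "near_int r = (\<Union>p::int. {x. \<bar>of_int p + x\<bar> \<le> r})"
    by (auto simp: near_int_def)
  also have "\<dots> \<in> sets borel"
    by (intro sets.countable_UN) (auto intro!: borel_closed closed_Collect_le continuous_intros)
  finally show ?thesis .
qed

lemma near_int_add_Ints: "z \<in> \<int> \<Longrightarrow> x + z \<in> near_int r \<longleftrightarrow> x \<in> near_int r"
proof -
  assume "z \<in> \<int>"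
  then obtain m where m: "z = of_int m" by (elim Ints_cases)
  have "(\<exists>p::int. \<bar>of_int p + (x + of_int m)\<bar> \<le> r) \<longleftrightarrow> (\<exists>p::int. \<bar>of_int p + x\<bar> \<le> r)"
  proof
    assume "\<exists>p::int. \<bar>of_int p + (x + of_int m)\<bar> \<le> r"
    then obtain p :: int where "\<bar>of_int p + (x + of_int m)\<bar> \<le> r" by blast
    then show "\<exists>p::int. \<bar>of_int p + x\<bar> \<le> r" by (intro exI[of _ "p + m"]) (simp add: add_ac)
  next
    assume "\<exists>p::int. \<bar>of_int p + x\<bar> \<le> r"
    then obtain p :: int where "\<bar>of_int p + x\<bar> \<le> r" by blast
    then show "\<exists>p::int. \<bar>of_int p + (x + of_int m)\<bar> \<le> r" by (intro exI[of _ "p - m"]) simp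
  qed
  then show ?thesis by (simp add: near_int_def m)
qed

lemma emeasure_unit: "A \<in> sets borel \<Longrightarrow> emeasure unit_measure A = emeasure lborel ({0..<1} \<inter> A)"
  by (simp add: emeasure_uniform_measure divide_ennreal_def)

lemma emeasure_lborel_vimage_add:
  fixes c :: real
  assumes "A \<in> sets borel"
  shows "emeasure lborel {x. x + c \<in> A} = emeasure lborel A"
proof -
  have "emeasure lborel A = emeasure (distr lborel borel ((+) c)) A"
    by (simp add: lborel_distr_plus)
  also have "\<dots> = emeasure lborel {x. x + c \<in> A}"
    using assms by (subst emeasure_distr) (auto simp: vimage_def add.commute)
  finally show ?thesis by simp
qed

lemma frac_measurable [measurable]: "frac \<in> borel_measurable (borel :: real measure)"
  unfolding frac_def by measurable

text \<open>Rotation of the circle seen on a fundamental domain: the unit interval is cut at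
  \<open>1 - b\<close> and each of the two pieces is translated.\<close>

lemma distr_unit_frac_add: "distr unit_measure unit_measure (\<lambda>x. frac (x + c)) = unit_measure"
proof (rule measure_eqI)
  fix A assume "A \<in> sets (distr unit_measure unit_measure (\<lambda>x. frac (x + c)))"
  then have A [measurable]: "A \<in> sets borel" by simp
  define b where "b = frac c"
  have b: "0 \<le> b" "b < 1" by (auto simp: b_def frac_lt_1)
  have fr: "frac (x + c) = (if x < 1 - b then x + b else x + (b - 1))" if "x \<in> {0..<1}" for x
  proof -
    have "frac x = x" using that by (simp add: frac_eq)
    then show ?thesis using that by (auto simp: frac_add b_def)
  qed
  have "emeasure (distr unit_measure unit_measure (\<lambda>x. frac (x + c))) A =
      emeasure unit_measure {x. frac (x + c) \<in> A}"
    by (subst emeasure_distr) (auto simp: vimage_def)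
  also have "\<dots> = emeasure lborel ({0..<1} \<inter> {x. frac (x + c) \<in> A})"
    by (rule emeasure_unit) measurable
  also have "{0..<1} \<inter> {x. frac (x + c) \<in> A} = {x. x + b \<in> A \<inter> {b..<1}} \<union> {x. x + (b - 1) \<in> A \<inter> {0..<b}}"
    using fr b by (auto split: if_splits)
  also have "emeasure lborel \<dots> = emeasure lborel {x. x + b \<in> A \<inter> {b..<1}} + emeasure lborel {x. x + (b - 1) \<in> A \<inter> {0..<b}}"
    by (rule plus_emeasure[symmetric]) (measurable, auto)
  also have "\<dots> = emeasure lborel (A \<inter> {b..<1}) + emeasure lborel (A \<inter> {0..<b})"
    by (simp only: emeasure_lborel_vimage_add A sets.Int atLeastLessThan_borel)
  also have "\<dots> = emeasure lborel ((A \<inter> {b..<1}) \<union> (A \<inter> {0..<b}))"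
    by (rule plus_emeasure) auto
  also have "(A \<inter> {b..<1}) \<union> (A \<inter> {0..<b}) = {0..<1} \<inter> A" using b by auto
  finally show "emeasure (distr unit_measure unit_measure (\<lambda>x. frac (x + c))) A = emeasure unit_measure A"
    by (simp only: emeasure_unit A)
qed simp

text \<open>A rotation reduces to \<open>a = 0\<close>, where the set consists of an arc of length
  \<open>r\<close> at either end of the unit interval; \<open>r < 1/2\<close> keeps them
  disjoint.\<close>

lemma emeasure_unit_near_int:
  assumes "0 \<le> r" "r < 1/2"
  shows "emeasure unit_measure {s. a + s \<in> near_int r} = ennreal (2 * r)"
proof -
  have "{s. a + s \<in> near_int r} = (\<lambda>x. frac (x + a)) -` near_int r"
  proof -
    have "a + s \<in> near_int r \<longleftrightarrow> frac (s + a) \<in> near_int r" for s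
      using near_int_add_Ints[of "- of_int \<lfloor>s + a\<rfloor>" "a + s" r] by (simp add: frac_def add.commute)
    then show ?thesis by auto
  qed
  then have "emeasure unit_measure {s. a + s \<in> near_int r} = emeasure (distr unit_measure unit_measure (\<lambda>x. frac (x + a))) (near_int r)"
    by (subst emeasure_distr) auto
  also have "\<dots> = emeasure lborel ({0..<1} \<inter> near_int r)"
    by (simp only: distr_unit_frac_add emeasure_unit near_int_measurable)
  also have "\<dots> = emeasure lborel ({0..r} \<union> {1-r..<1})"
  proof (rule emeasure_eq_AE)
    have *: "x \<in> {0..<1} \<inter> near_int r \<longleftrightarrow> x \<in> {0..r} \<union> {1 - r..<1}" for x
    proof
      assume x: "x \<in> {0..<1} \<inter> near_int r"
      then obtain p :: int where p: "\<bar>of_int p + x\<bar> \<le> r" by (auto simp: near_int_def)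
      have "of_int p < (1::real)" "of_int p > (-2::real)" using p x assms by auto
      then have "p = 0 \<or> p = -1" by linarith
      then show "x \<in> {0..r} \<union> {1 - r..<1}" using p x by auto
    next
      assume "x \<in> {0..r} \<union> {1 - r..<1}"
      then show "x \<in> {0..<1} \<inter> near_int r"
      proof
        assume "x \<in> {0..r}"
        then show ?thesis using assms by (auto simp: near_int_def intro!: exI[of _ "0::int"])
      next
        assume "x \<in> {1 - r..<1}"
        then show ?thesis using assms by (auto simp: near_int_def intro!: exI[of _ "-1::int"])
      qed
    qed
    then show "AE x in lborel. x \<in> {0..<1} \<inter> near_int r \<longleftrightarrow> x \<in> {0..r} \<union> {1 - r..<1}" by (intro AE_I2)
  qed auto
  also have "\<dots> = emeasure lborel {0..r} + emeasure lborel {1-r..<1}"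
    using assms by (intro plus_emeasure[symmetric]) auto
  also have "\<dots> = ennreal (2 * r)" using assms by (simp flip: ennreal_plus)
  finally show ?thesis .
qed

lemma space_torus_measure [simp]: "space torus_measure = UNIV"
  by (simp add: torus_measure_def space_PiM)

lemma measurable_torus_shift:
  "(\<lambda>\<gamma> i. frac (\<gamma> i + c i)) \<in> torus_measure \<rightarrow>\<^sub>M torus_measure"
proof -
  have "(\<lambda>\<gamma>. \<lambda>i\<in>UNIV. frac (\<gamma> i + c i)) \<in> torus_measure \<rightarrow>\<^sub>M torus_measure"
    unfolding torus_measure_def
  proof (rule measurable_restrict)
    fix i :: 'a
    have "(\<lambda>\<gamma>. frac (\<gamma> i + c i)) \<in> borel_measurable torus_measure"
      using measurable_torus_component[of i] by measurable
    then show "(\<lambda>\<gamma>. frac (\<gamma> i + c i)) \<in> Pi\<^sub>M UNIV (\<lambda>_. unit_measure) \<rightarrow>\<^sub>M unit_measure"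
      by (simp add: torus_measure_def cong: measurable_cong_sets)
  qed
  then show ?thesis by (simp add: restrict_def)
qed

lemma distr_torus_shift:
  "distr torus_measure torus_measure (\<lambda>\<gamma> i. frac (\<gamma> i + c i)) = (torus_measure :: ('n::finite \<Rightarrow> real) measure)"
proof -
  interpret product_sigma_finite "\<lambda>_::'n. unit_measure"
    using prob_space_unit unfolding product_sigma_finite_def
    by (intro allI prob_space_imp_sigma_finite)
  have "distr torus_measure torus_measure (\<lambda>\<gamma> i. frac (\<gamma> i + c i)) = Pi\<^sub>M UNIV (\<lambda>_. unit_measure)"
  proof (rule PiM_eqI)
    fix A :: "'n \<Rightarrow> real set" assume A: "\<And>i. i \<in> UNIV \<Longrightarrow> A i \<in> sets unit_measure"
    have pre: "{x. frac (x + c i) \<in> A i} \<in> sets borel" for i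
    proof -
      have "A i \<in> sets borel" using A by simp
      then show ?thesis by measurable
    qed
    have "emeasure (distr torus_measure torus_measure (\<lambda>\<gamma> i. frac (\<gamma> i + c i))) (Pi\<^sub>E UNIV A) =
        emeasure torus_measure ((\<lambda>\<gamma> i. frac (\<gamma> i + c i)) -` Pi\<^sub>E UNIV A \<inter> space torus_measure)"
      using A by (intro emeasure_distr measurable_torus_shift) (auto simp: torus_measure_def)
    also have "(\<lambda>\<gamma> i. frac (\<gamma> i + c i)) -` Pi\<^sub>E UNIV A \<inter> space torus_measure = Pi\<^sub>E UNIV (\<lambda>i. {x. frac (x + c i) \<in> A i})"
      by (auto simp: PiE_def Pi_def)
    also have "emeasure torus_measure \<dots> = (\<Prod>i\<in>UNIV. emeasure unit_measure {x. frac (x + c i) \<in> A i})"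
      unfolding torus_measure_def using pre by (intro emeasure_PiM) auto
    also have "\<dots> = (\<Prod>i\<in>UNIV. emeasure unit_measure (A i))"
    proof (rule prod.cong)
      fix i
      have "emeasure unit_measure {x. frac (x + c i) \<in> A i} = emeasure (distr unit_measure unit_measure (\<lambda>x. frac (x + c i))) (A i)"
        using A by (subst emeasure_distr) (auto simp: vimage_def)
      then show "emeasure unit_measure {x. frac (x + c i) \<in> A i} = emeasure unit_measure (A i)"
        by (simp add: distr_unit_frac_add)
    qed simp
    finally show "emeasure (distr torus_measure torus_measure (\<lambda>\<gamma> i. frac (\<gamma> i + c i))) (Pi\<^sub>E UNIV A) = (\<Prod>i\<in>UNIV. emeasure unit_measure (A i))" .
  qed (auto simp: torus_measure_def)
  then show ?thesis by (simp add: torus_measure_def)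
qed

text \<open>Independence on the torus by averaging over the translates in a direction \<open>w\<close> along which the
  first event is invariant while the second linear form moves with unit speed.\<close>

lemma torus_average:
  fixes F :: "('n::finite \<Rightarrow> real) \<Rightarrow> ennreal" and q :: "'n \<Rightarrow> int"
  assumes F [measurable]: "F \<in> borel_measurable torus_measure"
    and inv: "\<And>\<gamma> s. F (\<lambda>i. frac (\<gamma> i + s * w i)) = F \<gamma>"
    and w: "(\<Sum>i\<in>UNIV. w i * of_int (q i)) = 1"
    and r: "0 \<le> r" "r < 1/2"
  shows "(\<integral>\<^sup>+\<gamma>. F \<gamma> * indicator (near_int r) (\<tau> + (\<Sum>i\<in>UNIV. \<gamma> i * of_int (q i))) \<partial>torus_measure) =
    (\<integral>\<^sup>+\<gamma>. F \<gamma> \<partial>torus_measure) * ennreal (2 * r)"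
proof -
  interpret T: prob_space "torus_measure :: ('n \<Rightarrow> real) measure" by (rule prob_space_torus_measure)
  interpret U: prob_space unit_measure by (rule prob_space_unit)
  interpret P: pair_sigma_finite unit_measure "torus_measure :: ('n \<Rightarrow> real) measure" ..
  note [measurable] = measurable_torus_component
  define f where "f \<gamma> = \<tau> + (\<Sum>i\<in>UNIV. \<gamma> i * of_int (q i))" for \<gamma> :: "'n \<Rightarrow> real"
  have f [measurable]: "f \<in> borel_measurable torus_measure" unfolding f_def by measurable
  have fs: "f (\<lambda>i. frac (\<gamma> i + s * w i)) \<in> near_int r \<longleftrightarrow> f \<gamma> + s \<in> near_int r" for \<gamma> s
  proof -
    let ?z = "- (\<Sum>i\<in>UNIV. of_int \<lfloor>\<gamma> i + s * w i\<rfloor> * of_int (q i)) :: real"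
    have "f (\<lambda>i. frac (\<gamma> i + s * w i)) = f \<gamma> + s * (\<Sum>i\<in>UNIV. w i * of_int (q i)) + ?z"
      by (simp add: f_def frac_def algebra_simps sum.distrib sum_subtractf sum_distrib_left)
    moreover have "?z \<in> \<int>" by (intro Ints_minus Ints_sum Ints_mult) auto
    ultimately show ?thesis using near_int_add_Ints[of ?z "f \<gamma> + s" r] w by simp
  qed
  let ?G = "\<lambda>\<gamma>. F \<gamma> * indicator (near_int r) (f \<gamma>)"
  have "(\<integral>\<^sup>+\<gamma>. ?G \<gamma> \<partial>torus_measure) = (\<integral>\<^sup>+\<gamma>. F \<gamma> * indicator (near_int r) (f \<gamma> + s) \<partial>torus_measure)" for s
  proof -
    have "(\<integral>\<^sup>+\<gamma>. ?G \<gamma> \<partial>torus_measure) = (\<integral>\<^sup>+\<gamma>. ?G \<gamma> \<partial>distr torus_measure torus_measure (\<lambda>\<gamma> i. frac (\<gamma> i + s * w i)))"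
      by (simp only: distr_torus_shift)
    also have "\<dots> = (\<integral>\<^sup>+\<gamma>. ?G (\<lambda>i. frac (\<gamma> i + s * w i)) \<partial>torus_measure)"
      by (intro nn_integral_distr measurable_torus_shift) measurable
    also have "\<dots> = (\<integral>\<^sup>+\<gamma>. F \<gamma> * indicator (near_int r) (f \<gamma> + s) \<partial>torus_measure)"
      by (intro nn_integral_cong) (simp add: inv fs indicator_def)
    finally show ?thesis .
  qed
  then have "(\<integral>\<^sup>+\<gamma>. ?G \<gamma> \<partial>torus_measure) =
      (\<integral>\<^sup>+s. (\<integral>\<^sup>+\<gamma>. F \<gamma> * indicator (near_int r) (f \<gamma> + s) \<partial>torus_measure) \<partial>unit_measure)"
    by (simp add: U.emeasure_space_1)
  also have "\<dots> = (\<integral>\<^sup>+\<gamma>. (\<integral>\<^sup>+s. F \<gamma> * indicator (near_int r) (f \<gamma> + s) \<partial>unit_measure) \<partial>torus_measure)"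
    by (rule P.Fubini'[symmetric]) measurable
  also have "\<dots> = (\<integral>\<^sup>+\<gamma>. F \<gamma> * ennreal (2 * r) \<partial>torus_measure)"
  proof (rule nn_integral_cong)
    fix \<gamma>
    have "(\<integral>\<^sup>+s. F \<gamma> * indicator (near_int r) (f \<gamma> + s) \<partial>unit_measure) =
        (\<integral>\<^sup>+s. F \<gamma> * indicator {s. f \<gamma> + s \<in> near_int r} s \<partial>unit_measure)"
      by (intro nn_integral_cong) (simp add: indicator_def)
    also have "\<dots> = F \<gamma> * emeasure unit_measure {s. f \<gamma> + s \<in> near_int r}"
      by (rule nn_integral_cmult_indicator) simp
    finally show "(\<integral>\<^sup>+s. F \<gamma> * indicator (near_int r) (f \<gamma> + s) \<partial>unit_measure) = F \<gamma> * ennreal (2 * r)"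
      by (simp only: emeasure_unit_near_int[OF r])
  qed
  also have "\<dots> = (\<integral>\<^sup>+\<gamma>. F \<gamma> \<partial>torus_measure) * ennreal (2 * r)"
    by (rule nn_integral_multc) measurable
  finally show ?thesis by (simp add: f_def)
qed

text \<open>Chebyshev's inequality for the number of events that occur. Pairwise independence
  removes the mixed covariances, so the variance is at most the mean, whereas the squared deviation
  equals the squared mean wherever no event occurs.\<close>

lemma (in prob_space) prob_no_event_le:
  assumes I: "finite I" and E: "\<And>i. i \<in> I \<Longrightarrow> E i \<in> events"
    and indep: "\<And>i j. i \<in> I \<Longrightarrow> j \<in> I \<Longrightarrow> i \<noteq> j \<Longrightarrow> prob (E i \<inter> E j) = prob (E i) * prob (E j)"
    and pos: "0 < (\<Sum>i\<in>I. prob (E i))"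
  shows "prob (space M - (\<Union>i\<in>I. E i)) \<le> 1 / (\<Sum>i\<in>I. prob (E i))"
proof -
  let ?m = "\<Sum>i\<in>I. prob (E i)"
  let ?X = "\<lambda>i x. indicator (E i) x - prob (E i)"
  let ?N = "space M - (\<Union>i\<in>I. E i)"
  have intX: "integrable M (\<lambda>x. ?X i x * ?X j x)" if "i \<in> I" "j \<in> I" for i j
  proof -
    have [measurable]: "E i \<in> events" "E j \<in> events" using E that by auto
    show ?thesis
    proof (rule integrable_const_bound[where B = 1])
      show "AE x in M. norm (?X i x * ?X j x) \<le> 1"
      proof (rule AE_I2)
        fix x
        have "\<bar>?X i x\<bar> \<le> 1" "\<bar>?X j x\<bar> \<le> 1" by (auto simp: indicator_def)
        then show "norm (?X i x * ?X j x) \<le> 1"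
          by (simp add: abs_mult mult_le_one)
      qed
    qed measurable
  qed
  have cov: "expectation (\<lambda>x. ?X i x * ?X j x) = prob (E i \<inter> E j) - prob (E i) * prob (E j)"
    if "i \<in> I" "j \<in> I" for i j
  proof -
    have [measurable]: "E i \<in> events" "E j \<in> events" using E that by auto
    have int: "integrable M (indicator (E i) :: _ \<Rightarrow> real)" "integrable M (indicator (E j) :: _ \<Rightarrow> real)"
       "integrable M (indicator (E i \<inter> E j) :: _ \<Rightarrow> real)"
      by (auto simp: integrable_indicator_iff emeasure_eq_measure less_top[symmetric])
    have "expectation (\<lambda>x. ?X i x * ?X j x) = expectation (\<lambda>x. indicator (E i \<inter> E j) x
        - prob (E j) * indicator (E i) x - prob (E i) * indicator (E j) x + prob (E i) * prob (E j))"
      by (intro Bochner_Integration.integral_cong) (auto simp: indicator_def algebra_simps)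
    also have "\<dots> = prob (E i \<inter> E j) - prob (E i) * prob (E j)"
      using int by (simp add: prob_space E that Int_absorb1 sets.sets_into_space)
    finally show ?thesis .
  qed
  have "(\<Sum>i\<in>I. ?X i x)\<^sup>2 = (\<Sum>i\<in>I. \<Sum>j\<in>I. ?X i x * ?X j x)" for x
    by (simp add: power2_eq_square sum_product)
  then have "expectation (\<lambda>x. (\<Sum>i\<in>I. ?X i x)\<^sup>2) = (\<Sum>i\<in>I. \<Sum>j\<in>I. expectation (\<lambda>x. ?X i x * ?X j x))"
    using intX by (simp add: Bochner_Integration.integral_sum Bochner_Integration.integrable_sum)
  also have "\<dots> = (\<Sum>i\<in>I. \<Sum>j\<in>I. if j = i then prob (E i) - prob (E i) * prob (E i) else 0)"
    using indep by (intro sum.cong) (auto simp: cov)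
  also have "\<dots> = (\<Sum>i\<in>I. prob (E i) - prob (E i) * prob (E i))"
    using I by simp
  also have "\<dots> \<le> ?m" by (intro sum_mono) simp
  finally have var: "expectation (\<lambda>x. (\<Sum>i\<in>I. ?X i x)\<^sup>2) \<le> ?m" .
  have N [measurable]: "?N \<in> events" using I E by (intro sets.Diff sets.finite_UN) auto
  have "prob ?N * ?m\<^sup>2 = expectation (\<lambda>x. ?m\<^sup>2 * indicator ?N x)"
    using N by (simp add: Int_absorb1 sets.sets_into_space)
  also have "\<dots> \<le> expectation (\<lambda>x. (\<Sum>i\<in>I. ?X i x)\<^sup>2)"
  proof (rule integral_mono)
    show "integrable M (\<lambda>x. ?m\<^sup>2 * indicator ?N x)"
      using N by (intro integrable_mult_right) (auto simp: integrable_indicator_iff emeasure_eq_measure less_top[symmetric])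
    show "integrable M (\<lambda>x. (\<Sum>i\<in>I. ?X i x)\<^sup>2)"
      unfolding power2_eq_square sum_product using intX by (intro Bochner_Integration.integrable_sum) auto
    fix x assume x: "x \<in> space M"
    show "?m\<^sup>2 * indicator ?N x \<le> (\<Sum>i\<in>I. ?X i x)\<^sup>2"
    proof (cases "x \<in> ?N")
      case True
      then have "(\<Sum>i\<in>I. ?X i x) = - ?m"
        by (subst sum_negf[symmetric]) (intro sum.cong, auto)
      then show ?thesis by (simp add: indicator_def)
    qed simp
  qed
  finally have "prob ?N * ?m\<^sup>2 \<le> ?m" using var by linarith
  then show ?thesis using pos by (simp add: field_simps power2_eq_square)
qed

section \<open>Hits of integral linear forms on the torus\<close>

definition torus_hit :: "real \<Rightarrow> ('n::finite \<Rightarrow> int) \<Rightarrow> real \<Rightarrow> ('n \<Rightarrow> real) set" where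
  "torus_hit \<tau> q r = {\<gamma>. \<tau> + (\<Sum>i\<in>UNIV. \<gamma> i * of_int (q i)) \<in> near_int r}"

lemma sets_torus_hit [measurable]: "torus_hit \<tau> q r \<in> sets torus_measure"
proof -
  note [measurable] = measurable_torus_component
  have "(\<lambda>\<gamma>. \<tau> + (\<Sum>i\<in>UNIV. \<gamma> i * of_int (q i))) \<in> borel_measurable torus_measure" by measurable
  from measurable_sets[OF this near_int_measurable[of r]] show ?thesis
    by (simp add: torus_hit_def vimage_def)
qed

lemma torus_hit_shift:
  "(\<lambda>i. frac (\<gamma> i + s * w i)) \<in> torus_hit \<tau> q r \<longleftrightarrow>
   \<tau> + (\<Sum>i\<in>UNIV. \<gamma> i * of_int (q i)) + s * (\<Sum>i\<in>UNIV. w i * of_int (q i)) \<in> near_int r"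
proof -
  let ?z = "- (\<Sum>i\<in>UNIV. of_int \<lfloor>\<gamma> i + s * w i\<rfloor> * of_int (q i)) :: real"
  have "\<tau> + (\<Sum>i\<in>UNIV. frac (\<gamma> i + s * w i) * of_int (q i)) =
     \<tau> + (\<Sum>i\<in>UNIV. \<gamma> i * of_int (q i)) + s * (\<Sum>i\<in>UNIV. w i * of_int (q i)) + ?z"
    by (simp add: frac_def algebra_simps sum.distrib sum_subtractf sum_distrib_left)
  moreover have "?z \<in> \<int>" by (intro Ints_minus Ints_sum Ints_mult) auto
  ultimately show ?thesis by (simp only: torus_hit_def mem_Collect_eq near_int_add_Ints)
qed

lemma measure_torus_hit_Int:
  fixes S :: "('n::finite \<Rightarrow> real) set"
  assumes S: "S \<in> sets torus_measure"
    and inv: "\<And>\<gamma> s. (\<lambda>i. frac (\<gamma> i + s * w i)) \<in> S \<longleftrightarrow> \<gamma> \<in> S"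
    and w: "(\<Sum>i\<in>UNIV. w i * of_int (q i)) = 1" and r: "0 \<le> r" "r < 1/2"
  shows "measure torus_measure (S \<inter> torus_hit \<tau> q r) = measure torus_measure S * (2 * r)"
proof -
  interpret T: prob_space "torus_measure :: ('n \<Rightarrow> real) measure" by (rule prob_space_torus_measure)
  have "emeasure torus_measure (S \<inter> torus_hit \<tau> q r) = (\<integral>\<^sup>+\<gamma>. indicator (S \<inter> torus_hit \<tau> q r) \<gamma> \<partial>torus_measure)"
    using S by (intro nn_integral_indicator[symmetric]) auto
  also have "\<dots> = (\<integral>\<^sup>+\<gamma>. indicator S \<gamma> * indicator (near_int r) (\<tau> + (\<Sum>i\<in>UNIV. \<gamma> i * of_int (q i))) \<partial>torus_measure)"
    by (intro nn_integral_cong) (auto simp: indicator_def torus_hit_def)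
  also have "\<dots> = (\<integral>\<^sup>+\<gamma>. indicator S \<gamma> \<partial>torus_measure) * ennreal (2 * r)"
    using S inv by (intro torus_average[OF _ _ w r]) (auto simp: indicator_def)
  also have "\<dots> = emeasure torus_measure S * ennreal (2 * r)"
    using S by simp
  finally show ?thesis
    using r by (simp add: T.emeasure_eq_measure flip: ennreal_mult)
qed

text \<open>Here the invariant set is the whole torus, and the direction of unit speed is the
  \<open>i\<close>-th unit vector divided by \<open>q i\<close>.\<close>

lemma measure_torus_hit:
  fixes q :: "'n::finite \<Rightarrow> int"
  assumes "q i \<noteq> 0" and r: "0 \<le> r" "r < 1/2"
  shows "measure torus_measure (torus_hit \<tau> q r) = 2 * r"
proof -
  interpret T: prob_space "torus_measure :: ('n \<Rightarrow> real) measure" by (rule prob_space_torus_measure)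
  let ?w = "\<lambda>j. if j = i then 1 / of_int (q i) else 0 :: real"
  have "(\<Sum>j\<in>UNIV. ?w j * of_int (q j)) = (\<Sum>j\<in>UNIV. if j = i then 1 else 0)"
    using assms by (intro sum.cong) auto
  also have "\<dots> = 1" by simp
  finally have "measure torus_measure (UNIV \<inter> torus_hit \<tau> q r) = measure torus_measure (UNIV :: ('n \<Rightarrow> real) set) * (2 * r)"
    using r sets.top[of "torus_measure :: ('n \<Rightarrow> real) measure"]
    by (intro measure_torus_hit_Int) auto
  then show ?thesis using T.prob_space by simp
qed

text \<open>A nonzero minor means that \<open>q\<close> and \<open>q'\<close> are not parallel, so
  some direction is orthogonal to \<open>q\<close> and pairs to one with \<open>q'\<close>. The
  first event is invariant along it, and the second is averaged out.\<close>

lemma measure_torus_hit_indep: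
  fixes q q' :: "'n::finite \<Rightarrow> int"
  assumes nonpar: "q i * q' l \<noteq> q l * q' i" and r: "0 \<le> r" "r < 1/2" "0 \<le> r'" "r' < 1/2"
  shows "measure torus_measure (torus_hit \<tau> q r \<inter> torus_hit \<tau>' q' r') =
    measure torus_measure (torus_hit \<tau> q r) * measure torus_measure (torus_hit \<tau>' q' r')"
proof -
  have il: "i \<noteq> l" using nonpar by auto
  define \<Delta> where "\<Delta> = real_of_int (q i * q' l - q l * q' i)"
  have \<Delta>: "\<Delta> \<noteq> 0" unfolding \<Delta>_def of_int_eq_0_iff using nonpar by simp
  \<comment> \<open>Cramer's rule on the coordinates \<open>i\<close> and \<open>l\<close>: pairing
    with \<open>q\<close> gives 0, pairing with \<open>q'\<close> gives
    \<open>\<Delta> / \<Delta>\<close>.\<close>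
  define w where "w j = (if j = i then - of_int (q l) / \<Delta> else if j = l then of_int (q i) / \<Delta> else 0 :: real)" for j
  have wsum: "(\<Sum>j\<in>UNIV. w j * of_int (v j)) = (of_int (q i) * of_int (v l) - of_int (q l) * of_int (v i)) / \<Delta>" for v :: "'n \<Rightarrow> int"
  proof -
    have "(\<Sum>j\<in>UNIV. w j * of_int (v j)) = (\<Sum>j\<in>{i,l}. w j * of_int (v j))"
      by (rule sum.mono_neutral_right) (auto simp: w_def)
    then show ?thesis using il by (simp add: w_def diff_divide_distrib)
  qed
  have "q' i \<noteq> 0 \<or> q' l \<noteq> 0" using nonpar by auto
  then obtain j where "q' j \<noteq> 0" by blast
  then have "measure torus_measure (torus_hit \<tau>' q' r') = 2 * r'" using r by (intro measure_torus_hit) auto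
  moreover have "measure torus_measure (torus_hit \<tau> q r \<inter> torus_hit \<tau>' q' r') =
    measure torus_measure (torus_hit \<tau> q r) * (2 * r')"
  proof (rule measure_torus_hit_Int)
    show "(\<Sum>j\<in>UNIV. w j * of_int (q' j)) = 1" using \<Delta> by (simp add: wsum \<Delta>_def)
    show "(\<lambda>j. frac (\<gamma> j + s * w j)) \<in> torus_hit \<tau> q r \<longleftrightarrow> \<gamma> \<in> torus_hit \<tau> q r" for \<gamma> s
      unfolding torus_hit_shift wsum by (simp add: torus_hit_def mult.commute)
  qed (use r in auto)
  ultimately show ?thesis by simp
qed

section \<open>Several linear forms\<close>

definition primitive :: "('i \<Rightarrow> int) \<Rightarrow> bool" where
  "primitive q \<longleftrightarrow> (\<forall>g. (\<forall>i. g dvd q i) \<longrightarrow> is_unit g)"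

lemma ex_primitive:
  fixes q :: "'i \<Rightarrow> int"
  assumes "q i \<noteq> 0"
  shows "\<exists>g q'. 0 < g \<and> primitive q' \<and> q = (\<lambda>l. int g * q' l)"
proof -
  define g where "g = Gcd (range q)"
  have g: "g dvd q l" for l unfolding g_def by (rule Gcd_dvd) simp
  have "g \<noteq> 0" using g[of i] assms by auto
  moreover have "g \<ge> 0" by (simp add: g_def)
  ultimately have gpos: "g > 0" by simp
  define q' where "q' l = q l div g" for l
  have q: "q l = g * q' l" for l using g by (simp add: q'_def)
  have "primitive q'"
    unfolding primitive_def
  proof (intro allI impI)
    fix h assume h: "\<forall>i. h dvd q' i"
    have "g * h dvd Gcd (range q)" by (rule Gcd_greatest) (use h q in auto)
    then show "is_unit h" using gpos by (simp add: g_def [symmetric] dvd_mult_cancel_left)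
  qed
  then show ?thesis using gpos q by (intro exI[of _ "nat g"] exI[of _ q']) auto
qed

text \<open>The induction runs on the sharper bound \<open>2 - 1 / N\<close>, whose increment
  \<open>1 / N - 1 / (N + 1)\<close> dominates the new term.\<close>

lemma sum_inverse_squares_le: "(\<Sum>g\<in>{1..N::nat}. 1 / real g ^ 2) \<le> 2"
proof -
  have "(\<Sum>g\<in>{1..N}. 1 / real g ^ 2) \<le> 2 - 1 / real N" if "N > 0"
    using that
  proof (induction N)
    case (Suc N)
    show ?case
    proof (cases "N = 0")
      case False
      then have "1 / real (Suc N) ^ 2 \<le> 1 / real N - 1 / real (Suc N)"
        by (simp add: divide_simps power2_eq_square)
      then show ?thesis using Suc False by simp
    qed simp
  qed simp
  then show ?thesis by (cases "N = 0") (auto intro: order_trans)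
qed

lemma sum_inverse_ge_ln:
  "a \<le> b \<Longrightarrow> ln ((real b + 1) / (real a + 1)) \<le> (\<Sum>i\<in>{a..<b}. 1 / (real i + 1))"
proof (induction b rule: dec_induct)
  case (step b)
  have "ln ((real b + 2) / (real b + 1)) \<le> 1 / (real b + 1)"
    using ln_add_one_self_le_self[of "1 / (real b + 1)"] by (simp add: field_simps)
  moreover have "ln ((real b + 2) / (real a + 1)) = ln ((real b + 2) / (real b + 1)) + ln ((real b + 1) / (real a + 1))"
    by (simp add: ln_div)
  ultimately show ?case using step by (simp add: add.commute)
qed simp

text \<open>Row \<open>k\<close> of \<open>D\<close> is the coordinate functional, so on vectors
  with \<open>q k = 0\<close> the other rows are independent linear forms, the \<open>L\<close> of
  the overview. Keeping a full square matrix makes determinants and inverses available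
  directly.\<close>

locale linear_forms =
  fixes k :: "'n::finite" and D :: "real^'n^'n"
  assumes det_D: "det D \<noteq> 0" and row_k: "\<And>v. (D *v v) $ k = v $ k"
begin

definition form :: "('n \<Rightarrow> int) \<Rightarrow> 'n \<Rightarrow> real" where
  "form q j = (D *v (\<chi> l. of_int (q l))) $ j"

text \<open>Up to a factor independent of \<open>q\<close>, this is the probability of the event
  that will be attached to \<open>q\<close>.\<close>

definition weight :: "('n \<Rightarrow> int) \<Rightarrow> real" where
  "weight q = (\<Prod>j\<in>UNIV - {k}. 1 / form q j)"

definition box_points :: "real \<Rightarrow> real \<Rightarrow> ('n \<Rightarrow> int) set" where
  "box_points A B = {q. q k = 0 \<and> (\<forall>j\<in>UNIV - {k}. A \<le> form q j \<and> form q j \<le> B)}"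

lemma form_mult: "form (\<lambda>l. g * q l) j = of_int g * form q j"
proof -
  have "(\<chi> l. of_int (g * q l)) = of_int g *\<^sub>R ((\<chi> l. of_int (q l)) :: real^'n)"
    by (simp add: vec_eq_iff)
  then show ?thesis unfolding form_def by (simp only: matrix_vector_mult_scaleR vector_scaleR_component real_scaleR_def)
qed

lemma weight_mult: "weight (\<lambda>l. g * q l) = weight q / of_int g ^ card (UNIV - {k})"
proof -
  have "weight (\<lambda>l. g * q l) = (\<Prod>j\<in>UNIV - {k}. (1 / form q j) * (1 / of_int g))"
    by (simp add: weight_def form_mult mult.commute)
  also have "\<dots> = weight q * (1 / of_int g) ^ card (UNIV - {k})"
    by (simp only: prod.distrib prod_constant weight_def)
  finally show ?thesis by (simp add: power_one_over)
qed

text \<open>Solve \<open>D *v x = Y\<close> over the reals and round \<open>x\<close> down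
  coordinatewise; a form changes by at most the absolute row sum of \<open>D\<close>. Since
  \<open>row_k\<close> forces \<open>x $ k = 0\<close>, rounding stays in the hyperplane
  \<open>q k = 0\<close>.\<close>

lemma form_covering:
  obtains \<rho> where "\<rho> \<ge> 1"
    "\<And>y. \<exists>q. q k = 0 \<and> (\<forall>j\<in>UNIV - {k}. y j \<le> form q j \<and> form q j < y j + \<rho>)"
proof
  define K where "K = (\<Sum>j\<in>UNIV. \<Sum>l\<in>UNIV. \<bar>D $ j $ l\<bar>)"
  have K0: "K \<ge> 0" unfolding K_def by (intro sum_nonneg) auto
  then show "2 * K + 1 \<ge> 1" by simp
  fix y :: "'n \<Rightarrow> real"
  obtain D' where D': "D ** D' = mat 1"
    using det_D invertible_det_nz unfolding invertible_def by blast
  \<comment> \<open>Aiming \<open>K + 1/2\<close> above \<open>y j\<close> leaves room for an error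
    of \<open>K\<close> on either side with the upper inequality strict; hence the width
    \<open>2 * K + 1\<close>.\<close>
  define Y :: "real^'n" where "Y = (\<chi> j. if j = k then 0 else y j + (K + 1/2))"
  define x where "x = D' *v Y"
  have Dx: "D *v x = Y" using D' by (simp add: x_def matrix_vector_mul_assoc)
  define q where "q l = \<lfloor>x $ l\<rfloor>" for l
  have "x $ k = 0" using row_k[of x] by (simp add: Dx Y_def)
  then have "q k = 0" by (simp add: q_def)
  moreover have "y j \<le> form q j \<and> form q j < y j + (2 * K + 1)" if j: "j \<noteq> k" for j
  proof -
    have "form q j - Y $ j = (\<Sum>l\<in>UNIV. D $ j $ l * (of_int (q l) - x $ l))"
      unfolding Dx[symmetric] form_def by (simp add: matrix_vector_mult_def algebra_simps sum_subtractf)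
    then have "\<bar>form q j - Y $ j\<bar> \<le> (\<Sum>l\<in>UNIV. \<bar>D $ j $ l * (of_int (q l) - x $ l)\<bar>)"
      by (simp only: sum_abs)
    also have "\<dots> \<le> (\<Sum>l\<in>UNIV. \<bar>D $ j $ l\<bar>)"
    proof (intro sum_mono)
      fix l
      have "\<bar>of_int (q l) - x $ l\<bar> \<le> 1" unfolding q_def by linarith
      then show "\<bar>D $ j $ l * (of_int (q l) - x $ l)\<bar> \<le> \<bar>D $ j $ l\<bar>"
        by (simp add: abs_mult mult_left_le)
    qed
    also have "\<dots> \<le> K" unfolding K_def by (rule member_le_sum) (auto intro: sum_nonneg)
    finally show ?thesis using j by (simp add: Y_def) linarith
  qed
  ultimately show "\<exists>q. q k = 0 \<and> (\<forall>j\<in>UNIV - {k}. y j \<le> form q j \<and> form q j < y j + (2 * K + 1))"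
    by blast
qed

text \<open>The inverse of \<open>D\<close> is bounded. This turns bounds on the forms into bounds
  on integer coordinates, and so into finiteness and counting.\<close>

lemma form_bounded:
  obtains C where "C \<ge> 1"
    "\<And>q M l. q k = 0 \<Longrightarrow> M \<ge> 0 \<Longrightarrow> (\<And>j. j \<noteq> k \<Longrightarrow> \<bar>form q j\<bar> \<le> M) \<Longrightarrow> \<bar>of_int (q l)\<bar> \<le> C * M"
proof -
  obtain D' where D': "D' ** D = mat 1"
    using det_D invertible_det_nz unfolding invertible_def by blast
  obtain K where K: "K > 0" "\<And>x. norm (D' *v x) \<le> norm x * K"
    using bounded_linear.pos_bounded[OF matrix_vector_mul_bounded_linear] by blast
  show ?thesis
  proof
    show "max 1 (real CARD('n) * K) \<ge> 1" by simp
    fix q :: "'n \<Rightarrow> int" and M :: real and l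
    assume q: "q k = 0" and M: "M \<ge> 0" "\<And>j. j \<noteq> k \<Longrightarrow> \<bar>form q j\<bar> \<le> M"
    define v :: "real^'n" where "v = (\<chi> l. of_int (q l))"
    have "\<bar>of_int (q l)\<bar> = \<bar>v $ l\<bar>" by (simp add: v_def)
    also have "\<dots> \<le> norm v" by (rule component_le_norm_cart)
    also have "v = D' *v (D *v v)" using D' by (simp add: matrix_vector_mul_assoc)
    also have "norm \<dots> \<le> norm (D *v v) * K" by (rule K)
    also have "norm (D *v v) \<le> (\<Sum>j\<in>UNIV. \<bar>(D *v v) $ j\<bar>)" by (rule norm_le_l1_cart)
    also have "\<dots> \<le> (\<Sum>j::'n\<in>UNIV. M)"
    proof (intro sum_mono)
      fix j
      show "\<bar>(D *v v) $ j\<bar> \<le> M"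
        using M q row_k[of v] by (cases "j = k") (auto simp: v_def form_def)
    qed
    finally have "\<bar>of_int (q l)\<bar> \<le> real CARD('n) * K * M" using K(1) by (simp add: mult_ac)
    also have "\<dots> \<le> max 1 (real CARD('n) * K) * M" using M by (intro mult_right_mono) auto
    finally show "\<bar>of_int (q l)\<bar> \<le> max 1 (real CARD('n) * K) * M" .
  qed
qed

lemma finite_box_functions: "finite {q::'n \<Rightarrow> int. q k = 0 \<and> (\<forall>l. \<bar>q l\<bar> \<le> N)}"
  and card_box_functions: "N \<ge> 0 \<Longrightarrow> card {q::'n \<Rightarrow> int. q k = 0 \<and> (\<forall>l. \<bar>q l\<bar> \<le> N)} \<le> nat (2 * N + 1) ^ card (UNIV - {k})"
proof -
  let ?S = "{q::'n \<Rightarrow> int. q k = 0 \<and> (\<forall>l. \<bar>q l\<bar> \<le> N)}"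
  let ?P = "Pi\<^sub>E (UNIV - {k}) (\<lambda>_. {-N..N})"
  have inj: "inj_on (\<lambda>q. restrict q (UNIV - {k})) ?S"
  proof (rule inj_onI)
    fix q q' assume q: "q \<in> ?S" "q' \<in> ?S" and eq: "restrict q (UNIV - {k}) = restrict q' (UNIV - {k})"
    show "q = q'"
    proof
      fix l show "q l = q' l"
        using q fun_cong[OF eq, of l] by (cases "l = k") auto
    qed
  qed
  have sub: "(\<lambda>q. restrict q (UNIV - {k})) ` ?S \<subseteq> ?P"
    by (auto simp: abs_le_iff minus_le_iff split: if_splits)
  have fin: "finite ?P" by (intro finite_PiE) auto
  show "finite ?S" using inj sub fin by (meson finite_imageD finite_subset)
  show "card ?S \<le> nat (2 * N + 1) ^ card (UNIV - {k})" if "N \<ge> 0"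
  proof -
    have "card ?S \<le> card ?P" by (rule card_inj_on_le[OF inj sub fin])
    also have "\<dots> = nat (2 * N + 1) ^ card (UNIV - {k})"
      by (simp add: card_PiE add.commute)
    finally show ?thesis .
  qed
qed

lemma finite_box_points:
  assumes "0 \<le> A" "0 \<le> B" shows "finite (box_points A B)"
proof -
  obtain C where C: "C \<ge> 1"
    "\<And>q M l. q k = 0 \<Longrightarrow> M \<ge> 0 \<Longrightarrow> (\<And>j. j \<noteq> k \<Longrightarrow> \<bar>form q j\<bar> \<le> M) \<Longrightarrow> \<bar>of_int (q l)\<bar> \<le> C * M"
    using form_bounded by blast
  have "box_points A B \<subseteq> {q. q k = 0 \<and> (\<forall>l. \<bar>q l\<bar> \<le> \<lceil>C * B\<rceil>)}"
  proof
    fix q assume q: "q \<in> box_points A B"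
    have "\<bar>of_int (q l)\<bar> \<le> C * B" for l
      using q assms by (intro C) (force simp: box_points_def)+
    then have "\<bar>q l\<bar> \<le> \<lceil>C * B\<rceil>" for l by (metis of_int_abs le_of_int_ceiling of_int_le_iff order_trans)
    then show "q \<in> {q. q k = 0 \<and> (\<forall>l. \<bar>q l\<bar> \<le> \<lceil>C * B\<rceil>)}" using q by (simp add: box_points_def)
  qed
  then show ?thesis by (rule finite_subset) (rule finite_box_functions)
qed

section \<open>Weighted counts of all and of primitive integer points\<close>

lemma weight_nonneg: "0 \<le> A \<Longrightarrow> q \<in> box_points A B \<Longrightarrow> 0 \<le> weight q"
  unfolding weight_def by (intro prod_nonneg) (auto simp: box_points_def intro: order_trans)

text \<open>Tile by cubes of side \<open>\<rho>\<close> and choose one integer point with values in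
  each cube. In the cube of index \<open>\<kappa>\<close> the weight is at least the product of the
  \<open>1 / (\<rho> * (\<kappa> j + 1))\<close>, and the sum of these products over all index
  vectors is a power of a harmonic sum.\<close>

lemma sum_weight_ge:
  obtains \<rho> where "\<rho> \<ge> 1" "\<And>a b. 0 < a \<Longrightarrow>
     ((\<Sum>i\<in>{a..<b}. 1 / (real i + 1)) / \<rho>) ^ card (UNIV - {k}) \<le> (\<Sum>q\<in>box_points (\<rho> * real a) (\<rho> * real b). weight q)"
proof -
  obtain \<rho> where \<rho>: "\<rho> \<ge> 1"
    and "\<And>y. \<exists>q. q k = 0 \<and> (\<forall>j\<in>UNIV - {k}. y j \<le> form q j \<and> form q j < y j + \<rho>)"
    using form_covering by blast
  then obtain F where F: "\<And>y. F y k = 0" "\<And>y j. j \<noteq> k \<Longrightarrow> y j \<le> form (F y) j \<and> form (F y) j < y j + \<rho>"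
    by (metis DiffI UNIV_I singletonD)
  show ?thesis
  proof (rule that[OF \<rho>])
    fix a b :: nat assume a: "0 < a"
    let ?J = "UNIV - {k}"
    let ?P = "Pi\<^sub>E ?J (\<lambda>_. {a..<b})"
    let ?Q = "\<lambda>\<kappa>. F (\<lambda>j. \<rho> * real (\<kappa> j))"
    \<comment> \<open>The cube index can be read off the chosen point, so distinct cubes give
      distinct points.\<close>
    have fl: "\<kappa> j = nat \<lfloor>form (?Q \<kappa>) j / \<rho>\<rfloor>" if "j \<noteq> k" for \<kappa> :: "'n \<Rightarrow> nat" and j
    proof -
      have "\<lfloor>form (?Q \<kappa>) j / \<rho>\<rfloor> = int (\<kappa> j)"
        using F(2)[OF that, of "\<lambda>j. \<rho> * real (\<kappa> j)"] \<rho> by (simp add: floor_eq_iff field_simps)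
      then show ?thesis by simp
    qed
    have inj: "inj_on ?Q ?P"
    proof (rule inj_onI)
      fix \<kappa> \<kappa>' assume \<kappa>: "\<kappa> \<in> ?P" "\<kappa>' \<in> ?P" and eq: "?Q \<kappa> = ?Q \<kappa>'"
      show "\<kappa> = \<kappa>'"
      proof
        fix j show "\<kappa> j = \<kappa>' j"
        proof (cases "j = k")
          case False
          then show ?thesis using fl[of j \<kappa>] fl[of j \<kappa>'] eq by simp
        next
          case True
          then show ?thesis using \<kappa> by (auto simp: PiE_def extensional_def)
        qed
      qed
    qed
    have sub: "?Q ` ?P \<subseteq> box_points (\<rho> * real a) (\<rho> * real b)"
    proof
      fix q assume "q \<in> ?Q ` ?P"
      then obtain \<kappa> where \<kappa>: "\<kappa> \<in> ?P" "q = ?Q \<kappa>" by blast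
      have "\<rho> * real a \<le> form q j \<and> form q j \<le> \<rho> * real b" if j: "j \<noteq> k" for j
      proof -
        have "a \<le> \<kappa> j" "Suc (\<kappa> j) \<le> b" using \<kappa> j by (auto simp: PiE_def Pi_def Suc_le_eq)
        then have "real a \<le> real (\<kappa> j)" "real (\<kappa> j) + 1 \<le> real b" by simp_all
        then have "\<rho> * real a \<le> \<rho> * real (\<kappa> j)" "\<rho> * (real (\<kappa> j) + 1) \<le> \<rho> * real b"
          using \<rho> by (auto intro!: mult_left_mono)
        moreover have "\<rho> * real (\<kappa> j) \<le> form q j" "form q j < \<rho> * real (\<kappa> j) + \<rho>"
          using F(2)[OF j, of "\<lambda>j. \<rho> * real (\<kappa> j)"] unfolding \<kappa>(2) by blast+
        ultimately show ?thesis unfolding distrib_left by linarith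
      qed
      then show "q \<in> box_points (\<rho> * real a) (\<rho> * real b)"
        using F(1) \<kappa> by (auto simp: box_points_def)
    qed
    have "((\<Sum>i\<in>{a..<b}. 1 / (real i + 1)) / \<rho>) ^ card ?J = (\<Prod>j\<in>?J. \<Sum>i\<in>{a..<b}. 1 / (\<rho> * (real i + 1)))"
      by (simp add: sum_divide_distrib mult.commute)
    also have "\<dots> = (\<Sum>\<kappa>\<in>?P. \<Prod>j\<in>?J. 1 / (\<rho> * (real (\<kappa> j) + 1)))"
      by (rule prod_sum_PiE) auto
    also have "\<dots> \<le> (\<Sum>\<kappa>\<in>?P. weight (?Q \<kappa>))"
    proof (rule sum_mono)
      fix \<kappa> assume \<kappa>: "\<kappa> \<in> ?P"
      show "(\<Prod>j\<in>?J. 1 / (\<rho> * (real (\<kappa> j) + 1))) \<le> weight (?Q \<kappa>)"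
        unfolding weight_def
      proof (rule prod_mono)
        fix j assume j: "j \<in> ?J"
        then have "0 < \<rho> * real (\<kappa> j)" using \<kappa> a \<rho> by (auto simp: PiE_def Pi_def intro!: mult_pos_pos)
        moreover have "\<rho> * real (\<kappa> j) \<le> form (?Q \<kappa>) j" "form (?Q \<kappa>) j \<le> \<rho> * (real (\<kappa> j) + 1)"
          using F(2)[of j "\<lambda>j. \<rho> * real (\<kappa> j)"] j by (auto simp: distrib_left)
        ultimately show "0 \<le> 1 / (\<rho> * (real (\<kappa> j) + 1)) \<and> 1 / (\<rho> * (real (\<kappa> j) + 1)) \<le> 1 / form (?Q \<kappa>) j"
          using \<rho> by (auto intro!: divide_left_mono mult_pos_pos)
      qed
    qed
    also have "\<dots> = (\<Sum>q\<in>?Q ` ?P. weight q)" by (simp add: sum.reindex[OF inj])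
    also have "\<dots> \<le> (\<Sum>q\<in>box_points (\<rho> * real a) (\<rho> * real b). weight q)"
      using sub \<rho> by (intro sum_mono2 finite_box_points) (auto intro!: weight_nonneg[of "\<rho> * real a"])
    finally show "((\<Sum>i\<in>{a..<b}. 1 / (real i + 1)) / \<rho>) ^ card ?J \<le> (\<Sum>q\<in>box_points (\<rho> * real a) (\<rho> * real b). weight q)" .
  qed
qed

text \<open>Write a point as \<open>g\<close> times a primitive point. If \<open>g \<le> A\<close>,
  the primitive part still has its forms between 1 and \<open>B\<close>, and the factors
  \<open>1 / g^m\<close> sum to at most 2 because \<open>m \<ge> 2\<close>. If \<open>g > A\<close>,
  the primitive part has coordinates of size at most \<open>C * B / A\<close>, so such points are
  few, and each has weight at most \<open>1 / A^m\<close>.\<close>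

lemma sum_weight_le:
  assumes m: "card (UNIV - {k}) \<ge> 2" and A: "1 \<le> A" "A \<le> B"
    and C: "1 \<le> C" "\<And>q M l. q k = 0 \<Longrightarrow> M \<ge> 0 \<Longrightarrow> (\<And>j. j \<noteq> k \<Longrightarrow> \<bar>form q j\<bar> \<le> M) \<Longrightarrow> \<bar>of_int (q l)\<bar> \<le> C * M"
  shows "(\<Sum>q\<in>box_points A B. weight q) \<le> 2 * (\<Sum>q\<in>{q \<in> box_points 1 B. primitive q}. weight q)
     + C * B * (2 * C * B / A + 1) ^ card (UNIV - {k}) / A ^ card (UNIV - {k})"
proof -
  let ?m = "card (UNIV - {k})"
  let ?X = "box_points A B" and ?Pr = "{q \<in> box_points 1 B. primitive q}"
  have finX: "finite ?X" using A by (intro finite_box_points) auto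
  have finPr: "finite ?Pr" using A finite_box_points[of 1 B] by simp
  obtain j0 where j0: "j0 \<noteq> k"
  proof -
    have "UNIV - {k} \<noteq> {}" using m by (metis card.empty not_numeral_le_zero)
    then show ?thesis using that by blast
  qed
  have nonzero: "\<exists>i. q i \<noteq> 0" if "q \<in> ?X" for q
  proof (rule ccontr)
    assume "\<not> ?thesis"
    then have "form q j0 = 0" by (simp add: form_def vec_eq_iff matrix_vector_mult_def)
    moreover have "A \<le> form q j0" using that j0 by (simp add: box_points_def)
    ultimately show False using A by simp
  qed
  let ?P = "\<lambda>q r. 0 < fst r \<and> primitive (snd r) \<and> (\<lambda>l. int (fst r) * snd r l) = q"
  have "\<forall>q\<in>?X. \<exists>r. ?P q r"
  proof
    fix q assume "q \<in> ?X"
    then obtain i where "q i \<noteq> 0" using nonzero by blast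
    from ex_primitive[of q, OF this] obtain g q' where g: "0 < g" "primitive q'" "q = (\<lambda>l. int g * q' l)"
      by blast
    have "?P q (g, q')" using g(1,2) by (simp only: fst_conv snd_conv g(3) simp_thms)
    then show "\<exists>r. ?P q r" ..
  qed
  from bchoice[OF this] obtain h where h: "\<forall>q\<in>?X. ?P q (h q)" ..
  define gg pp where "gg q = fst (h q)" and "pp q = snd (h q)" for q
  have gpos: "0 < gg q" and prim: "primitive (pp q)" and eq: "(\<lambda>l. int (gg q) * pp q l) = q"
    if "q \<in> ?X" for q
    using bspec[OF h that] by (simp_all only: gg_def pp_def)
  have qk: "q k = 0" and qf: "\<And>j. j \<noteq> k \<Longrightarrow> A \<le> form q j \<and> form q j \<le> B" if "q \<in> ?X" for q
    using that by (auto simp: box_points_def)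
  have inj: "inj_on (\<lambda>q. (gg q, pp q)) ?X"
  proof (rule inj_onI)
    fix q q' assume q: "q \<in> ?X" "q' \<in> ?X" and "(gg q, pp q) = (gg q', pp q')"
    then have "(\<lambda>l. int (gg q) * pp q l) = (\<lambda>l. int (gg q') * pp q' l)" by simp
    then show "q = q'" using eq q by simp
  qed
  have ppk: "pp q k = 0" if "q \<in> ?X" for q
    using fun_cong[OF eq[OF that], of k] qk[OF that] gpos[OF that] by simp
  have fpp: "form q j = real (gg q) * form (pp q) j" if "q \<in> ?X" for q j
    using form_mult[of "int (gg q)" "pp q" j] by (simp add: eq[OF that])
  have wpp: "weight q = weight (pp q) / real (gg q) ^ ?m" if "q \<in> ?X" for q
    using weight_mult[of "int (gg q)" "pp q"] by (simp add: eq[OF that])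
  let ?G = "{q \<in> ?X. real (gg q) \<le> A}" and ?H = "{q \<in> ?X. \<not> real (gg q) \<le> A}"
  have good: "(\<Sum>q\<in>?G. weight q) \<le> 2 * (\<Sum>q\<in>?Pr. weight q)"
  proof -
    have sub: "(\<lambda>q. (gg q, pp q)) ` ?G \<subseteq> {1..nat \<lfloor>A\<rfloor>} \<times> ?Pr"
    proof (rule image_subsetI)
      fix q assume "q \<in> ?G"
      then have q: "q \<in> ?X" "real (gg q) \<le> A" by simp_all
      have "1 \<le> form (pp q) j \<and> form (pp q) j \<le> B" if j: "j \<noteq> k" for j
      proof -
        have g: "real (gg q) > 0" using gpos[OF q(1)] by simp
        have "real (gg q) * 1 \<le> real (gg q) * form (pp q) j"
          using qf[OF q(1) j] q(2) by (simp add: fpp[OF q(1)])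
        then have 1: "1 \<le> form (pp q) j" using g by (simp only: mult_le_cancel_left_pos)
        have 2: "1 * form (pp q) j \<le> real (gg q) * form (pp q) j"
          using 1 g by (intro mult_right_mono) auto
        show ?thesis using 1 2 qf[OF q(1) j] unfolding fpp[OF q(1)] by linarith
      qed
      moreover have "gg q \<le> nat \<lfloor>A\<rfloor>" using q(2) by (simp add: le_nat_floor)
      ultimately show "(gg q, pp q) \<in> {1..nat \<lfloor>A\<rfloor>} \<times> ?Pr"
        using gpos[OF q(1)] prim[OF q(1)] ppk[OF q(1)] by (auto simp: box_points_def)
    qed
    have "(\<Sum>q\<in>?G. weight q) = (\<Sum>q\<in>?G. (\<lambda>(g, q'). weight q' / real g ^ ?m) (gg q, pp q))"
      by (intro sum.cong) (auto simp: wpp)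
    also have "\<dots> = (\<Sum>(g, q')\<in>(\<lambda>q. (gg q, pp q)) ` ?G. weight q' / real g ^ ?m)"
      by (subst sum.reindex) (auto intro: inj_on_subset[OF inj])
    also have "\<dots> \<le> (\<Sum>(g, q')\<in>{1..nat \<lfloor>A\<rfloor>} \<times> ?Pr. weight q' / real g ^ ?m)"
      using sub finPr by (intro sum_mono2) (auto intro!: divide_nonneg_nonneg weight_nonneg[of 1])
    also have "\<dots> = (\<Sum>g\<in>{1..nat \<lfloor>A\<rfloor>}. 1 / real g ^ ?m) * (\<Sum>q\<in>?Pr. weight q)"
      by (simp add: sum.cartesian_product[symmetric] sum_product)
    also have "\<dots> \<le> 2 * (\<Sum>q\<in>?Pr. weight q)"
    proof (rule mult_right_mono)
      have "(\<Sum>g\<in>{1..nat \<lfloor>A\<rfloor>}. 1 / real g ^ ?m) \<le> (\<Sum>g\<in>{1..nat \<lfloor>A\<rfloor>}. 1 / real g ^ 2)"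
        using m by (intro sum_mono divide_left_mono power_increasing) auto
      then show "(\<Sum>g\<in>{1..nat \<lfloor>A\<rfloor>}. 1 / real g ^ ?m) \<le> 2"
        using sum_inverse_squares_le[of "nat \<lfloor>A\<rfloor>"] by linarith
      show "0 \<le> (\<Sum>q\<in>?Pr. weight q)" by (intro sum_nonneg) (auto intro!: weight_nonneg[of 1])
    qed
    finally show ?thesis .
  qed
  have bad: "(\<Sum>q\<in>?H. weight q) \<le> C * B * (2 * C * B / A + 1) ^ ?m / A ^ ?m"
  proof -
    let ?N = "\<lfloor>C * B / A\<rfloor>"
    have CB: "0 \<le> C * B" "0 \<le> C * B / A" using A C(1) by auto
    have sub: "(\<lambda>q. (gg q, pp q)) ` ?H \<subseteq> {1..nat \<lfloor>C * B\<rfloor>} \<times> {q. q k = 0 \<and> (\<forall>l. \<bar>q l\<bar> \<le> ?N)}"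
    proof (rule image_subsetI)
      fix q assume "q \<in> ?H"
      then have q: "q \<in> ?X" "\<not> real (gg q) \<le> A" by simp_all
      have qB: "\<bar>of_int (q l)\<bar> \<le> C * B" for l
        using A qf[OF q(1)] by (intro C(2) qk[OF q(1)]) force+
      have ql: "q l = int (gg q) * pp q l" for l using fun_cong[OF eq[OF q(1)], of l] by simp
      obtain i where "q i \<noteq> 0" using nonzero[OF q(1)] by blast
      then have "\<bar>pp q i\<bar> \<ge> 1" using ql[of i] by auto
      then have "real (gg q) * 1 \<le> real (gg q) * \<bar>of_int (pp q i)\<bar>" by (intro mult_left_mono) auto
      also have "\<dots> \<le> C * B" using qB[of i] by (simp add: ql abs_mult)
      finally have "gg q \<le> nat \<lfloor>C * B\<rfloor>" by (simp add: le_nat_floor)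
      moreover have "\<bar>pp q l\<bar> \<le> ?N" for l
      proof -
        have "A * \<bar>of_int (pp q l)\<bar> \<le> real (gg q) * \<bar>of_int (pp q l)\<bar>"
          using q(2) by (intro mult_right_mono) auto
        also have "\<dots> \<le> C * B" using qB[of l] by (simp add: ql abs_mult)
        finally have "\<bar>of_int (pp q l)\<bar> \<le> C * B / A" using A by (simp add: field_simps)
        then show ?thesis by (simp add: le_floor_iff)
      qed
      ultimately show "(gg q, pp q) \<in> {1..nat \<lfloor>C * B\<rfloor>} \<times> {q. q k = 0 \<and> (\<forall>l. \<bar>q l\<bar> \<le> ?N)}"
        using gpos[OF q(1)] prim[OF q(1)] ppk[OF q(1)] by auto
    qed
    have "card ?H \<le> card ({1..nat \<lfloor>C * B\<rfloor>} \<times> {q. q k = 0 \<and> (\<forall>l. \<bar>q l\<bar> \<le> ?N)})"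
      using sub by (intro card_inj_on_le[of "\<lambda>q. (gg q, pp q)"] finite_cartesian_product finite_box_functions)
        (auto intro: inj_on_subset[OF inj])
    also have "\<dots> \<le> nat \<lfloor>C * B\<rfloor> * nat (2 * ?N + 1) ^ ?m"
      using CB card_box_functions[of ?N] by (simp add: card_cartesian_product)
    finally have "real (card ?H) \<le> real (nat \<lfloor>C * B\<rfloor> * nat (2 * ?N + 1) ^ ?m)"
      by (rule of_nat_mono)
    also have "\<dots> = of_int \<lfloor>C * B\<rfloor> * (2 * of_int ?N + 1) ^ ?m"
      using CB by simp
    also have "\<dots> \<le> C * B * (2 * (C * B / A) + 1) ^ ?m"
      using CB of_int_floor_le[of "C * B / A"]
      by (intro mult_mono power_mono add_mono mult_left_mono) (auto intro: order_trans)
    finally have card: "real (card ?H) \<le> C * B * (2 * C * B / A + 1) ^ ?m" by (simp add: mult.assoc)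
    have "(\<Sum>q\<in>?H. weight q) \<le> (\<Sum>q\<in>?H. 1 / A ^ ?m)"
    proof (rule sum_mono)
      fix q assume "q \<in> ?H"
      then have "q \<in> ?X" by simp
      then have "weight q \<le> (\<Prod>j\<in>UNIV - {k}. 1 / A)"
        unfolding weight_def
      proof (intro prod_mono)
        fix j assume "j \<in> UNIV - {k}"
        then have "A \<le> form q j" using qf[OF \<open>q \<in> ?X\<close>] by simp
        then show "0 \<le> 1 / form q j \<and> 1 / form q j \<le> 1 / A"
          using A by (auto intro: divide_left_mono)
      qed
      then show "weight q \<le> 1 / A ^ ?m" by (simp add: power_one_over)
    qed
    also have "\<dots> = real (card ?H) / A ^ ?m" by simp
    also have "\<dots> \<le> C * B * (2 * C * B / A + 1) ^ ?m / A ^ ?m"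
      using card A by (intro divide_right_mono) auto
    finally show ?thesis .
  qed
  have "(\<Sum>q\<in>?X. weight q) = (\<Sum>q\<in>?G. weight q) + (\<Sum>q\<in>?H. weight q)"
    using finX by (subst sum.union_disjoint[symmetric]) (auto intro: sum.cong)
  then show ?thesis using good bad by linarith
qed

text \<open>The full weighted sum between two scales is at least of order \<open>(ln n)^m\<close>,
  while points with a large common factor contribute a bounded amount; what remains must come from
  primitive points.\<close>

lemma sum_weight_primitive_ge:
  assumes m: "card (UNIV - {k}) \<ge> 2"
  obtains \<rho> c n0 where "\<rho> \<ge> 1" "c > 0"
    "\<And>n::nat. n \<ge> n0 \<Longrightarrow> c * ln (real n) ^ card (UNIV - {k}) \<le>
       (\<Sum>q\<in>{q \<in> box_points 1 (\<rho> * real n ^ 5). primitive q}. weight q)"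
proof -
  let ?m = "card (UNIV - {k})"
  obtain \<rho> where \<rho>: "\<rho> \<ge> 1" and low: "\<And>a b. 0 < a \<Longrightarrow>
     ((\<Sum>i\<in>{a..<b}. 1 / (real i + 1)) / \<rho>) ^ ?m \<le> (\<Sum>q\<in>box_points (\<rho> * real a) (\<rho> * real b). weight q)"
    using sum_weight_ge by blast
  obtain C where C: "C \<ge> 1"
    "\<And>q M l. q k = 0 \<Longrightarrow> M \<ge> 0 \<Longrightarrow> (\<And>j. j \<noteq> k \<Longrightarrow> \<bar>form q j\<bar> \<le> M) \<Longrightarrow> \<bar>of_int (q l)\<bar> \<le> C * M"
    using form_bounded by blast
  define K where "K = C * \<rho> * (3 * C) ^ ?m"
  have "filterlim (\<lambda>n. (ln (real n) / (2 * \<rho>)) ^ ?m) at_top sequentially"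
  proof (rule filterlim_pow_at_top)
    show "0 < ?m" using m by simp
    have "filterlim (\<lambda>n. (1 / (2 * \<rho>)) * ln (real n)) at_top sequentially"
      using \<rho> by (intro filterlim_tendsto_pos_mult_at_top[OF tendsto_const]
          filterlim_compose[OF ln_at_top filterlim_real_sequentially]) auto
    then show "filterlim (\<lambda>n. ln (real n) / (2 * \<rho>)) at_top sequentially"
      by (simp only: times_divide_eq_left mult_1_left)
  qed
  then have "\<forall>\<^sub>F n in sequentially. 2 * K \<le> (ln (real n) / (2 * \<rho>)) ^ ?m"
    unfolding filterlim_at_top by blast
  then obtain n1 where n1: "\<And>n. n \<ge> n1 \<Longrightarrow> 2 * K \<le> (ln (real n) / (2 * \<rho>)) ^ ?m"
    by (auto simp: eventually_sequentially)
  show ?thesis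
  proof (rule that[OF \<rho>])
    \<comment> \<open>The 2 in the base comes from the logarithm of a square root. The 4 arises
      because the error \<open>K\<close> uses up half of the main term and the primitive sum enters
      with a factor 2.\<close>
    show "1 / (4 * (2 * \<rho>) ^ ?m) > 0" using \<rho> by simp
    fix n assume n: "n \<ge> max n1 4"
    \<comment> \<open>With these exponents the error term of \<open>sum_weight_le\<close> is at most
      a constant times \<open>n^(5 + m) / n^(4 * m)\<close>, which is bounded as
      \<open>m \<ge> 2\<close>, while the ratio \<open>n\<close> of the scales still produces a
      logarithm.\<close>
    let ?A = "\<rho> * real (n ^ 4)" and ?B = "\<rho> * real (n ^ 5)"
    let ?S = "\<Sum>q\<in>{q \<in> box_points 1 ?B. primitive q}. weight q"
    have npos: "real n \<ge> 4" using n by simp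
    have A1: "1 \<le> ?A" using \<rho> npos mult_mono[of 1 \<rho> 1 "real n ^ 4"] by (simp add: one_le_power)
    have AB: "?A \<le> ?B" using \<rho> npos by (simp add: power_increasing)
    have "ln (real n) / 2 \<le> ln ((real (n ^ 5) + 1) / (real (n ^ 4) + 1))"
    proof -
      have "ln (real n) / 2 = ln (sqrt (real n))" using npos by (simp add: ln_sqrt)
      also have "\<dots> \<le> ln ((real (n ^ 5) + 1) / (real (n ^ 4) + 1))"
      proof (rule ln_mono)
        have s: "sqrt (real n) \<ge> 2" using npos real_le_rsqrt[of 2 "real n"] by simp
        have "sqrt (real n) * (real (n ^ 4) + 1) \<le> sqrt (real n) * (2 * real (n ^ 4))"
          using npos one_le_power[of "real n" 4] s by (intro mult_left_mono) auto
        also have "\<dots> \<le> sqrt (real n) * (sqrt (real n) * real (n ^ 4))"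
          using s by (intro mult_left_mono mult_right_mono) auto
        also have "\<dots> = real (n ^ 5)" using npos by (simp add: power_Suc[symmetric] flip: mult.assoc)
        finally show "sqrt (real n) \<le> (real (n ^ 5) + 1) / (real (n ^ 4) + 1)"
          using zero_le_power[of "real n" 4] by (subst pos_le_divide_eq) (auto intro: add_nonneg_pos)
      qed (use npos in auto)
      finally show ?thesis .
    qed
    also have "\<dots> \<le> (\<Sum>i\<in>{n ^ 4..<n ^ 5}. 1 / (real i + 1))"
      using npos by (intro sum_inverse_ge_ln power_increasing) auto
    finally have "ln (real n) / (2 * \<rho>) \<le> (\<Sum>i\<in>{n ^ 4..<n ^ 5}. 1 / (real i + 1)) / \<rho>"
      using \<rho> by (simp add: field_simps)
    then have "(ln (real n) / (2 * \<rho>)) ^ ?m \<le> ((\<Sum>i\<in>{n ^ 4..<n ^ 5}. 1 / (real i + 1)) / \<rho>) ^ ?m"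
      using npos \<rho> by (intro power_mono) auto
    also have "\<dots> \<le> (\<Sum>q\<in>box_points ?A ?B. weight q)"
      using npos by (intro low) auto
    also have "\<dots> \<le> 2 * ?S + C * ?B * (2 * C * ?B / ?A + 1) ^ ?m / ?A ^ ?m"
      by (rule sum_weight_le[OF m A1 AB C(1)]) (rule C(2))
    also have "C * ?B * (2 * C * ?B / ?A + 1) ^ ?m / ?A ^ ?m \<le> K"
    proof -
      have "?B / ?A = real n" using \<rho> npos by (simp add: eval_nat_numeral)
      then have "2 * C * ?B / ?A + 1 = 2 * C * real n + 1" by (metis times_divide_eq_right)
      also have "\<dots> \<le> 3 * C * real n"
        using mult_mono[of 1 C 1 "real n"] C(1) npos by simp
      finally have "(2 * C * ?B / ?A + 1) ^ ?m \<le> (3 * C * real n) ^ ?m"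
        using C(1) \<rho> by (intro power_mono) auto
      then have "C * ?B * (2 * C * ?B / ?A + 1) ^ ?m \<le> C * ?B * (3 * C * real n) ^ ?m"
        using C(1) \<rho> by (intro mult_left_mono) auto
      also have "\<dots> = K * real n ^ (5 + ?m)"
      proof -
        have "C * (\<rho> * x ^ 5) * (3 * C * x) ^ N = C * \<rho> * (3 * C) ^ N * x ^ (5 + N)" for x N
          by (simp add: power_mult_distrib power_add mult_ac)
        then show ?thesis by (simp only: K_def of_nat_power)
      qed
      also have "\<dots> \<le> K * real n ^ (4 * ?m)"
        using C(1) \<rho> npos m unfolding K_def by (intro mult_left_mono power_increasing) auto
      also have "\<dots> \<le> K * ?A ^ ?m"
      proof (rule mult_left_mono)
        have "1 * real n ^ (4 * ?m) \<le> \<rho> ^ ?m * real n ^ (4 * ?m)"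
          using \<rho> npos by (intro mult_right_mono one_le_power) auto
        then show "real n ^ (4 * ?m) \<le> ?A ^ ?m" by (simp add: power_mult_distrib power_mult)
        show "0 \<le> K" using C(1) \<rho> by (simp add: K_def)
      qed
      finally show ?thesis using A1 by (simp add: divide_le_eq)
    qed
    also have "K \<le> (ln (real n) / (2 * \<rho>)) ^ ?m / 2" using n1[of n] n by simp
    finally have "(ln (real n) / (2 * \<rho>)) ^ ?m / 4 \<le> ?S" by simp
    then show "1 / (4 * (2 * \<rho>) ^ ?m) * ln (real n) ^ ?m \<le> (\<Sum>q\<in>{q \<in> box_points 1 (\<rho> * real n ^ 5). primitive q}. weight q)"
      by (simp add: power_divide)
  qed
qed

text \<open>Parallel primitive vectors agree up to sign, and a form positive on both decides the
  sign. Thus distinct primitive points of a box are never parallel, as independence on the torus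
  requires.\<close>

lemma primitive_parallel:
  assumes q: "primitive q" "primitive q'" and par: "\<And>i l. q i * q' l = q l * q' i"
    and j: "form q j > 0" "form q' j > 0"
  shows "q = q'"
proof -
  have "\<exists>i. q i \<noteq> 0"
  proof (rule ccontr)
    assume "\<not> ?thesis"
    then have "is_unit (0::int)" using q(1) unfolding primitive_def by (metis dvd_refl)
    then show False by simp
  qed
  then obtain i where i: "q i \<noteq> 0" by blast
  define a b where "a = q i" and "b = q' i"
  have ab: "a * q' l = b * q l" for l using par[of i l] by (simp add: a_def b_def mult.commute)
  have a0: "a \<noteq> 0" using i by (simp add: a_def)
  obtain a' b' where g: "a = gcd a b * a'" "b = gcd a b * b'" "coprime a' b'"
    using gcd_coprime_exists[of a b] a0 by (metis gcd_eq_0_iff mult.commute)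
  have "gcd a b \<noteq> 0" using a0 by simp
  then have ab': "a' * q' l = b' * q l" for l
    using ab[of l] g by (metis mult.assoc mult_left_cancel)
  have "a' dvd q l" for l
    using ab'[of l] g(3) by (metis coprime_dvd_mult_right_iff dvd_triv_left)
  then have ua: "\<bar>a'\<bar> = 1" using q(1) by (auto simp: primitive_def)
  have "b' dvd q' l" for l
    using ab'[of l] g(3) by (metis coprime_commute coprime_dvd_mult_right_iff dvd_triv_left)
  then have ub: "\<bar>b'\<bar> = 1" using q(2) by (auto simp: primitive_def)
  have eq: "q' = (\<lambda>l. (a' * b') * q l)"
  proof
    fix l
    have "q' l = (a' * a') * q' l" using ua by (auto simp: abs_if split: if_splits)
    then show "q' l = (a' * b') * q l" using ab'[of l] by (simp add: mult.assoc)
  qed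
  then have f: "form q' j = of_int (a' * b') * form q j"
    using form_mult[of "a' * b'" q j] by simp
  have "a' * b' \<noteq> -1"
  proof
    assume "a' * b' = -1"
    then show False using f j by simp
  qed
  then have "a' * b' = 1"
    using ua ub by (auto simp: abs_if split: if_splits)
  then show ?thesis using eq by simp
qed

text \<open>For fixed \<open>n\<close> the events of the \<open>q \<in> Q n\<close> are pairwise
  independent, and their mean number tends to infinity with \<open>n\<close>, so the probability
  that none occurs tends to zero. The offset \<open>\<gamma>0\<close> enters through the constants
  \<open>\<tau> q\<close>.\<close>

lemma AE_small_value_many_forms:
  fixes \<gamma>0 :: "'n \<Rightarrow> real"
  assumes m: "card (UNIV - {k}) \<ge> 2" and \<kappa>: "0 < \<kappa>" "\<kappa> < real (card (UNIV - {k}))"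
  shows "AE \<gamma> in torus_measure. \<exists>t\<ge>t0. \<exists>p::int. \<exists>q. q k = 0 \<and>
    (\<forall>j\<in>UNIV - {k}. 1 \<le> \<bar>form q j\<bar> \<and> \<bar>form q j\<bar> \<le> exp t) \<and>
    \<bar>of_int p + (\<Sum>l\<in>UNIV. (\<gamma>0 l + \<gamma> l) * of_int (q l))\<bar> * (\<Prod>j\<in>UNIV - {k}. \<bar>form q j\<bar>) \<le> t powr (- \<kappa>)"
proof -
  interpret T: prob_space "torus_measure :: ('n \<Rightarrow> real) measure" by (rule prob_space_torus_measure)
  let ?m = "card (UNIV - {k})"
  obtain \<rho> c n0 where \<rho>: "\<rho> \<ge> 1" and c: "c > 0" and low:
    "\<And>n::nat. n \<ge> n0 \<Longrightarrow> c * ln (real n) ^ ?m \<le>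
       (\<Sum>q\<in>{q \<in> box_points 1 (\<rho> * real n ^ 5). primitive q}. weight q)"
    using sum_weight_primitive_ge[OF m] by blast
  \<comment> \<open>This makes \<open>exp (t n)\<close> equal to \<open>n^6\<close>, which dominates
    the box size \<open>\<rho> * n^5\<close> once \<open>n \<ge> \<rho>\<close>.\<close>
  define t where "t n = 6 * ln (real n)" for n :: nat
  define Q where "Q n = {q \<in> box_points 1 (\<rho> * real n ^ 5). primitive q}" for n :: nat
  define r where "r n q = t n powr (- \<kappa>) * weight q" for n q
  define \<tau> where "\<tau> q = (\<Sum>l\<in>UNIV. \<gamma>0 l * of_int (q l))" for q :: "'n \<Rightarrow> int"
  define E where "E n q = torus_hit (\<tau> q) q (r n q)" for n q
  have tlim: "filterlim t at_top sequentially"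
    unfolding t_def by (intro filterlim_tendsto_pos_mult_at_top[OF tendsto_const]
          filterlim_compose[OF ln_at_top filterlim_real_sequentially]) auto
  obtain j0 where j0: "j0 \<noteq> k"
  proof -
    have "UNIV - {k} \<noteq> {}" using m by (metis card.empty not_numeral_le_zero)
    then show ?thesis using that by blast
  qed
  have "((\<lambda>n. t n powr (- \<kappa>)) \<longlongrightarrow> 0) sequentially"
    using \<kappa> tlim by (intro tendsto_neg_powr) auto
  then have "\<forall>\<^sub>F n in sequentially. t n powr (- \<kappa>) < 1/2"
    by (rule order_tendstoD) simp
  moreover have "\<forall>\<^sub>F n in sequentially. max t0 1 \<le> t n"
    by (rule tlim[unfolded filterlim_at_top, rule_format])
  moreover have "\<forall>\<^sub>F n in sequentially. max (real n0) (\<rho> + 1) \<le> real n"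
    by (rule filterlim_real_sequentially[unfolded filterlim_at_top, rule_format])
  ultimately have "\<forall>\<^sub>F n in sequentially. t n powr (- \<kappa>) < 1/2 \<and> max t0 1 \<le> t n \<and> max (real n0) (\<rho> + 1) \<le> real n"
    by eventually_elim auto
  then obtain n1 where n1: "\<And>n. n \<ge> n1 \<Longrightarrow> t n powr (- \<kappa>) < 1/2 \<and> max t0 1 \<le> t n \<and> max (real n0) (\<rho> + 1) \<le> real n"
    by (auto simp: eventually_sequentially)
  have finQ: "finite (Q n)" for n
    unfolding Q_def using finite_box_points[of 1 "\<rho> * real n ^ 5"] \<rho> by simp
  have formQ: "1 \<le> form q j \<and> form q j \<le> \<rho> * real n ^ 5" if "q \<in> Q n" "j \<noteq> k" for n q j
    using that by (auto simp: Q_def box_points_def)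
  have wt: "0 < weight q \<and> weight q \<le> 1" if "q \<in> Q n" for n q
  proof
    have "0 < form q j" if j: "j \<noteq> k" for j using formQ[OF \<open>q \<in> Q n\<close> j] by linarith
    then show "0 < weight q" unfolding weight_def by (intro prod_pos) auto
    show "weight q \<le> 1" unfolding weight_def using formQ[OF that] by (intro prod_le_1) force
  qed
  have rQ: "0 \<le> r n q \<and> r n q < 1/2" if "q \<in> Q n" "n \<ge> n1" for n q
  proof
    show "0 \<le> r n q" using wt[OF that(1)] by (simp add: r_def)
    have "r n q \<le> t n powr (- \<kappa>) * 1" unfolding r_def using wt[OF that(1)] by (intro mult_left_mono) auto
    then show "r n q < 1/2" using n1[OF that(2)] by simp
  qed
  have qne: "\<exists>i. q i \<noteq> 0" if "q \<in> Q n" for n q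
  proof (rule ccontr)
    assume "\<not> ?thesis"
    then have "form q j0 = 0" by (simp add: form_def vec_eq_iff matrix_vector_mult_def)
    then show False using formQ[OF that j0] by simp
  qed
  have PE: "T.prob (E n q) = 2 * r n q" if "q \<in> Q n" "n \<ge> n1" for n q
    using qne[OF that(1)] rQ[OF that] measure_torus_hit unfolding E_def by blast
  have indep: "T.prob (E n q \<inter> E n q') = T.prob (E n q) * T.prob (E n q')"
    if q: "q \<in> Q n" "q' \<in> Q n" "q \<noteq> q'" and n: "n \<ge> n1" for n q q'
  proof -
    have "\<exists>i l. q i * q' l \<noteq> q l * q' i"
    proof (rule ccontr)
      assume "\<not> ?thesis"
      moreover have "0 < form q j0" "0 < form q' j0" using formQ[OF q(1) j0] formQ[OF q(2) j0] by auto
      ultimately have "q = q'" using q by (intro primitive_parallel[of q q' j0]) (auto simp: Q_def)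
      then show False using q(3) by simp
    qed
    then obtain i l where il: "q i * q' l \<noteq> q l * q' i" by blast
    show ?thesis
      unfolding E_def using rQ[OF q(1) n] rQ[OF q(2) n] by (intro measure_torus_hit_indep[OF il]) auto
  qed
  \<comment> \<open>Twice \<open>t n powr - \<kappa>\<close> times the lower bound for the weights;
    the powers of \<open>ln n\<close> combine to the exponent \<open>m - \<kappa>\<close>, which is
    positive by hypothesis.\<close>
  let ?mean = "\<lambda>n. 2 * c / 6 powr \<kappa> * ln (real n) powr (real ?m - \<kappa>)"
  have lnpos: "ln (real n) > 0" if "n \<ge> n1" for n using n1[OF that] by (simp add: t_def)
  have mean: "?mean n \<le> (\<Sum>q\<in>Q n. T.prob (E n q))" if n: "n \<ge> n1" for n
  proof -
    have "?mean n = 2 * t n powr (- \<kappa>) * (c * ln (real n) ^ ?m)"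
    proof -
      have "x powr (real N - \<kappa>) = x powr (- \<kappa>) * x ^ N" if "x > 0" for x N
        using that powr_add[of x "real N" "- \<kappa>"] by (simp add: powr_realpow)
      then show ?thesis
        using lnpos[OF n] by (simp only: t_def powr_mult powr_minus_divide) simp
    qed
    also have "\<dots> \<le> 2 * t n powr (- \<kappa>) * (\<Sum>q\<in>Q n. weight q)"
      using low[of n] n1[OF n] unfolding Q_def by (intro mult_left_mono) auto
    also have "\<dots> = (\<Sum>q\<in>Q n. T.prob (E n q))"
      using PE[OF _ n] by (simp add: r_def sum_distrib_left mult.assoc)
    finally show ?thesis .
  qed
  \<comment> \<open>A hit at some \<open>n \<ge> n1\<close>, where \<open>t n \<ge> t0\<close> is
    guaranteed. The complement has probability at most \<open>1 / ?mean n\<close> for every such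
    \<open>n\<close>, hence zero.\<close>
  define H where "H = (\<Union>n\<in>{n1..}. \<Union>q\<in>Q n. E n q)"
  have E_sets: "E n q \<in> sets torus_measure" for n q by (simp add: E_def)
  have H_sets: "H \<in> sets torus_measure"
    unfolding H_def using finQ E_sets by (intro sets.countable_UN' sets.finite_UN) auto
  have le: "T.prob (UNIV - H) \<le> 1 / ?mean n" if n: "n \<ge> n1" for n
  proof -
    have mp: "0 < ?mean n" using c lnpos[OF n] by simp
    have "T.prob (UNIV - H) \<le> T.prob (space torus_measure - (\<Union>q\<in>Q n. E n q))"
      using n finQ E_sets sets.top[of "torus_measure :: ('n \<Rightarrow> real) measure"]
      by (intro T.finite_measure_mono sets.Diff sets.finite_UN) (auto simp: H_def)
    also have "\<dots> \<le> 1 / (\<Sum>q\<in>Q n. T.prob (E n q))"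
      using finQ E_sets indep n mean[OF n] mp by (intro T.prob_no_event_le) auto
    also have "\<dots> \<le> 1 / ?mean n"
      using divide_left_mono[OF mean[OF n] zero_le_one mult_pos_pos[OF less_le_trans[OF mp mean[OF n]] mp]] .
    finally show ?thesis .
  qed
  have "filterlim ?mean at_top sequentially"
    using c \<kappa> by (intro filterlim_tendsto_pos_mult_at_top[OF tendsto_const]
      filterlim_compose[OF real_powr_at_top] filterlim_compose[OF ln_at_top filterlim_real_sequentially]) auto
  then have "((\<lambda>n. 1 / ?mean n) \<longlongrightarrow> 0) sequentially"
    by (intro real_tendsto_divide_at_top[OF tendsto_const])
  then have "T.prob (UNIV - H) \<le> 0"
    by (rule tendsto_lowerbound) (use le in \<open>auto simp: eventually_sequentially\<close>)
  then have "T.prob (UNIV - H) = 0" using measure_nonneg[of torus_measure "UNIV - H"] by linarith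
  then have "UNIV - H \<in> null_sets torus_measure"
    using H_sets sets.compl_sets[OF H_sets] by (intro null_setsI) (auto simp: T.emeasure_eq_measure)
  then have "AE \<gamma> in torus_measure. \<gamma> \<notin> UNIV - H" by (rule AE_not_in)
  then show ?thesis
  proof eventually_elim
    case (elim \<gamma>)
    then obtain n q where n: "n \<ge> n1" and q: "q \<in> Q n" and hit: "\<gamma> \<in> E n q" by (auto simp: H_def)
    from hit obtain p :: int where p: "\<bar>of_int p + (\<tau> q + (\<Sum>i\<in>UNIV. \<gamma> i * of_int (q i)))\<bar> \<le> r n q"
      by (auto simp: E_def torus_hit_def near_int_def)
    have "t n \<ge> t0" using n1[OF n] by simp
    moreover have "q k = 0" using q by (simp add: Q_def box_points_def)
    moreover have "1 \<le> \<bar>form q j\<bar> \<and> \<bar>form q j\<bar> \<le> exp (t n)" if j: "j \<in> UNIV - {k}" for j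
    proof -
      have np: "real n \<ge> 1" "real n \<ge> \<rho>" using n1[OF n] \<rho> by auto
      have "exp (t n) = real n ^ 6"
        using np unfolding t_def by (metis exp_ln exp_of_nat_mult of_nat_numeral less_le_trans zero_less_one)
      also have "\<dots> = real n * real n ^ 5" by (simp add: eval_nat_numeral)
      also have "\<dots> \<ge> \<rho> * real n ^ 5" using np by (intro mult_right_mono) auto
      finally show ?thesis using formQ[OF q, of j] j by simp
    qed
    moreover have "\<bar>of_int p + (\<Sum>l\<in>UNIV. (\<gamma>0 l + \<gamma> l) * of_int (q l))\<bar> * (\<Prod>j\<in>UNIV - {k}. \<bar>form q j\<bar>) \<le> t n powr (- \<kappa>)"
    proof -
      have fp: "0 < form q j" if "j \<noteq> k" for j using formQ[OF q that] by linarith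
      have eq: "weight q * (\<Prod>j\<in>UNIV - {k}. \<bar>form q j\<bar>) = 1"
        unfolding weight_def prod.distrib[symmetric] using fp by (intro prod.neutral) force
      have "\<bar>of_int p + (\<Sum>l\<in>UNIV. (\<gamma>0 l + \<gamma> l) * of_int (q l))\<bar> * (\<Prod>j\<in>UNIV - {k}. \<bar>form q j\<bar>)
          \<le> r n q * (\<Prod>j\<in>UNIV - {k}. \<bar>form q j\<bar>)"
        using p by (intro mult_right_mono prod_nonneg) (auto simp: \<tau>_def distrib_right sum.distrib)
      also have "\<dots> = t n powr (- \<kappa>)" using eq by (simp add: r_def mult.assoc)
      finally show ?thesis .
    qed
    ultimately show ?case by blast
  qed
qed

end

section \<open>Continued fractions\<close>

definition gauss_map :: "real \<Rightarrow> real" where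
  "gauss_map x = frac (1 / x)"

definition digit :: "real \<Rightarrow> nat" where
  "digit x = nat \<lfloor>1 / x\<rfloor>"

text \<open>If \<open>q'\<close> and \<open>q\<close> are consecutive convergent denominators and
  \<open>\<theta> = q' / q\<close>, the weight is the conditional density, given the digits so far,
  of the remainder under iteration of \<open>gauss_map\<close>. The value
  \<open>\<theta> = 0\<close> is Lebesgue measure.\<close>

definition gauss_integral :: "real \<Rightarrow> (real \<Rightarrow> ennreal) \<Rightarrow> ennreal" where
  "gauss_integral \<theta> F = (\<integral>\<^sup>+x. F x * ennreal ((1 + \<theta>) / (1 + \<theta> * x)\<^sup>2) * indicator {0..1} x \<partial>lborel)"

text \<open>The mass that the density with parameter \<open>\<theta>\<close> gives to the interval
  from \<open>1 / (n + 1)\<close> to \<open>1 / n\<close>: the conditional probability that the next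
  digit is \<open>n\<close>.\<close>

definition digit_prob :: "real \<Rightarrow> nat \<Rightarrow> real" where
  "digit_prob \<theta> n = (1 + \<theta>) / ((real n + \<theta>) * (real n + 1 + \<theta>))"

lemma gauss_map_measurable [measurable]: "gauss_map \<in> borel_measurable borel"
  unfolding gauss_map_def frac_def by measurable

lemma digit_measurable [measurable]: "digit \<in> measurable borel (count_space UNIV)"
  unfolding digit_def by measurable

text \<open>The densities \<open>(1 + \<theta>) / (1 + \<theta> x)\<^sup>2\<close> on the unit interval are permuted, up to the factor
  \<open>digit_prob\<close>, by the inverse branches of the Gauss map.\<close>

lemma gauss_branch:
  assumes F [measurable]: "F \<in> borel_measurable borel" and n: "n \<ge> 1" and \<theta>: "0 \<le> \<theta>" "\<theta> \<le> 1"
  shows "(\<integral>\<^sup>+x. F (1 / x - real n) * ennreal ((1 + \<theta>) / (1 + \<theta> * x)\<^sup>2) * indicator {1 / (real n + 1)..1 / real n} x \<partial>lborel)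
    = ennreal (digit_prob \<theta> n) * gauss_integral (1 / (real n + \<theta>)) F"
proof -
  \<comment> \<open>An increasing parametrisation of the branch, as the substitution rule requires;
    the reflection \<open>y = 1 - u\<close> afterwards turns \<open>u\<close> into the remainder
    \<open>1 / x - n\<close>.\<close>
  let ?g = "\<lambda>u. 1 / (real n + 1 - u)" and ?g' = "\<lambda>u. 1 / (real n + 1 - u)\<^sup>2"
  let ?\<theta> = "1 / (real n + \<theta>)"
  have n1: "real n \<ge> 1" using n by simp
  have "(\<integral>\<^sup>+x. F (1 / x - real n) * ennreal ((1 + \<theta>) / (1 + \<theta> * x)\<^sup>2) * indicator {?g 0..?g 1} x \<partial>lborel)
     = (\<integral>\<^sup>+u. F (1 / ?g u - real n) * ennreal ((1 + \<theta>) / (1 + \<theta> * ?g u)\<^sup>2) * ?g' u * indicator {0..1} u \<partial>lborel)"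
  proof (rule nn_integral_substitution_aux)
    fix u :: real assume "u \<in> {0..1}"
    then have "real n + 1 - u \<noteq> 0" using n1 by auto
    then show "(?g has_real_derivative ?g' u) (at u)"
      by (auto intro!: derivative_eq_intros simp: power2_eq_square)
  next
    show "continuous_on {0..1} ?g'" using n1 by (auto intro!: continuous_intros)
  qed (auto, measurable)
  also have "\<dots> = (\<integral>\<^sup>+u. (\<lambda>y. ennreal (digit_prob \<theta> n) * (F y * ennreal ((1 + ?\<theta>) / (1 + ?\<theta> * y)\<^sup>2) * indicator {0..1} y)) (1 + (-1) * u) \<partial>lborel)"
  proof (rule nn_integral_cong)
    fix u :: real
    show "F (1 / ?g u - real n) * ennreal ((1 + \<theta>) / (1 + \<theta> * ?g u)\<^sup>2) * ?g' u * indicator {0..1} u =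
      (\<lambda>y. ennreal (digit_prob \<theta> n) * (F y * ennreal ((1 + ?\<theta>) / (1 + ?\<theta> * y)\<^sup>2) * indicator {0..1} y)) (1 + (-1) * u)"
    proof (cases "u \<in> {0..1}")
      case True
      define z where "z = real n + 1 - u"
      have z: "z \<ge> 1" using True n1 by (auto simp: z_def)
      have "(1 + \<theta>) / (1 + \<theta> * (1 / z))\<^sup>2 * (1 / z\<^sup>2) = (1 + \<theta>) / (z + \<theta>)\<^sup>2"
      proof -
        have "(1 + \<theta> * (1 / z)) * z = z + \<theta>" using z by (simp add: field_simps)
        then have "(1 + \<theta> * (1 / z))\<^sup>2 * z\<^sup>2 = (z + \<theta>)\<^sup>2"
          by (simp only: power_mult_distrib[symmetric])
        then show ?thesis by simp
      qed
      also have "\<dots> = digit_prob \<theta> n * ((1 + ?\<theta>) / (1 + ?\<theta> * (1 - u))\<^sup>2)"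
      proof -
        have p: "real n + \<theta> > 0" using n1 \<theta> by simp
        have 1: "1 + ?\<theta> * (1 - u) = (z + \<theta>) / (real n + \<theta>)" using p by (simp add: z_def field_simps)
        have 2: "1 + ?\<theta> = (real n + 1 + \<theta>) / (real n + \<theta>)" using p by (simp add: field_simps)
        have 3: "real n + 1 + \<theta> > 0" "z + \<theta> > 0" using n1 \<theta> z by auto
        have "(1 + \<theta>) / Z\<^sup>2 = (1 + \<theta>) / (P * R) * (R / P / (Z / P)\<^sup>2)"
          if "P > 0" "R > 0" "Z > 0" for P R Z :: real
          using that by (simp add: power2_eq_square)
        from this[OF p 3] show ?thesis unfolding 1 2 digit_prob_def .
      qed
      finally have "ennreal ((1 + \<theta>) / (1 + \<theta> * (1 / z))\<^sup>2) * ennreal (1 / z\<^sup>2) = ennreal (digit_prob \<theta> n) * ennreal ((1 + ?\<theta>) / (1 + ?\<theta> * (1 - u))\<^sup>2)"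
        using \<theta> n1 by (simp add: ennreal_mult[symmetric] digit_prob_def)
      then show ?thesis using True
        by (simp add: z_def[symmetric] mult_ac) (simp add: z_def algebra_simps)
    qed (auto simp: indicator_def)
  qed
  also have "\<dots> = (\<integral>\<^sup>+y. ennreal (digit_prob \<theta> n) * (F y * ennreal ((1 + ?\<theta>) / (1 + ?\<theta> * y)\<^sup>2) * indicator {0..1} y) \<partial>lborel)"
    by (subst (2) nn_integral_real_affine[where t = 1 and c = "-1"]) auto
  also have "\<dots> = ennreal (digit_prob \<theta> n) * gauss_integral ?\<theta> F"
    unfolding gauss_integral_def by (rule nn_integral_cmult) measurable
  finally show ?thesis by simp
qed

text \<open>Conditioning on the first digit: each branch gives its \<open>digit_prob\<close> times
  an integral of the same family, with parameter \<open>1 / (n + \<theta>)\<close> again in the unit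
  interval. The closed branches share endpoints, where the sum only bounds the integrand from
  above.\<close>

lemma gauss_step:
  assumes F [measurable]: "F \<in> borel_measurable borel" and \<theta>: "0 \<le> \<theta>" "\<theta> \<le> 1"
    and M: "\<And>n. n \<ge> 1 \<Longrightarrow> gauss_integral (1 / (real n + \<theta>)) F \<le> M"
  shows "gauss_integral \<theta> (\<lambda>x. indicator H (digit x) * F (gauss_map x)) \<le>
    (\<Sum>a. indicator H (Suc a) * ennreal (digit_prob \<theta> (Suc a))) * M"
proof -
  let ?T = "\<lambda>a x. indicator H (Suc a) * (F (1 / x - real (Suc a)) * ennreal ((1 + \<theta>) / (1 + \<theta> * x)\<^sup>2) *
      indicator {1 / (real (Suc a) + 1)..1 / real (Suc a)} x)"
  have "AE x in lborel. x \<noteq> (0::real)" by (rule AE_lborel_singleton)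
  then have "gauss_integral \<theta> (\<lambda>x. indicator H (digit x) * F (gauss_map x)) \<le> (\<integral>\<^sup>+x. (\<Sum>a. ?T a x) \<partial>lborel)"
    unfolding gauss_integral_def
  proof (intro nn_integral_mono_AE, eventually_elim)
    fix x :: real assume x0: "x \<noteq> 0"
    show "indicator H (digit x) * F (gauss_map x) * ennreal ((1 + \<theta>) / (1 + \<theta> * x)\<^sup>2) * indicator {0..1} x \<le> (\<Sum>a. ?T a x)"
    proof (cases "x \<in> {0..1}")
      case True
      then have x: "0 < x" "x \<le> 1" using x0 by auto
      then have "1 / x \<ge> 1" by simp
      then have fl: "\<lfloor>1 / x\<rfloor> \<ge> 1" by simp
      then have "digit x \<noteq> 0" by (simp add: digit_def)
      then obtain a where a: "digit x = Suc a" using not0_implies_Suc by blast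
      have f: "real (Suc a) \<le> 1 / x" "1 / x < real (Suc a) + 1"
        using fl a unfolding digit_def by linarith+
      have "gauss_map x = 1 / x - real (Suc a)"
        using fl a by (simp add: gauss_map_def frac_def digit_def)
      moreover have "x \<in> {1 / (real (Suc a) + 1)..1 / real (Suc a)}"
        using f x by (auto simp: field_simps)
      ultimately have "indicator H (digit x) * F (gauss_map x) * ennreal ((1 + \<theta>) / (1 + \<theta> * x)\<^sup>2) * indicator {0..1} x = ?T a x"
        using True by (simp add: a mult_ac)
      also have "\<dots> \<le> (\<Sum>a. ?T a x)"
        using sum_le_suminf[of "\<lambda>a. ?T a x" "{a}"]
        by (simp only: sum.insert sum.empty finite.intros empty_iff summableI not_False_eq_True add_0_right zero_le simp_thms)
      finally show ?thesis .
    qed simp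
  qed
  also have "\<dots> = (\<Sum>a. \<integral>\<^sup>+x. ?T a x \<partial>lborel)"
    by (rule nn_integral_suminf) measurable
  also have "\<dots> = (\<Sum>a. indicator H (Suc a) * (ennreal (digit_prob \<theta> (Suc a)) * gauss_integral (1 / (real (Suc a) + \<theta>)) F))"
  proof (intro suminf_cong)
    fix a
    have "(\<integral>\<^sup>+x. ?T a x \<partial>lborel) = indicator H (Suc a) * (\<integral>\<^sup>+x. F (1 / x - real (Suc a)) * ennreal ((1 + \<theta>) / (1 + \<theta> * x)\<^sup>2) *
      indicator {1 / (real (Suc a) + 1)..1 / real (Suc a)} x \<partial>lborel)"
      by (rule nn_integral_cmult) measurable
    also have "(\<integral>\<^sup>+x. F (1 / x - real (Suc a)) * ennreal ((1 + \<theta>) / (1 + \<theta> * x)\<^sup>2) *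
      indicator {1 / (real (Suc a) + 1)..1 / real (Suc a)} x \<partial>lborel) = ennreal (digit_prob \<theta> (Suc a)) * gauss_integral (1 / (real (Suc a) + \<theta>)) F"
      by (rule gauss_branch[OF F _ \<theta>]) simp
    finally show "(\<integral>\<^sup>+x. ?T a x \<partial>lborel) = indicator H (Suc a) * (ennreal (digit_prob \<theta> (Suc a)) * gauss_integral (1 / (real (Suc a) + \<theta>)) F)" .
  qed
  also have "\<dots> \<le> (\<Sum>a. indicator H (Suc a) * (ennreal (digit_prob \<theta> (Suc a)) * M))"
    by (intro suminf_le mult_left_mono M) auto
  also have "\<dots> = (\<Sum>a. indicator H (Suc a) * ennreal (digit_prob \<theta> (Suc a))) * M"
    by (simp add: ennreal_suminf_multc mult.assoc[symmetric])
  finally show ?thesis .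
qed

definition digits_in :: "nat \<Rightarrow> (nat \<Rightarrow> nat set) \<Rightarrow> real set" where
  "digits_in N H = {x. \<forall>i<N. digit ((gauss_map ^^ i) x) \<in> H i}"

lemma gauss_map_iter_measurable [measurable]: "(gauss_map ^^ i) \<in> borel_measurable borel"
  by (induction i) (auto simp: o_def)

lemma digits_in_measurable [measurable]: "digits_in N H \<in> sets borel"
  unfolding digits_in_def by measurable

text \<open>The past influences the next digit only through \<open>\<theta>\<close>, so bounds on
  conditional probabilities that are uniform in \<open>\<theta>\<close> multiply up. The induction
  strips the first digit, which changes \<open>\<theta>\<close> and shifts \<open>H\<close> and
  \<open>p\<close>.\<close>

lemma gauss_integral_digits_in_le:
  assumes "0 \<le> \<theta>" "\<theta> \<le> 1"
    and p: "\<And>i \<theta>. 0 \<le> \<theta> \<Longrightarrow> \<theta> \<le> 1 \<Longrightarrow> (\<Sum>a. indicator (H i) (Suc a) * ennreal (digit_prob \<theta> (Suc a))) \<le> ennreal (p i)"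
    and p0: "\<And>i. 0 \<le> p i"
  shows "gauss_integral \<theta> (indicator (digits_in N H)) \<le> ennreal (\<Prod>i<N. p i)"
  using assms
proof (induction N arbitrary: \<theta> H p)
  case 0
  have "gauss_integral \<theta> (indicator (digits_in 0 H)) = (\<integral>\<^sup>+x. ennreal ((1 + \<theta>) / (1 + \<theta> * x)\<^sup>2) * indicator {0..1} x \<partial>lborel)"
    unfolding gauss_integral_def by (simp add: digits_in_def)
  also have "\<dots> = ennreal ((1 + \<theta>) * 1 / (1 + \<theta> * 1) - (1 + \<theta>) * 0 / (1 + \<theta> * 0))"
  proof (rule nn_integral_FTC_Icc)
    fix x :: real assume "x \<in> {0..1}"
    then have "1 + \<theta> * x > 0" using 0 by (simp add: add_pos_nonneg)
    then show "((\<lambda>x. (1 + \<theta>) * x / (1 + \<theta> * x)) has_real_derivative (1 + \<theta>) / (1 + \<theta> * x)\<^sup>2) (at x)"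
      by (auto intro!: derivative_eq_intros simp: power2_eq_square field_simps)
    show "0 \<le> (1 + \<theta>) / (1 + \<theta> * x)\<^sup>2" using 0 by simp
  qed auto
  also have "\<dots> \<le> ennreal (\<Prod>i<0. p i)" using 0 by simp
  finally show ?case .
next
  case (Suc N)
  let ?H = "\<lambda>i. H (Suc i)"
  have "indicator (digits_in (Suc N) H) = (\<lambda>x. indicator (H 0) (digit x) * indicator (digits_in N ?H) (gauss_map x) :: ennreal)"
  proof
    fix x
    have "x \<in> digits_in (Suc N) H \<longleftrightarrow> digit x \<in> H 0 \<and> gauss_map x \<in> digits_in N ?H"
      unfolding digits_in_def mem_Collect_eq All_less_Suc2 by (simp add: funpow_swap1)
    then show "indicator (digits_in (Suc N) H) x = (indicator (H 0) (digit x) * indicator (digits_in N ?H) (gauss_map x) :: ennreal)"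
      by (simp add: indicator_def)
  qed
  then have "gauss_integral \<theta> (indicator (digits_in (Suc N) H)) = gauss_integral \<theta> (\<lambda>x. indicator (H 0) (digit x) * indicator (digits_in N ?H) (gauss_map x))"
    by simp
  also have "\<dots> \<le> (\<Sum>a. indicator (H 0) (Suc a) * ennreal (digit_prob \<theta> (Suc a))) * ennreal (\<Prod>i<N. p (Suc i))"
  proof (rule gauss_step)
    fix n :: nat assume "n \<ge> 1"
    then have "real n + \<theta> \<ge> 1" using Suc.prems by simp
    then show "gauss_integral (1 / (real n + \<theta>)) (indicator (digits_in N ?H)) \<le> ennreal (\<Prod>i<N. p (Suc i))"
      by (intro Suc.IH Suc.prems) auto
  qed (use Suc.prems in auto)
  also have "\<dots> \<le> ennreal (p 0) * ennreal (\<Prod>i<N. p (Suc i))"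
    by (intro mult_right_mono Suc.prems) auto
  also have "\<dots> = ennreal (\<Prod>i<Suc N. p i)"
    using Suc.prems by (subst prod.lessThan_Suc_shift) (simp add: ennreal_mult prod_nonneg)
  finally show ?case .
qed

section \<open>Sizes of the digits\<close>

lemma digit_prob_sums:
  assumes "0 \<le> \<theta>" "c \<ge> 1"
  shows "(\<lambda>a. digit_prob \<theta> (a + c)) sums ((1 + \<theta>) / (real c + \<theta>))"
proof -
  let ?f = "\<lambda>a. (1 + \<theta>) / (real (a + c) + \<theta>)"
  have "digit_prob \<theta> (a + c) = ?f a - ?f (Suc a)" for a
  proof -
    have "real (a + c) + \<theta> > 0" using assms by simp
    then show ?thesis by (simp add: digit_prob_def divide_simps) (simp add: algebra_simps)
  qed
  moreover have "(\<lambda>a. ?f a - ?f (Suc a)) sums (?f 0 - 0)"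
    by (rule telescope_sums') real_asymp
  ultimately show ?thesis by simp
qed

lemma digit_prob_nonneg: "0 \<le> \<theta> \<Longrightarrow> 0 \<le> digit_prob \<theta> n"
  by (simp add: digit_prob_def)

lemma suminf_digit_prob_UNIV:
  assumes "0 \<le> \<theta>"
  shows "(\<Sum>a. indicator UNIV (Suc a) * ennreal (digit_prob \<theta> (Suc a))) \<le> ennreal 1"
proof -
  have "(\<lambda>a. digit_prob \<theta> (a + 1)) sums 1" using digit_prob_sums[OF assms, of 1] assms by simp
  then have "(\<Sum>a. ennreal (digit_prob \<theta> (Suc a))) = ennreal 1"
    by (intro suminf_ennreal_eq digit_prob_nonneg assms) simp
  then show ?thesis by simp
qed

lemma suminf_digit_prob_atLeast:
  assumes \<theta>: "0 \<le> \<theta>" "\<theta> \<le> 1" and c: "c \<ge> 1"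
  shows "(\<Sum>a. indicator {c..} (Suc a) * ennreal (digit_prob \<theta> (Suc a))) \<le> ennreal (2 / real c)"
proof -
  let ?f = "\<lambda>a. indicator {c..} (Suc a) * ennreal (digit_prob \<theta> (Suc a))"
  have "(\<Sum>a. ?f a) = (\<Sum>a. ?f (a + (c - 1))) + (\<Sum>a<c - 1. ?f a)"
    by (rule suminf_offset) simp
  also have "(\<Sum>a<c - 1. ?f a) = 0" by (intro sum.neutral) auto
  also have "(\<Sum>a. ?f (a + (c - 1))) = (\<Sum>a. ennreal (digit_prob \<theta> (a + c)))"
    using c by (intro suminf_cong) (auto simp: indicator_def)
  also have "\<dots> = ennreal ((1 + \<theta>) / (real c + \<theta>))"
    by (intro suminf_ennreal_eq digit_prob_nonneg digit_prob_sums \<theta> c)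
  also have "(1 + \<theta>) / (real c + \<theta>) \<le> 2 / real c"
    using \<theta> c by (intro frac_le) auto
  finally show ?thesis by (simp add: ennreal_leI)
qed

lemma suminf_digit_prob_lessThan:
  assumes \<theta>: "0 \<le> \<theta>" "\<theta> \<le> 1" and c: "c \<ge> 1"
  shows "(\<Sum>a. indicator {..<c} (Suc a) * ennreal (digit_prob \<theta> (Suc a))) \<le> ennreal (1 - 1 / real c)"
proof -
  let ?f = "\<lambda>a. (1 + \<theta>) / (real a + 1 + \<theta>)"
  have "(\<Sum>a. indicator {..<c} (Suc a) * ennreal (digit_prob \<theta> (Suc a))) =
      (\<Sum>a<c - 1. indicator {..<c} (Suc a) * ennreal (digit_prob \<theta> (Suc a)))"
    by (rule suminf_finite) auto
  also have "\<dots> = (\<Sum>a<c - 1. ennreal (digit_prob \<theta> (Suc a)))"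
    by (intro sum.cong) (auto simp: indicator_def)
  also have "\<dots> = ennreal (\<Sum>a<c - 1. digit_prob \<theta> (Suc a))"
    by (simp add: sum_ennreal digit_prob_nonneg \<theta>)
  also have "(\<Sum>a<c - 1. digit_prob \<theta> (Suc a)) = (\<Sum>a<c - 1. ?f a - ?f (Suc a))"
  proof (intro sum.cong refl)
    fix a :: nat
    have "real a + 1 + \<theta> > 0" using \<theta> by simp
    then show "digit_prob \<theta> (Suc a) = ?f a - ?f (Suc a)"
      by (simp add: digit_prob_def divide_simps) (simp add: algebra_simps)
  qed
  also have "\<dots> = ?f 0 - ?f (c - 1)" by (rule sum_lessThan_telescope')
  also have "\<dots> = 1 - (1 + \<theta>) / (real c + \<theta>)" using \<theta> c by (simp add: of_nat_diff)
  also have "\<dots> \<le> 1 - 1 / real c"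
  proof -
    have "1 / real c \<le> (1 + \<theta>) / (real c + \<theta>)"
      using \<theta> c mult_right_mono[of 1 "real c" \<theta>] by (simp add: divide_simps) (simp add: algebra_simps)
    then show ?thesis by simp
  qed
  finally show ?thesis by (simp add: ennreal_leI)
qed

lemma prob_digits_in_le:
  assumes p: "\<And>i \<theta>. 0 \<le> \<theta> \<Longrightarrow> \<theta> \<le> 1 \<Longrightarrow> (\<Sum>a. indicator (H i) (Suc a) * ennreal (digit_prob \<theta> (Suc a))) \<le> ennreal (p i)"
    and p0: "\<And>i. 0 \<le> p i"
  shows "measure unit_measure (digits_in N H) \<le> (\<Prod>i<N. p i)"
proof -
  interpret U: prob_space unit_measure by (rule prob_space_unit)
  have "emeasure unit_measure (digits_in N H) = (\<integral>\<^sup>+x. indicator ({0..<1} \<inter> digits_in N H) x \<partial>lborel)"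
    by (subst emeasure_unit) auto
  also have "\<dots> \<le> gauss_integral 0 (indicator (digits_in N H))"
    unfolding gauss_integral_def by (intro nn_integral_mono) (auto simp: indicator_def)
  also have "\<dots> \<le> ennreal (\<Prod>i<N. p i)"
    by (intro gauss_integral_digits_in_le p p0) auto
  finally show ?thesis
    by (simp add: U.emeasure_eq_measure ennreal_le_iff prod_nonneg p0)
qed

text \<open>The divergence half of the Borel-Bernstein theorem: whatever the past, digit
  \<open>i\<close> is below \<open>i + 2\<close> with probability at most
  \<open>1 - 1 / (i + 2)\<close>, and the product of these bounds telescopes to a quotient tending
  to zero.\<close>

lemma AE_digit_large:
  "AE x in unit_measure. \<forall>n0. \<exists>n\<ge>n0. n + 2 \<le> digit ((gauss_map ^^ n) x)"
proof -
  interpret U: prob_space unit_measure by (rule prob_space_unit)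
  have "AE x in unit_measure. \<exists>n\<ge>n0. n + 2 \<le> digit ((gauss_map ^^ n) x)" for n0
  proof -
    define B where "B = {x. \<forall>n\<ge>n0. digit ((gauss_map ^^ n) x) < n + 2}"
    have B [measurable]: "B \<in> sets borel" unfolding B_def by measurable
    define H where "H i = (if i < n0 then UNIV else {..<i + 2})" for i :: nat
    define p where "p i = (if i < n0 then 1 else 1 - 1 / real (i + 2))" for i :: nat
    have pn: "(\<Sum>a. indicator {..<i + 2} (Suc a) * ennreal (digit_prob \<theta> (Suc a))) \<le> ennreal (1 - 1 / real (i + 2))"
      if "0 \<le> \<theta>" "\<theta> \<le> 1" for \<theta> i
      using that by (intro suminf_digit_prob_lessThan) auto
    have le: "U.prob B \<le> real (n0 + 1) / real (n0 + d + 1)" for d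
    proof -
      have "U.prob B \<le> U.prob (digits_in (n0 + d) H)"
        by (intro U.finite_measure_mono) (auto simp: B_def digits_in_def H_def)
      also have "\<dots> \<le> (\<Prod>i<n0 + d. p i)"
      proof (rule prob_digits_in_le)
        show "(\<Sum>a. indicator (H i) (Suc a) * ennreal (digit_prob \<theta> (Suc a))) \<le> ennreal (p i)"
          if "0 \<le> \<theta>" "\<theta> \<le> 1" for i \<theta>
          using suminf_digit_prob_UNIV[OF that(1)] pn[OF that, of i] unfolding H_def p_def by presburger
        show "0 \<le> p i" for i by (simp add: p_def)
      qed
      also have "\<dots> = real (n0 + 1) / real (n0 + d + 1)"
      proof (induction d)
        case 0
        then show ?case by (simp add: p_def)
      next
        case (Suc d)
        have "p (n0 + d) = real (n0 + d + 1) / real (n0 + d + 2)"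
          by (simp add: p_def divide_simps)
        then show ?case using Suc by simp
      qed
      finally show ?thesis .
    qed
    have "(\<lambda>d. real (n0 + 1) / real (n0 + d + 1)) \<longlonglongrightarrow> 0" by real_asymp
    then have "U.prob B \<le> 0" by (rule tendsto_lowerbound) (use le in auto)
    then have "U.prob B = 0" using measure_nonneg[of unit_measure B] by linarith
    then have "B \<in> null_sets unit_measure" by (intro null_setsI) (auto simp: U.emeasure_eq_measure)
    then have "AE x in unit_measure. x \<notin> B" by (rule AE_not_in)
    then show ?thesis by eventually_elim (auto simp: B_def not_less)
  qed
  then show ?thesis by (simp add: AE_all_countable)
qed

text \<open>The convergence half: digit \<open>n\<close> reaches \<open>(n + 2)^2\<close> with
  probability at most \<open>2 / (n + 2)^2\<close>, which is summable, and Borel-Cantelli applies.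
  This will control the growth of denominators.\<close>

lemma AE_digit_small:
  "AE x in unit_measure. \<exists>n0. \<forall>n\<ge>n0. digit ((gauss_map ^^ n) x) < (n + 2)\<^sup>2"
proof -
  interpret U: prob_space unit_measure by (rule prob_space_unit)
  define A where "A n = {x. (n + 2)\<^sup>2 \<le> digit ((gauss_map ^^ n) x)}" for n
  have A [measurable]: "A n \<in> sets unit_measure" for n unfolding A_def by measurable
  have le: "U.prob (A n) \<le> 2 / (real n + 2)\<^sup>2" for n
  proof -
    define H where "H i = (if i = n then {(n + 2)\<^sup>2..} else UNIV)" for i :: nat
    define p where "p i = (if i = n then 2 / (real n + 2)\<^sup>2 else 1)" for i :: nat
    have pn: "(\<Sum>a. indicator {(n + 2)\<^sup>2..} (Suc a) * ennreal (digit_prob \<theta> (Suc a))) \<le> ennreal (2 / (real n + 2)\<^sup>2)"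
      if "0 \<le> \<theta>" "\<theta> \<le> 1" for \<theta>
      using suminf_digit_prob_atLeast[OF that, of "(n + 2)\<^sup>2"] by (simp add: add.commute)
    have "U.prob (A n) \<le> U.prob (digits_in (Suc n) H)"
      by (intro U.finite_measure_mono) (auto simp: A_def digits_in_def H_def)
    also have "\<dots> \<le> (\<Prod>i<Suc n. p i)"
      using suminf_digit_prob_UNIV pn
      by (intro prob_digits_in_le) (auto simp: H_def p_def)
    also have "\<dots> = 2 / (real n + 2)\<^sup>2" by (simp add: p_def)
    finally show ?thesis .
  qed
  have "summable (\<lambda>n. 2 / (real n + 2)\<^sup>2)"
  proof -
    have "summable (\<lambda>n. inverse (real (n + 2) ^ 2))"
      by (subst summable_iff_shift) (rule inverse_power_summable, simp)
    then have "summable (\<lambda>n. 2 * inverse (real (n + 2) ^ 2))" by (rule summable_mult)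
    then show ?thesis by (simp add: divide_inverse add.commute)
  qed
  then have "summable (\<lambda>n. U.prob (A n))"
    by (rule summable_comparison_test[rotated]) (use le in auto)
  then have "AE x in unit_measure. \<forall>\<^sub>F n in sequentially. x \<in> space unit_measure - A n"
    by (intro borel_cantelli_AE1 A) (auto simp: U.emeasure_eq_measure)
  then show ?thesis
    by eventually_elim (auto simp: eventually_sequentially A_def not_le)
qed

section \<open>Approximation by convergents\<close>

lemma gauss_map_irrational:
  assumes "x \<notin> \<rat>"
  shows "gauss_map x \<notin> \<rat>" "0 < gauss_map x" "gauss_map x < 1"
proof -
  show r: "gauss_map x \<notin> \<rat>"
  proof
    assume "gauss_map x \<in> \<rat>"
    then have "gauss_map x + of_int \<lfloor>1 / x\<rfloor> \<in> \<rat>" by simp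
    then have "1 / x \<in> \<rat>" by (simp add: gauss_map_def frac_def)
    then have "inverse (1 / x) \<in> \<rat>" by (rule Rats_inverse)
    then show False using assms by simp
  qed
  show "0 < gauss_map x" using r frac_ge_0[of "1 / x"] by (metis Rats_0 gauss_map_def order_le_less)
  show "gauss_map x < 1" by (simp add: gauss_map_def frac_lt_1)
qed

lemma gauss_iter_irrational:
  assumes "x \<notin> \<rat>" "0 < x" "x < 1"
  shows "(gauss_map ^^ n) x \<notin> \<rat> \<and> 0 < (gauss_map ^^ n) x \<and> (gauss_map ^^ n) x < 1"
  using assms by (induction n) (auto simp: gauss_map_irrational)

text \<open>Consecutive convergents, the primed one being the older, starting from
  \<open>0 / 1\<close> and the formal \<open>1 / 0\<close>; the last equation recovers
  \<open>x\<close> from the remainder after \<open>n\<close> steps. The new denominator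
  \<open>q * a + q'\<close> is at most \<open>q * (a + 1)\<close>, which gives the product
  bound.\<close>

lemma convergents:
  assumes x: "x \<notin> \<rat>" "0 < x" "x < 1"
  shows "\<exists>p q p' q'::int. 1 \<le> q \<and> 0 \<le> q' \<and> q' \<le> q \<and> q \<le> (\<Prod>i<n. int (digit ((gauss_map ^^ i) x)) + 1) \<and>
    \<bar>p * q' - p' * q\<bar> = 1 \<and> x * (q + q' * (gauss_map ^^ n) x) = p + p' * (gauss_map ^^ n) x"
proof (induction n)
  case 0
  show ?case by (rule exI[of _ 0], rule exI[of _ 1], rule exI[of _ 1], rule exI[of _ 0]) simp
next
  case (Suc n)
  let ?y = "(gauss_map ^^ n) x"
  let ?z = "gauss_map ?y"
  define a where "a = int (digit ?y)"
  obtain p q p' q' :: int where h: "1 \<le> q" "0 \<le> q'" "q' \<le> q" "q \<le> (\<Prod>i<n. int (digit ((gauss_map ^^ i) x)) + 1)"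
    "\<bar>p * q' - p' * q\<bar> = 1" "x * (q + q' * ?y) = p + p' * ?y"
    using Suc.IH by blast
  have y: "0 < ?y" "?y < 1" using gauss_iter_irrational[OF x] by auto
  have "1 \<le> 1 / ?y" using y by (simp only: le_divide_eq_1_pos less_imp_le)
  then have fl: "1 \<le> \<lfloor>1 / ?y\<rfloor>" by (simp only: one_le_floor)
  then have aeq: "a = \<lfloor>1 / ?y\<rfloor>" unfolding a_def digit_def by linarith
  with fl have a1: "a \<ge> 1" by simp
  have yz: "?y * (a + ?z) = 1"
    using y by (simp add: aeq gauss_map_def frac_def)
  have expand: "(of_int b + of_int c * ?y) * (a + ?z) = of_int b * (a + ?z) + of_int c" for b c :: int
  proof -
    have "(of_int b + of_int c * ?y) * (a + ?z) = of_int b * (a + ?z) + of_int c * (?y * (a + ?z))"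
      by (simp only: distrib_right mult.assoc)
    then show ?thesis by (simp only: yz mult_1_right)
  qed
  have "x * (of_int q * (a + ?z) + q') = x * (q + q' * ?y) * (a + ?z)"
    by (simp only: expand mult.assoc)
  also have "\<dots> = (p + p' * ?y) * (a + ?z)" by (simp only: h(6))
  also have "\<dots> = p * (a + ?z) + p'" by (rule expand)
  finally have "x * (of_int (q * a + q') + of_int q * ?z) = of_int (p * a + p') + of_int p * ?z"
    by (simp add: algebra_simps)
  moreover have "1 \<le> q * a + q'" "q \<le> q * a + q'"
  proof -
    have "q * 1 \<le> q * a" using a1 h(1) by (intro mult_left_mono) auto
    then show "1 \<le> q * a + q'" "q \<le> q * a + q'" using h(1,2) by linarith+
  qed
  moreover have "q * a + q' \<le> (\<Prod>i<Suc n. int (digit ((gauss_map ^^ i) x)) + 1)"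
  proof -
    have "q * a + q' \<le> q * (a + 1)" using h by (simp add: algebra_simps)
    also have "\<dots> \<le> (\<Prod>i<n. int (digit ((gauss_map ^^ i) x)) + 1) * (a + 1)"
      using h a1 by (intro mult_right_mono) auto
    finally show ?thesis by (simp add: a_def)
  qed
  moreover have "\<bar>(p * a + p') * q - p * (q * a + q')\<bar> = 1"
    using h(5) by (simp add: algebra_simps abs_minus_commute)
  ultimately show ?case using h(1)
    by (intro exI[of _ "p * a + p'"] exI[of _ "q * a + q'"] exI[of _ p] exI[of _ q]) simp
qed

text \<open>Multiplying the error \<open>x * q - p\<close> by \<open>q + q' * y\<close>, with
  \<open>y\<close> the remainder, gives \<open>y\<close> times a determinant of absolute value one.
  The witness \<open>p\<close> here is the negative of the numerator.\<close>

lemma convergent_approx: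
  assumes x: "x \<notin> \<rat>" "0 < x" "x < 1"
  shows "\<exists>p q::int. 1 \<le> q \<and> q \<le> (\<Prod>i<n. int (digit ((gauss_map ^^ i) x)) + 1) \<and>
    of_int q * \<bar>of_int p + x * of_int q\<bar> \<le> (gauss_map ^^ n) x"
proof -
  let ?y = "(gauss_map ^^ n) x"
  obtain p q p' q' :: int where h: "1 \<le> q" "0 \<le> q'" "q' \<le> q" "q \<le> (\<Prod>i<n. int (digit ((gauss_map ^^ i) x)) + 1)"
    "\<bar>p * q' - p' * q\<bar> = 1" "x * (q + q' * ?y) = p + p' * ?y"
    using convergents[OF x] by blast
  have y: "0 < ?y" using gauss_iter_irrational[OF x] by auto
  have "(x * q - p) * (q + q' * ?y) = ?y * (of_int (p' * q - p * q'))"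
  proof -
    have "(x * q - p) * (q + q' * ?y) = q * (x * (q + q' * ?y)) - p * (q + q' * ?y)" by (simp add: algebra_simps)
    also have "\<dots> = ?y * (of_int (p' * q - p * q'))" unfolding h(6) by (simp add: algebra_simps)
    finally show ?thesis .
  qed
  then have "\<bar>x * q - p\<bar> * \<bar>q + q' * ?y\<bar> = \<bar>?y\<bar> * \<bar>of_int (p' * q - p * q')\<bar>"
    by (simp only: abs_mult[symmetric])
  also have "\<bar>of_int (p' * q - p * q')\<bar> = (1::real)"
    using h(5) by (metis abs_minus_commute of_int_1 of_int_abs)
  finally have "\<bar>x * q - p\<bar> * (q + q' * ?y) = ?y" using h y by simp
  moreover have "\<bar>x * q - p\<bar> * q \<le> \<bar>x * q - p\<bar> * (q + q' * ?y)"
    using h y by (intro mult_left_mono) auto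
  ultimately have "of_int q * \<bar>of_int (- p) + x * of_int q\<bar> \<le> ?y" by (simp add: mult.commute)
  then show ?thesis using h by blast
qed

text \<open>At an \<open>n\<close> with a large digit the remainder is at most \<open>1 / n\<close>,
  and since digits are eventually below a square, \<open>ln q\<close> is at most of order
  \<open>n * ln n\<close>. Replacing that order by a power \<open>n powr \<beta>\<close> costs less
  than the gap between \<open>\<kappa>\<close> and 1.\<close>

lemma AE_small_value_one_form:
  assumes \<kappa>: "0 < \<kappa>" "\<kappa> < 1" and w: "w > 0"
  shows "AE x in unit_measure. \<exists>t\<ge>t0. \<exists>p q::int. 1 \<le> q \<and> w * of_int q \<le> exp t \<and>
    \<bar>of_int p + x * of_int q\<bar> * (w * of_int q) \<le> t powr (- \<kappa>)"
proof -
  have "AE x in lborel. x \<notin> (\<rat> :: real set)"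
    using countable_rat by (intro AE_not_in countable_imp_null_set_lborel)
  then have "AE x in unit_measure. x \<notin> \<rat> \<and> 0 < x \<and> x < 1"
  proof -
    have "AE x in unit_measure. x \<in> {0..<1}"
      by (rule AE_uniform_measureI) auto
    moreover have "AE x in unit_measure. x \<notin> \<rat>"
      using \<open>AE x in lborel. x \<notin> \<rat>\<close> by (intro AE_uniform_measureI) auto
    ultimately show ?thesis
    proof eventually_elim
      case (elim x)
      then have "x \<noteq> 0" by auto
      then show ?case using elim by auto
    qed
  qed
  then show ?thesis
    using AE_digit_large AE_digit_small
  proof eventually_elim
    case (elim x)
    then have x: "x \<notin> \<rat>" "0 < x" "x < 1" by auto
    obtain n0 where n0: "\<And>n. n \<ge> n0 \<Longrightarrow> digit ((gauss_map ^^ n) x) < (n + 2)\<^sup>2" using elim by blast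
    define a where "a i = real (digit ((gauss_map ^^ i) x)) + 1" for i
    define K where "K = (\<Prod>i<n0. a i)"
    have a1: "a i \<ge> 1" for i by (simp add: a_def)
    have K1: "K \<ge> 1" unfolding K_def by (intro prod_ge_1 a1)
    have prod: "(\<Prod>i<n. a i) \<le> K * (real n + 1) ^ (2 * n)" if n: "n \<ge> n0" for n
    proof -
      have "(\<Prod>i<n. a i) = K * (\<Prod>i\<in>{n0..<n}. a i)"
        unfolding K_def using n by (subst prod.union_disjoint[symmetric]) (auto intro: prod.cong)
      also have "(\<Prod>i\<in>{n0..<n}. a i) \<le> (\<Prod>i\<in>{n0..<n}. (real n + 1) ^ 2)"
      proof (rule prod_mono)
        fix i assume i: "i \<in> {n0..<n}"
        then have "digit ((gauss_map ^^ i) x) + 1 \<le> (i + 2)\<^sup>2" using n0[of i] by simp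
        also have "\<dots> \<le> (n + 1)\<^sup>2" using i by (intro power_mono) auto
        finally have "real (digit ((gauss_map ^^ i) x) + 1) \<le> real ((n + 1)\<^sup>2)" by (rule of_nat_mono)
        then show "0 \<le> a i \<and> a i \<le> (real n + 1) ^ 2" by (simp add: a_def add.commute)
      qed
      also have "\<dots> = (real n + 1) ^ (2 * (n - n0))" by (simp add: power_mult)
      also have "\<dots> \<le> (real n + 1) ^ (2 * n)" by (intro power_increasing) auto
      finally show ?thesis using K1 by simp
    qed
    \<comment> \<open>What matters is \<open>\<beta> > 1\<close>, so that
      \<open>n powr \<beta>\<close> beats \<open>n * ln n\<close>, together with
      \<open>\<kappa> * \<beta> < 1\<close>, which leaves a positive power of \<open>n\<close> to
      absorb \<open>w\<close>. The reciprocal of the midpoint of \<open>\<kappa>\<close> and 1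
      satisfies both.\<close>
    define \<kappa>' where "\<kappa>' = (\<kappa> + 1) / 2"
    define \<beta> where "\<beta> = 1 / \<kappa>'"
    have \<kappa>': "\<kappa> < \<kappa>'" "\<kappa>' < 1" "0 < \<kappa>'" using \<kappa> by (auto simp: \<kappa>'_def)
    have \<beta>: "\<beta> > 1" "\<kappa> * \<beta> < 1" using \<kappa>' by (auto simp: \<beta>_def)
    have "\<forall>\<^sub>F n in sequentially. t0 \<le> real n powr \<beta>"
      using \<beta>(1) by real_asymp
    moreover have "\<forall>\<^sub>F n in sequentially. ln w + ln K + 2 * real n * ln (real n + 1) \<le> real n powr \<beta>"
      using \<beta>(1) by real_asymp
    moreover have "\<forall>\<^sub>F n in sequentially. w \<le> real n powr (1 - \<kappa> * \<beta>)"
      using \<beta>(2) by real_asymp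
    ultimately have "\<forall>\<^sub>F n in sequentially. t0 \<le> real n powr \<beta> \<and>
        ln w + ln K + 2 * real n * ln (real n + 1) \<le> real n powr \<beta> \<and> w \<le> real n powr (1 - \<kappa> * \<beta>)"
      by eventually_elim auto
    then obtain n1 where n1: "\<And>n. n \<ge> n1 \<Longrightarrow> t0 \<le> real n powr \<beta> \<and>
        ln w + ln K + 2 * real n * ln (real n + 1) \<le> real n powr \<beta> \<and> w \<le> real n powr (1 - \<kappa> * \<beta>)"
      by (auto simp: eventually_sequentially)
    obtain n where n: "n \<ge> max (max n0 n1) 1" and dig: "n + 2 \<le> digit ((gauss_map ^^ n) x)"
      using elim by blast
    let ?y = "(gauss_map ^^ n) x" and ?t = "real n powr \<beta>"
    have npos: "real n > 0" using n by simp
    have y: "0 < ?y" using gauss_iter_irrational[OF x] by blast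
    obtain p q :: int where pq: "1 \<le> q" "q \<le> (\<Prod>i<n. int (digit ((gauss_map ^^ i) x)) + 1)"
      "of_int q * \<bar>of_int p + x * of_int q\<bar> \<le> ?y"
      using convergent_approx[OF x] by blast
    have "?y \<le> 1 / real n"
    proof -
      have "real n \<le> 1 / ?y" using dig unfolding digit_def by linarith
      then show ?thesis using y npos by (simp add: field_simps)
    qed
    have "of_int q \<le> (\<Prod>i<n. a i)"
    proof -
      have "real_of_int q \<le> of_int (\<Prod>i<n. int (digit ((gauss_map ^^ i) x)) + 1)" using pq(2) by (simp only: of_int_le_iff)
      then show ?thesis by (simp add: a_def)
    qed
    also have "\<dots> \<le> K * (real n + 1) ^ (2 * n)" using prod n by simp
    finally have "w * of_int q \<le> w * (K * (real n + 1) ^ (2 * n))" using w by simp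
    also have "\<dots> = exp (ln w + ln K + 2 * real n * ln (real n + 1))"
    proof -
      have "exp (2 * real n * ln (real n + 1)) = (real n + 1) ^ (2 * n)"
        using exp_of_nat_mult[of "2 * n" "ln (real n + 1)"] by simp
      then show ?thesis using w K1 by (simp add: exp_add)
    qed
    also have "\<dots> \<le> exp ?t" using n1[of n] n by simp
    finally have "w * of_int q \<le> exp ?t" .
    moreover have "\<bar>of_int p + x * of_int q\<bar> * (w * of_int q) \<le> ?t powr (- \<kappa>)"
    proof -
      have "\<bar>of_int p + x * of_int q\<bar> * (w * of_int q) = w * (of_int q * \<bar>of_int p + x * of_int q\<bar>)" by simp
      also have "\<dots> \<le> w * (1 / real n)"
        using pq(3) \<open>?y \<le> 1 / real n\<close> w by (intro mult_left_mono) auto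
      also have "\<dots> \<le> real n powr (1 - \<kappa> * \<beta>) * (1 / real n)"
        using n1[of n] n by (intro mult_right_mono) auto
      also have "\<dots> = ?t powr (- \<kappa>)"
        using npos by (simp add: powr_powr powr_diff powr_minus_divide mult.commute)
      finally show ?thesis .
    qed
    moreover have "t0 \<le> ?t" using n1[of n] n by simp
    ultimately show ?case using pq(1) by blast
  qed
qed

section \<open>Small products in almost every lattice\<close>

text \<open>Rotations and coordinate projections preserve the measures, so statements for almost
  every point of the circle pull back. The shift \<open>c\<close> is there for the offset
  \<open>\<gamma>0\<close>.\<close>

lemma AE_torus_component:
  fixes l :: "'n::finite"
  assumes "AE x in unit_measure. P x"
  shows "AE \<gamma> in torus_measure. P (frac (\<gamma> l + c))"
proof -
  have "AE x in distr unit_measure unit_measure (\<lambda>x. frac (x + c)). P x"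
    unfolding distr_unit_frac_add by (rule assms)
  then have "AE x in unit_measure. P (frac (x + c))"
    by (rule AE_distrD[rotated]) (simp cong: measurable_cong_sets)
  then have "AE x in distr torus_measure unit_measure (\<lambda>\<gamma>. \<gamma> l). P (frac (x + c))"
    unfolding torus_measure_def by (subst distr_PiM_component) (auto intro: prob_space_unit)
  then show ?thesis
    by (rule AE_distrD[rotated]) (use measurable_torus_component[of l] in \<open>simp cong: measurable_cong_sets\<close>)
qed

context linear_forms
begin

text \<open>Joins the two cases. The lower bound \<open>\<eta>\<close> on the forms is 1 for several
  forms and \<open>w\<close> for a single one, whose values are integer multiples of
  \<open>w\<close>; it is chosen before \<open>t0\<close>.\<close>

lemma AE_small_value:
  fixes \<gamma>0 :: "'n \<Rightarrow> real"
  assumes n: "CARD('n) \<ge> 2" and \<kappa>: "0 < \<kappa>" "\<kappa> < real CARD('n) - 1"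
  obtains \<eta> where "\<eta> > 0" "\<And>t0. AE \<gamma> in torus_measure. \<exists>t\<ge>t0. \<exists>p::int. \<exists>q. q k = 0 \<and>
    (\<forall>j\<in>UNIV - {k}. \<eta> \<le> \<bar>form q j\<bar> \<and> \<bar>form q j\<bar> \<le> exp t) \<and>
    \<bar>of_int p + (\<Sum>l\<in>UNIV. (\<gamma>0 l + \<gamma> l) * of_int (q l))\<bar> * (\<Prod>j\<in>UNIV - {k}. \<bar>form q j\<bar>) \<le> t powr (- \<kappa>)"
proof (cases "card (UNIV - {k}) \<ge> 2")
  case True
  have "\<kappa> < real (card (UNIV - {k}))" using \<kappa> n by (simp add: of_nat_diff)
  then show ?thesis using that[of 1] AE_small_value_many_forms[OF True \<kappa>(1)] by force
next
  case False
  then have "card (UNIV - {k}) = 1" using n by simp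
  then obtain l where l: "UNIV - {k} = {l}" by (metis card_1_singletonE)
  then have lk: "l \<noteq> k" and UNIV: "UNIV = {k, l}" by auto
  have \<kappa>1: "\<kappa> < 1" using \<kappa> \<open>card (UNIV - {k}) = 1\<close> n by simp
  define w where "w = \<bar>D $ l $ l\<bar>"
  have form_l: "form q l = D $ l $ l * of_int (q l)" if "q k = 0" for q
    using that lk by (simp add: form_def matrix_vector_mult_def UNIV)
  have "w > 0"
  proof (rule ccontr)
    assume "\<not> w > 0"
    then have D0: "D $ l $ l = 0" by (simp add: w_def)
    have "D *v axis l 1 = 0"
    proof (rule vec_eq_iff[THEN iffD2], rule allI)
      fix i
      have "i = k \<or> i = l" using UNIV by blast
      then show "(D *v axis l 1) $ i = 0 $ i"
      proof
        assume "i = k"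
        then show ?thesis using row_k[of "axis l 1"] lk by (simp add: axis_def)
      next
        assume "i = l"
        then show ?thesis using lk D0 by (simp add: matrix_vector_mult_def UNIV axis_def)
      qed
    qed
    moreover obtain D' where "D' ** D = mat 1"
      using det_D invertible_det_nz unfolding invertible_def by blast
    ultimately have "axis l (1::real) = 0"
      by (metis matrix_vector_mul_assoc matrix_vector_mul_lid matrix_vector_mult_0_right)
    then show False by (simp add: axis_eq_0_iff)
  qed
  show ?thesis
  proof (rule that[OF \<open>w > 0\<close>])
    fix t0
    from AE_torus_component[OF AE_small_value_one_form[OF \<kappa>(1) \<kappa>1 \<open>w > 0\<close>, of t0], where c = "\<gamma>0 l" and l = l]
    show "AE \<gamma> in torus_measure. \<exists>t\<ge>t0. \<exists>p::int. \<exists>q. q k = 0 \<and>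
      (\<forall>j\<in>UNIV - {k}. w \<le> \<bar>form q j\<bar> \<and> \<bar>form q j\<bar> \<le> exp t) \<and>
      \<bar>of_int p + (\<Sum>l\<in>UNIV. (\<gamma>0 l + \<gamma> l) * of_int (q l))\<bar> * (\<Prod>j\<in>UNIV - {k}. \<bar>form q j\<bar>) \<le> t powr (- \<kappa>)"
    proof eventually_elim
      case (elim \<gamma>)
      then obtain t p and b :: int where t: "t0 \<le> t" "1 \<le> b" "w * of_int b \<le> exp t"
        "\<bar>of_int p + frac (\<gamma> l + \<gamma>0 l) * of_int b\<bar> * (w * of_int b) \<le> t powr (- \<kappa>)" by blast
      define q where "q i = (if i = l then b else 0)" for i
      have qk: "q k = 0" using lk by (simp add: q_def)
      have f: "\<bar>form q l\<bar> = w * of_int b" using form_l[of q, OF qk] t(2) by (simp add: q_def w_def abs_mult)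
      \<comment> \<open>The integer removed by \<open>frac\<close>, multiplied by \<open>b\<close>,
        is moved into the free integer.\<close>
      have eq: "of_int (p - \<lfloor>\<gamma> l + \<gamma>0 l\<rfloor> * b) + (\<Sum>i\<in>UNIV. (\<gamma>0 i + \<gamma> i) * of_int (q i))
         = of_int p + frac (\<gamma> l + \<gamma>0 l) * of_int b"
        using lk by (simp add: UNIV q_def frac_def algebra_simps)
      have "\<bar>of_int (p - \<lfloor>\<gamma> l + \<gamma>0 l\<rfloor> * b) + (\<Sum>i\<in>UNIV. (\<gamma>0 i + \<gamma> i) * of_int (q i))\<bar> *
          (\<Prod>j\<in>UNIV - {k}. \<bar>form q j\<bar>) \<le> t powr (- \<kappa>)"
        unfolding eq using t(4) f by (simp add: l)
      moreover have "\<forall>j\<in>UNIV - {k}. w \<le> \<bar>form q j\<bar> \<and> \<bar>form q j\<bar> \<le> exp t"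
        using f t(2,3) \<open>w > 0\<close> by (simp add: l)
      ultimately show ?case using t(1) qk by blast
    qed
  qed
qed

end

section \<open>From a small product to a lattice vector in the region\<close>

lemma shear_mult_vec:
  "shear k \<gamma> *v z = (\<chi> i. if i = k then z $ k + (\<Sum>l\<in>UNIV - {k}. \<gamma> l * z $ l) else z $ i)"
proof -
  have "(shear k \<gamma> *v z) $ i = (if i = k then z $ k + (\<Sum>l\<in>UNIV - {k}. \<gamma> l * z $ l) else z $ i)" for i
  proof (cases "i = k")
    case True
    have "(shear k \<gamma> *v z) $ i = (\<Sum>l\<in>UNIV. (if l = k then 1 else \<gamma> l) * z $ l)"
      unfolding matrix_vector_mult_def shear_def vec_lambda_beta using True by (intro sum.cong) auto
    also have "\<dots> = z $ k + (\<Sum>l\<in>UNIV - {k}. (if l = k then 1 else \<gamma> l) * z $ l)"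
      by (subst sum.remove[of UNIV k]) auto
    finally show ?thesis using True by simp
  next
    case False
    have "(shear k \<gamma> *v z) $ i = (\<Sum>l\<in>UNIV. if i = l then z $ l else 0)"
      unfolding matrix_vector_mult_def shear_def vec_lambda_beta using False by (intro sum.cong) auto
    then show ?thesis using False by simp
  qed
  then show ?thesis by (simp add: vec_eq_iff)
qed

text \<open>The box gives every coordinate the same slack \<open>t powr \<delta>\<close>. With
  \<open>d = m + 1\<close> coordinates the slacks multiply to \<open>t powr \<kappa>\<close>,
  precisely what the small product permits. The conditions in \<open>large\<close> can be met for
  large \<open>t\<close> when \<open>\<alpha> < \<delta>\<close>.\<close>

lemma approx_regionI:
  fixes V :: "real^'n" and k :: 'n and F :: "'n \<Rightarrow> real"
  defines "m \<equiv> card (UNIV - {k})"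
  assumes V: "V \<noteq> 0" and \<alpha>: "0 < \<alpha>" and \<eta>: "0 < \<eta>" and t: "1 \<le> t" and m: "1 \<le> m"
    and \<delta>: "\<delta> = \<kappa> / (real m + 1)"
    and F: "\<And>j. j \<noteq> k \<Longrightarrow> \<eta> \<le> F j \<and> F j \<le> exp t"
    and Vj: "\<And>j. j \<noteq> k \<Longrightarrow> \<bar>V $ j\<bar> \<le> C * F j"
    and Vk: "\<bar>V $ k\<bar> * (\<Prod>j\<in>UNIV - {k}. F j) \<le> C * t powr (- \<kappa>)"
    and large: "max (real N) 2 \<le> \<eta> * t powr \<delta>" "1 / (\<eta> * t powr \<delta>) ^ m \<le> exp t * t powr \<delta>"
      "\<delta> * ln t \<le> t" "C < (2 * t) powr (- \<alpha>) * t powr \<delta>"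
  shows "V \<in> approx_region \<alpha> N"
proof -
  let ?J = "UNIV - {k}" and ?s = "t powr \<delta>"
  define P where "P = (\<Prod>j\<in>?J. F j)"
  \<comment> \<open>The entry at \<open>k\<close> is forced by the requirement that the product of
    all entries be one.\<close>
  define T :: "real^'n" where "T = (\<chi> j. if j = k then 1 / (?s ^ m * P) else F j * ?s)"
  have Fpos: "0 < F j" if "j \<noteq> k" for j using F[OF that] \<eta> by linarith
  have P: "0 < P" unfolding P_def using Fpos by (intro prod_pos) auto
  have s: "0 < ?s" using t by simp
  have "(\<Prod>p\<in>UNIV. T $ p) = T $ k * (\<Prod>p\<in>?J. T $ p)"
    by (rule prod.remove) auto
  also have "(\<Prod>p\<in>?J. T $ p) = (\<Prod>p\<in>?J. F p * ?s)"
    by (intro prod.cong) (auto simp: T_def)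
  also have "\<dots> = P * ?s ^ m" by (simp only: prod.distrib prod_constant P_def m_def)
  also have "T $ k = 1 / (?s ^ m * P)" by (simp add: T_def)
  finally have "(\<Prod>p\<in>UNIV. T $ p) = 1" using P s by (simp add: mult.commute)
  moreover have Tpos: "0 < T $ p" for p using Fpos P s by (simp add: T_def)
  ultimately have Tdiag: "T \<in> diag_params" by (simp add: diag_params_def)
  obtain j0 where j0: "j0 \<noteq> k"
  proof -
    have "?J \<noteq> {}" using m unfolding m_def by (metis card.empty not_one_le_zero)
    then show ?thesis using that by blast
  qed
  \<comment> \<open>Two bounds on \<open>max_coord T\<close> are needed: from below to reach
    \<open>N\<close>, and from above so that its logarithm is at most \<open>2 * t\<close>.\<close>
  have "\<eta> * ?s \<le> T $ j0" using F[OF j0] j0 s by (simp add: T_def)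
  then have max_ge: "\<eta> * ?s \<le> max_coord T" using max_coord_ge[of T j0] by linarith
  have "T $ p \<le> exp t * ?s" for p
  proof (cases "p = k")
    case True
    have "\<eta> ^ m \<le> P" unfolding P_def m_def prod_constant[symmetric] using F \<eta> by (intro prod_mono) auto
    then have "1 / (?s ^ m * P) \<le> 1 / (?s ^ m * \<eta> ^ m)"
      using s \<eta> P by (intro divide_left_mono mult_left_mono mult_pos_pos) auto
    then show ?thesis using large(2) True by (simp add: T_def power_mult_distrib mult.commute)
  next
    case False
    then show ?thesis using F s by (simp add: T_def)
  qed
  then have max_le: "max_coord T \<le> exp t * ?s"
    unfolding max_coord_def by (subst Max_le_iff) auto
  have m2: "max_coord T \<ge> 2" using max_ge large(1) by simp
  then have lnpos: "0 < ln (max_coord T)" by simp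
  have "ln (max_coord T) \<le> ln (exp t * ?s)" using max_le m2 by (intro ln_mono) auto
  also have "\<dots> = t + \<delta> * ln t" using s t by (simp add: ln_mult ln_powr)
  also have "\<dots> \<le> 2 * t" using large(3) by simp
  finally have c: "(2 * t) powr (- \<alpha>) \<le> ln (max_coord T) powr (- \<alpha>)"
    using lnpos \<alpha> by (intro powr_mono2') auto
  have "\<bar>V $ p\<bar> < ln (max_coord T) powr (- \<alpha>) * T $ p" for p
  proof -
    have "\<bar>V $ p\<bar> < (2 * t) powr (- \<alpha>) * T $ p"
    proof (cases "p = k")
      case False
      have "\<bar>V $ p\<bar> \<le> C * F p" using Vj[OF False] .
      also have "\<dots> < (2 * t) powr (- \<alpha>) * ?s * F p" using large(4) Fpos[OF False] by simp
      finally show ?thesis using False by (simp add: T_def mult_ac)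
    next
      case True
      have "t powr (- \<kappa>) = 1 / (?s * ?s ^ m)"
      proof -
        have "\<kappa> = (1 + real m) * \<delta>" unfolding \<delta> by (simp add: add.commute)
        then have "\<kappa> = \<delta> + real m * \<delta>" by (simp only: distrib_right mult_1_left)
        then have "t powr \<kappa> = ?s * ?s ^ m"
          using t by (simp add: powr_add powr_realpow[symmetric] powr_powr mult.commute)
        then show ?thesis by (simp add: powr_minus_divide)
      qed
      then have "\<bar>V $ k\<bar> * P \<le> C * (1 / (?s * ?s ^ m))" using Vk by (simp only: P_def)
      then have "\<bar>V $ k\<bar> \<le> C * (1 / (?s * ?s ^ m)) / P" by (simp only: pos_le_divide_eq[OF P])
      also have "\<dots> = C * (1 / ?s * (1 / (?s ^ m * P)))" by simp
      also have "\<dots> < (2 * t) powr (- \<alpha>) * ?s * (1 / ?s * (1 / (?s ^ m * P)))"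
        using large(4) s P by (intro mult_strict_right_mono) auto
      also have "\<dots> = (2 * t) powr (- \<alpha>) * (1 / (?s ^ m * P))" using s by simp
      finally show ?thesis using True by (simp add: T_def)
    qed
    also have "\<dots> \<le> ln (max_coord T) powr (- \<alpha>) * T $ p"
      using c Tpos[of p] by (intro mult_right_mono) auto
    finally show ?thesis .
  qed
  moreover have "real N \<le> max_coord T" using max_ge large(1) by simp
  ultimately show ?thesis
    unfolding approx_region_def using Tdiag V by blast
qed

text \<open>For an integer vector with entry \<open>p\<close> at \<open>k\<close> and
  \<open>q\<close> elsewhere, the image has coordinate \<open>x $ k $ k * y\<close> at
  \<open>k\<close> and \<open>form q j + x $ j $ k * y\<close> at \<open>j \<noteq> k\<close>, where
  \<open>y\<close> is the random inner quantity of \<open>AE_small_value\<close>. A bounded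
  \<open>y\<close> makes coordinate \<open>j\<close> at most a constant times its form.\<close>

lemma AE_shear_meets:
  fixes x :: "real^'n^'n" and k :: 'n
  assumes n: "CARD('n) \<ge> 2" and x: "x \<in> special_linear" "x $ k $ k \<noteq> 0"
    and \<alpha>: "0 < \<alpha>" "\<alpha> < (real CARD('n) - 1) / real CARD('n)"
  shows "AE \<gamma> in torus_measure. lattice_of (x ** shear k \<gamma>) \<inter> approx_region \<alpha> N \<noteq> {}"
proof -
  let ?m = "card (UNIV - {k})"
  define M where "M = x $ k $ k"
  \<comment> \<open>Gaussian elimination with pivot \<open>M\<close>: a multiple of row
    \<open>k\<close> clears column \<open>k\<close> from each other row, so these rows are
    unaffected when multiples of column \<open>k\<close> are added to other columns.\<close>
  define D :: "real^'n^'n" where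
    "D = (\<chi> i j. if i = k then (if j = k then 1 else 0) else x $ i $ j - x $ i $ k / M * x $ k $ j)"
  have Dk: "(D *v v) $ k = v $ k" for v
  proof -
    have "(D *v v) $ k = (\<Sum>j\<in>UNIV. if j = k then v $ j else 0)"
      unfolding matrix_vector_mult_def D_def vec_lambda_beta by (intro sum.cong) auto
    then show ?thesis by simp
  qed
  have Dj: "(D *v v) $ j = (x *v v) $ j - x $ j $ k / M * (x *v v) $ k" if "j \<noteq> k" for j v
    using that by (simp add: D_def matrix_vector_mult_def sum_subtractf sum_distrib_left left_diff_distrib mult.assoc)
  have xe: "(x *v axis k 1) $ j = x $ j $ k" for j
    by (simp add: matrix_vector_mult_basis column_def)
  have detx: "det x = 1" using x by (simp add: special_linear_def)
  have inj: "v = 0" if "x *v v = 0" for v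
  proof -
    obtain x' where "x' ** x = mat 1"
      using detx invertible_det_nz[of x] unfolding invertible_def by auto
    then show ?thesis using that
      by (metis matrix_vector_mul_assoc matrix_vector_mul_lid matrix_vector_mult_0_right)
  qed
  have "v = 0" if v: "D *v v = 0" for v
  proof -
    let ?c = "(x *v v) $ k / M"
    have "x *v (v - ?c *\<^sub>R axis k 1) = 0"
    proof (rule vec_eq_iff[THEN iffD2], rule allI)
      fix j
      have "(x *v (v - ?c *\<^sub>R axis k 1)) $ j = (x *v v) $ j - ?c * x $ j $ k"
        by (simp add: matrix_vector_mult_diff_distrib matrix_vector_mult_scaleR xe)
      also have "\<dots> = 0"
        using Dj[of j v] v x(2) by (cases "j = k") (auto simp: M_def)
      finally show "(x *v (v - ?c *\<^sub>R axis k 1)) $ j = 0 $ j" by simp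
    qed
    then have eq: "v = ?c *\<^sub>R axis k 1" using inj by fastforce
    moreover have "v $ k = 0" using Dk[of v] v by simp
    ultimately have "?c = 0" by (metis axis_nth mult_1_right real_scaleR_def vector_scaleR_component)
    with eq have "v = 0 *\<^sub>R axis k 1" by (simp only:)
    then show ?thesis by simp
  qed
  then have "det D \<noteq> 0"
    using matrix_left_invertible_ker[of D] invertible_det_nz[of D] invertible_left_inverse[of D] by blast
  then interpret linear_forms k D using Dk by unfold_locales auto
  \<comment> \<open>The midpoint of \<open>\<alpha> * d\<close> and \<open>d - 1\<close>, so that
    both \<open>\<alpha> < \<kappa> / d\<close> and \<open>\<kappa> < d - 1\<close> hold.\<close>
  define \<kappa> where "\<kappa> = (\<alpha> * real CARD('n) + (real CARD('n) - 1)) / 2"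
  have *: "\<alpha> * real CARD('n) < real CARD('n) - 1" using \<alpha> n by (simp add: field_simps)
  have \<kappa>: "0 < \<kappa>" "\<kappa> < real CARD('n) - 1" "\<alpha> < \<kappa> / real CARD('n)"
  proof -
    have d: "2 \<le> real CARD('n)" using n by simp
    then have "0 < \<alpha> * real CARD('n)" using \<alpha> by simp
    moreover have "0 < (b + c) / 2 \<and> (b + c) / 2 < c \<and> b < (b + c) / 2" if "0 < b" "b < c" for b c :: real
      using that by (auto simp: field_simps)
    ultimately have **: "0 < \<kappa> \<and> \<kappa> < real CARD('n) - 1 \<and> \<alpha> * real CARD('n) < \<kappa>"
      using * unfolding \<kappa>_def by blast
    then show "0 < \<kappa>" "\<kappa> < real CARD('n) - 1" by blast+
    have "\<alpha> * real CARD('n) < \<kappa>" using ** by blast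
    then show "\<alpha> < \<kappa> / real CARD('n)" using d by (simp add: field_simps)
  qed
  \<comment> \<open>Row \<open>k\<close> of \<open>x\<close> divided by its pivot: the contribution
    of the unsheared matrix to coordinate \<open>k\<close>, measured in units of
    \<open>M\<close>.\<close>
  define \<gamma>0 where "\<gamma>0 l = (if l = k then 0 else x $ k $ l / M)" for l
  obtain \<eta> where \<eta>: "\<eta> > 0" and AE: "\<And>t0. AE \<gamma> in torus_measure. \<exists>t\<ge>t0. \<exists>p::int. \<exists>q. q k = 0 \<and>
    (\<forall>j\<in>UNIV - {k}. \<eta> \<le> \<bar>form q j\<bar> \<and> \<bar>form q j\<bar> \<le> exp t) \<and>
    \<bar>of_int p + (\<Sum>l\<in>UNIV. (\<gamma>0 l + \<gamma> l) * of_int (q l))\<bar> * (\<Prod>j\<in>UNIV - {k}. \<bar>form q j\<bar>) \<le> t powr (- \<kappa>)"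
    using AE_small_value[OF n \<kappa>(1,2)] by blast
  define R where "R = (\<Sum>j\<in>UNIV. \<bar>x $ j $ k\<bar>)"
  \<comment> \<open>The 1 pays for \<open>form q j\<close>, the last term for
    \<open>x $ j $ k * y\<close>, using that \<open>y\<close> is at most \<open>1 / \<eta>^m\<close>
    in absolute value and the form at least \<open>\<eta>\<close>; the middle \<open>R\<close> pays
    for the entry \<open>x $ k $ k\<close> in coordinate \<open>k\<close>.\<close>
  define C where "C = 1 + R + R / \<eta> ^ Suc ?m"
  define \<delta> where "\<delta> = \<kappa> / real CARD('n)"
  have \<delta>: "\<alpha> < \<delta>" "0 < \<delta>" using \<kappa>(3) \<alpha> by (auto simp: \<delta>_def)
  have m: "1 \<le> ?m" "real CARD('n) = real ?m + 1" using n by (auto simp: of_nat_diff)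
  have R: "\<bar>x $ j $ k\<bar> \<le> R" for j unfolding R_def by (rule member_le_sum) auto
  have R0: "0 \<le> R" unfolding R_def by (intro sum_nonneg) auto
  have "\<forall>\<^sub>F t in at_top. max (real N) 2 \<le> \<eta> * t powr \<delta>"
    using \<eta> \<delta> by real_asymp
  moreover have "\<forall>\<^sub>F t in at_top. 1 / (\<eta> * t powr \<delta>) ^ ?m \<le> exp t * t powr \<delta>"
  proof -
    have "\<forall>\<^sub>F t in at_top. 1 \<le> \<eta> * t powr \<delta>" using \<eta> \<delta> by real_asymp
    moreover have "\<forall>\<^sub>F t in at_top. 1 \<le> exp t * t powr \<delta>" using \<delta> by real_asymp
    ultimately show ?thesis
    proof eventually_elim
      case (elim t)
      then have "1 \<le> (\<eta> * t powr \<delta>) ^ ?m" by (intro one_le_power)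
      then have "1 / (\<eta> * t powr \<delta>) ^ ?m \<le> 1" by simp
      then show ?case using elim by linarith
    qed
  qed
  moreover have "\<forall>\<^sub>F t in at_top. \<delta> * ln t \<le> t" using \<delta> by real_asymp
  moreover have "\<forall>\<^sub>F t in at_top. C < (2 * t) powr (- \<alpha>) * t powr \<delta>"
  proof -
    have "\<forall>\<^sub>F t in at_top. C * 2 powr \<alpha> < t powr (\<delta> - \<alpha>)" using \<delta> by real_asymp
    then show ?thesis using eventually_gt_at_top[of 0]
    proof eventually_elim
      case (elim t)
      then have "C < 2 powr (- \<alpha>) * t powr (\<delta> - \<alpha>)" by (simp add: powr_minus field_simps)
      also have "\<dots> = (2 * t) powr (- \<alpha>) * t powr \<delta>"
        using elim by (simp add: powr_mult powr_diff powr_minus field_simps)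
      finally show ?case .
    qed
  qed
  moreover have "\<forall>\<^sub>F t::real in at_top. 1 \<le> t" by (rule eventually_ge_at_top)
  ultimately have "\<forall>\<^sub>F t in at_top. max (real N) 2 \<le> \<eta> * t powr \<delta> \<and> 1 / (\<eta> * t powr \<delta>) ^ ?m \<le> exp t * t powr \<delta> \<and>
      \<delta> * ln t \<le> t \<and> C < (2 * t) powr (- \<alpha>) * t powr \<delta> \<and> 1 \<le> t"
    by eventually_elim blast
  then obtain t0 where t0: "\<And>t. t \<ge> t0 \<Longrightarrow> max (real N) 2 \<le> \<eta> * t powr \<delta> \<and> 1 / (\<eta> * t powr \<delta>) ^ ?m \<le> exp t * t powr \<delta> \<and>
      \<delta> * ln t \<le> t \<and> C < (2 * t) powr (- \<alpha>) * t powr \<delta> \<and> 1 \<le> t"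
    by (auto simp: eventually_at_top_linorder)
  obtain j0 where j0: "j0 \<noteq> k"
  proof -
    have "UNIV - {k} \<noteq> {}" using m(1) by (metis card.empty not_one_le_zero)
    then show ?thesis using that by blast
  qed
  from AE[of t0] show ?thesis
  proof eventually_elim
    case (elim \<gamma>)
    then obtain t p q where t: "t \<ge> t0" and q: "q k = 0"
      and f: "\<And>j. j \<noteq> k \<Longrightarrow> \<eta> \<le> \<bar>form q j\<bar> \<and> \<bar>form q j\<bar> \<le> exp t"
      and sm: "\<bar>of_int p + (\<Sum>l\<in>UNIV. (\<gamma>0 l + \<gamma> l) * of_int (q l))\<bar> * (\<Prod>j\<in>UNIV - {k}. \<bar>form q j\<bar>) \<le> t powr (- \<kappa>)"
      by blast
    note t0 = t0[OF t]
    define y where "y = of_int p + (\<Sum>l\<in>UNIV. (\<gamma>0 l + \<gamma> l) * of_int (q l))"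
    define u :: "real^'n" where "u = (\<chi> l. of_int (q l))"
    define z :: "real^'n" where "z = (\<chi> l. if l = k then of_int p else of_int (q l))"
    define s where "s = of_int p + (\<Sum>l\<in>UNIV. \<gamma> l * of_int (q l))"
    define V where "V = (x ** shear k \<gamma>) *v z"
    have zint: "z \<in> integer_vectors" by (simp add: z_def integer_vectors_def)
    have uk: "u $ k = 0" using q by (simp add: u_def)
    have "shear k \<gamma> *v z = u + s *\<^sub>R axis k 1"
    proof -
      have "(\<Sum>l\<in>UNIV. \<gamma> l * of_int (q l)) = (\<Sum>l\<in>UNIV - {k}. \<gamma> l * z $ l)"
        using q by (subst sum.remove[of UNIV k]) (auto simp: z_def)
      then show ?thesis
        unfolding shear_mult_vec vec_eq_iff using q by (auto simp: u_def s_def z_def axis_def)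
    qed
    then have "V = x *v u + s *\<^sub>R (x *v axis k 1)"
      by (simp add: V_def matrix_vector_mul_assoc[symmetric] matrix_vector_right_distrib matrix_vector_mult_scaleR)
    then have Vc: "V $ j = (x *v u) $ j + s * x $ j $ k" for j by (simp add: xe)
    have xuk: "(x *v u) $ k = M * (\<Sum>l\<in>UNIV. \<gamma>0 l * of_int (q l))"
    proof -
      have "(x *v u) $ k = (\<Sum>l\<in>UNIV. M * (\<gamma>0 l * of_int (q l)))"
        unfolding matrix_vector_mult_def using q x(2)
        by simp (intro sum.cong, auto simp: \<gamma>0_def u_def M_def)
      then show ?thesis by (simp add: sum_distrib_left)
    qed
    have ys: "y = s + (x *v u) $ k / M"
      using x(2) by (simp add: y_def s_def xuk M_def[symmetric] distrib_right sum.distrib)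
    have Vk: "V $ k = x $ k $ k * y"
      using x(2) by (simp add: Vc ys M_def[symmetric] field_simps)
    have Vj: "V $ j = form q j + x $ j $ k * y" if "j \<noteq> k" for j
    proof -
      have "form q j = (x *v u) $ j - x $ j $ k / M * (x *v u) $ k"
        unfolding form_def u_def[symmetric] by (rule Dj[OF that])
      then show ?thesis by (simp add: Vc ys algebra_simps)
    qed
    have Pge: "\<eta> ^ ?m \<le> (\<Prod>j\<in>UNIV - {k}. \<bar>form q j\<bar>)"
      unfolding prod_constant[symmetric] using f \<eta> by (intro prod_mono) auto
    have "t powr (- \<kappa>) \<le> 1" using t0 \<kappa>(1) powr_mono[of "- \<kappa>" 0 t] by simp
    have "\<bar>y\<bar> * \<eta> ^ ?m \<le> \<bar>y\<bar> * (\<Prod>j\<in>UNIV - {k}. \<bar>form q j\<bar>)"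
      using Pge by (intro mult_left_mono) auto
    also have "\<dots> \<le> 1" using sm \<open>t powr (- \<kappa>) \<le> 1\<close> by (simp add: y_def)
    finally have ysmall: "\<bar>y\<bar> \<le> 1 / \<eta> ^ ?m" using \<eta> by (simp add: field_simps)
    have "V \<in> approx_region \<alpha> N"
    proof (rule approx_regionI[where k = k and t = t and \<delta> = \<delta> and C = C and \<eta> = \<eta> and \<kappa> = \<kappa> and F = "\<lambda>j. \<bar>form q j\<bar>"])
      show "V \<noteq> 0"
      proof
        assume "V = 0"
        then have "shear k \<gamma> *v z = 0" using inj by (simp add: V_def matrix_vector_mul_assoc[symmetric])
        moreover have "(shear k \<gamma> *v z) $ j = of_int (q j)" if "j \<noteq> k" for j
          using that by (simp add: shear_mult_vec z_def)
        ultimately have "q j = 0" if "j \<noteq> k" for j using that by (metis of_int_eq_0_iff zero_index)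
        then have "q = (\<lambda>l. 0)" using q by fastforce
        then have "form q j0 = 0" by (simp add: form_def vec_eq_iff matrix_vector_mult_def)
        then show False using f[OF j0] \<eta> by simp
      qed
      show "\<delta> = \<kappa> / (real ?m + 1)" by (simp only: \<delta>_def m(2))
      show "\<bar>V $ j\<bar> \<le> C * \<bar>form q j\<bar>" if j: "j \<noteq> k" for j
      proof -
        have "\<bar>x $ j $ k * y\<bar> \<le> R * (1 / \<eta> ^ ?m)"
          unfolding abs_mult using R ysmall R0 by (intro mult_mono) auto
        also have "\<dots> = R / \<eta> ^ Suc ?m * \<eta>"
          using \<eta> by (simp only: power_Suc) (simp add: divide_simps del: card_Diff_insert)
        also have "\<dots> \<le> R / \<eta> ^ Suc ?m * \<bar>form q j\<bar>"
          using f[OF j] R0 \<eta> by (intro mult_left_mono) auto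
        finally have "\<bar>V $ j\<bar> \<le> \<bar>form q j\<bar> + R / \<eta> ^ Suc ?m * \<bar>form q j\<bar>"
          unfolding Vj[OF j] by linarith
        also have "\<dots> \<le> C * \<bar>form q j\<bar>"
          using mult_nonneg_nonneg[OF R0 abs_ge_zero[of "form q j"]] unfolding C_def distrib_right by linarith
        finally show ?thesis .
      qed
      have "\<bar>V $ k\<bar> * (\<Prod>j\<in>UNIV - {k}. \<bar>form q j\<bar>) = \<bar>x $ k $ k\<bar> * (\<bar>y\<bar> * (\<Prod>j\<in>UNIV - {k}. \<bar>form q j\<bar>))"
        by (simp add: Vk abs_mult)
      also have "\<dots> \<le> C * t powr (- \<kappa>)"
      proof (intro mult_mono)
        show "\<bar>x $ k $ k\<bar> \<le> C" using R[of k] R0 \<eta> unfolding C_def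
          by (smt (verit) divide_nonneg_pos zero_less_power)
        show "0 \<le> C" using R0 \<eta> by (simp add: C_def)
      qed (use sm in \<open>auto simp: y_def intro!: prod_nonneg mult_nonneg_nonneg\<close>)
      finally show "\<bar>V $ k\<bar> * (\<Prod>j\<in>UNIV - {k}. \<bar>form q j\<bar>) \<le> C * t powr (- \<kappa>)" .
    qed (use t0 f m(1) \<alpha>(1) \<eta> in auto)
    moreover have "V \<in> lattice_of (x ** shear k \<gamma>)"
      using zint by (auto simp: V_def lattice_of_def)
    ultimately show ?case by blast
  qed
qed

theorem theorem1p1:
  fixes \<mu> :: "(real^'n) set measure"
  assumes "CARD('n) \<ge> 2"
    and "invariant_lattice_measure \<mu>"
  shows "AE \<Lambda> in \<mu>.
    Limsup diag_at_infinity
      (\<lambda>T. ereal (- (ln (lattice_min (box_of T) \<Lambda>) / ln (ln (max_coord T)))))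
    \<ge> ereal ((real CARD('n) - 1) / real CARD('n))"
proof -
  let ?b = "(real CARD('n) - 1) / real CARD('n)"
  have b: "0 < ?b" using assms(1) by simp
  \<comment> \<open>Exponents strictly below the bound and converging to it: the shear argument
    needs strict inequality, and countably many exceptional null sets may be discarded.\<close>
  define a where "a i = ?b * (1 - 1 / (real i + 2))" for i :: nat
  have a: "0 < a i" "a i < ?b" for i
  proof -
    have "0 < 1 - 1 / (real i + 2)" "1 - 1 / (real i + 2) < 1" by (auto simp: field_simps)
    then show "0 < a i" "a i < ?b"
      unfolding a_def using mult_pos_pos[OF b] mult_strict_left_mono[of _ 1 ?b, OF _ b] by (blast, fastforce)
  qed
  have "a \<longlonglongrightarrow> ?b * (1 - 0)"
    unfolding a_def by (intro tendsto_intros) real_asymp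
  then have lim: "(\<lambda>i. ereal (a i)) \<longlonglongrightarrow> ereal ?b" by simp
  \<comment> \<open>Any coordinate can serve as the pivot.\<close>
  fix k :: 'n
  have space: "space \<mu> = unimodular_lattices"
    using assms(2) sets_eq_imp_space_eq space_lattice_borel unfolding invariant_lattice_measure_def by metis
  have "AE \<Lambda> in \<mu>. \<Lambda> \<inter> approx_region (a i) N \<noteq> {}" for i N
    using AE_meets_lattice[OF assms(2) open_approx_region AE_meets_matrix[OF open_approx_region]]
      AE_shear_meets[OF assms(1)] a by blast
  then have "AE \<Lambda> in \<mu>. \<forall>i N. \<Lambda> \<inter> approx_region (a i) N \<noteq> {}"
    by (simp add: AE_all_countable)
  with AE_space show ?thesis
  proof eventually_elim
    case (elim \<Lambda>)
    then have "ereal (a i) \<le> Limsup diag_at_infinity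
      (\<lambda>T. ereal (- (ln (lattice_min (box_of T) \<Lambda>) / ln (ln (max_coord T)))))" for i
      by (intro Limsup_ge_of_meets) (auto simp: space)
    then show ?case using lim by (intro LIMSEQ_le_const2[OF lim]) auto
  qed
qed

end
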